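(* Let $k\in\{2,3,4\}$, $0<\varepsilon\ll 1$ and $\lambda\ge 1$. Let $\beta\in C^\infty_c(B(0,\varepsilon))$, $\beta:\mathbb{R}^2\to\mathbb{R}$, and let $h:\mathbb{R}^2\to\mathbb{R}$ be a smooth function with $$h(u,v)=v^2\pm u^k+f(u,v)\quad\text{for }(u,v)\in B(0,\varepsilon)$$ (for one choice of the sign), where $f(u,v)=\mathcal{O}(|v|^3+|v|^2|u|+|u|^{k+1})$ and $$|\partial^\alpha f(u,v)|\le C_\alpha\min(\varepsilon^{3-|\alpha|},1)$$ for all multi-indices $\alpha$. For $x_1,x_2\in\mathbb{R}$ set $$I_\Phi(\lambda)=\int_{\mathbb{R}^2} e^{i\lambda\Phi(u,v)}\beta(u,v)\,du\,dv,\qquad \Phi(u,v)=\frac{x_1}{\lambda}u+\frac{x_2}{\lambda}v+h(u,v).$$ Then $$|I_\Phi(\lambda)|\le C\lambda^{-\frac12-\frac1k},$$ with a constant $C$ that is uniform in $x_1,x_2$ with $|x_i|\le 10\varepsilon\lambda$ ($i=1,2$) and depends only on $\mathrm{supp}(\beta)$ and $\|\beta\|_{C^N}$ for some fixed $N$.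
   Context: $B(0,\varepsilon)$ is the ball of radius $\varepsilon$ about the origin in $\mathbb{R}^2$. The constants $C_\alpha$ and the implicit constant in the $\mathcal{O}$-condition on $f$ are regarded as fixed; $0<\varepsilon\ll1$ means that $\varepsilon$ is sufficiently small relative to these fixed constants. $\|\beta\|_{C^N}$ is the sup norm of the derivatives of $\beta$ up to order $N$. *)

theory Defs
  imports "HOL-Analysis.Analysis"
begin

text \<open>Meaningful for open \<open>S\<close>: all iterated directional derivatives up to order \<open>n\<close> exist
  and are (totally) differentiable on \<open>S\<close>, those of order \<open>n\<close> being continuous; that is,
  \<open>f\<close> is of class \<open>C\<^sup>n\<close> on \<open>S\<close>.\<close>

fun Cn_on :: "nat \<Rightarrow> 'a::real_normed_vector set \<Rightarrow> ('a \<Rightarrow> 'b::real_normed_vector) \<Rightarrow> bool"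
  where
    "Cn_on 0 S f \<longleftrightarrow> continuous_on S f"
  | "Cn_on (Suc n) S f \<longleftrightarrow>
      (\<forall>x\<in>S. f differentiable (at x)) \<and> (\<forall>w. Cn_on n S (\<lambda>x. frechet_derivative f (at x) w))"

definition smooth_on :: "'a::real_normed_vector set \<Rightarrow> ('a \<Rightarrow> 'b::real_normed_vector) \<Rightarrow> bool"
  where "smooth_on S f \<longleftrightarrow> (\<forall>n. Cn_on n S f)"

definition partial_u :: "(real \<times> real \<Rightarrow> real) \<Rightarrow> real \<times> real \<Rightarrow> real"
  where "partial_u g = (\<lambda>(u, v). deriv (\<lambda>t. g (t, v)) u)"

definition partial_v :: "(real \<times> real \<Rightarrow> real) \<Rightarrow> real \<times> real \<Rightarrow> real"
  where "partial_v g = (\<lambda>(u, v). deriv (\<lambda>t. g (u, t)) v)"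

text \<open>\<open>\<partial>\<^sup>\<alpha>\<close> for the multi-index \<open>\<alpha> = (a, b)\<close>. The order in which the partial derivatives are
  taken is immaterial, since this is only applied to smooth functions. The value at a point
  depends only on the germ of \<open>g\<close> there.\<close>

definition partial_deriv :: "nat \<Rightarrow> nat \<Rightarrow> (real \<times> real \<Rightarrow> real) \<Rightarrow> real \<times> real \<Rightarrow> real"
  where "partial_deriv a b g = (partial_u ^^ a) ((partial_v ^^ b) g)"

definition supp :: "('a::topological_space \<Rightarrow> real) \<Rightarrow> 'a set"
  where "supp g = closure {x. g x \<noteq> 0}"

definition test_function_on :: "(real \<times> real) set \<Rightarrow> (real \<times> real \<Rightarrow> real) \<Rightarrow> bool"
  where "test_function_on U g \<longleftrightarrow> smooth_on UNIV g \<and> compact (supp g) \<and> supp g \<subseteq> U"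

text \<open>The real supremum is a genuine one only if the derivatives up to order \<open>N\<close> are bounded,
  as they are for test functions.\<close>

definition CN_norm :: "nat \<Rightarrow> (real \<times> real \<Rightarrow> real) \<Rightarrow> real"
  where "CN_norm N g = Sup {\<bar>partial_deriv a b g z\<bar> | a b z. a + b \<le> N}"

definition phase :: "(real \<times> real \<Rightarrow> real) \<Rightarrow> real \<Rightarrow> real \<Rightarrow> real \<Rightarrow> real \<times> real \<Rightarrow> real"
  where "phase h x1 x2 lam = (\<lambda>(u, v). x1 / lam * u + x2 / lam * v + h (u, v))"

definition osc_integral ::
    "(real \<times> real \<Rightarrow> real) \<Rightarrow> (real \<times> real \<Rightarrow> real) \<Rightarrow> real \<Rightarrow> complex"
  where "osc_integral \<beta> \<Phi> lam =
    (LINT z|lborel. exp (\<i> * complex_of_real (lam * \<Phi> z)) * complex_of_real (\<beta> z))"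

end

theory Submission
  imports Defs
begin

text \<open>Write \<open>h = v\<^sup>2 + s u\<^sup>k + F\<close>, let \<open>\<Phi>\<close> be the phase, and put
\<open>B(u) = \<integral> e\<^bsup>i\<lambda>\<Phi>(u,v)\<^esup> \<beta>(u,v) dv\<close>, so that the integral to be estimated is \<open>\<integral> B(u) du\<close>.

The direction of \<open>v\<close> is nondegenerate, \<open>\<Phi>\<^sub>v\<^sub>v = 2 + F\<^sub>v\<^sub>v\<close> being close to 2, and accounts for the factor
\<open>\<lambda>\<^bsup>-1/2\<^esup>\<close>. If \<open>v = \<gamma>(u)\<close> is the solution of \<open>\<Phi>\<^sub>v = 0\<close>, what is left is an integral over \<open>u\<close> with the
phase \<open>\<psi>(u) = \<Phi>(u, \<gamma>(u))\<close>. Differentiating the equation for \<open>\<gamma>\<close> shows that the derivative of \<open>\<psi>\<close>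
of order \<open>k\<close> is \<open>s k! + O(\<epsilon>)\<close> (\<open>\<psi>_top\<close>), so van der Corput's lemma of order \<open>k\<close> supplies the
factor \<open>\<lambda>\<^bsup>-1/k\<^esup>\<close>. It is applied to \<open>B = e\<^bsup>i\<lambda>\<psi>\<^esup> A\<close> and asks for \<open>A\<close> and \<open>A'\<close> to be \<open>O(\<lambda>\<^bsup>-1/2\<^esup>)\<close>. The
bound on \<open>A\<close> is van der Corput's lemma of order 2 in \<open>v\<close>. In \<open>A'\<close> the differentiation of the
exponential produces the amplitude \<open>i\<lambda>(\<Phi>\<^sub>u(u,v) - \<psi>'(u))\<beta>\<close>. Since \<open>\<psi>'(u) = \<Phi>\<^sub>u(u, \<gamma>(u))\<close>, this
vanishes at the critical point and therefore equals \<open>i\<lambda>\<Phi>\<^sub>v q \<beta>\<close> with a smooth quotient \<open>q\<close>; now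
\<open>i\<lambda>\<Phi>\<^sub>v e\<^bsup>i\<lambda>\<Phi>\<^esup>\<close> is a \<open>v\<close>-derivative, and one integration by parts removes the factor \<open>\<lambda>\<close>
(\<open>stationary_fiber_bound\<close>).

The critical point may lie outside the ball, where \<open>f\<close> is not controlled, so the argument above is
restricted to the set of all \<open>u\<close> for which it lies inside. This set is an interval
(\<open>crit_interval\<close>): the curve \<open>\<Phi>\<^sub>v = 0\<close> has bounded curvature, whereas the boundary of the ball has
curvature \<open>1/\<epsilon>\<close>. For every other \<open>u\<close> the derivative \<open>\<Phi>\<^sub>v\<close> is at least the distance to one end of
the fiber, and \<open>\<beta>\<close> vanishes there to second order, so that integrating by parts once
gives \<open>B(u) = O(\<lambda>\<^bsup>-1\<^esup>)\<close> (\<open>fiber_off_crit\<close>). This suffices because \<open>1/2 + 1/k \<le> 1\<close>.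

The hypotheses on \<open>f\<close> enter as follows. The derivative bounds make the second derivatives of \<open>F\<close>
of size \<open>\<epsilon>\<close> and those of order 3 to 5 bounded. The bound on \<open>|f|\<close> makes the Taylor coefficient
of \<open>u\<^sup>k\<close> at the origin vanish, and for \<open>k = 4\<close> also that of \<open>u\<^sup>2v\<close>
(\<open>weighted_flatness_uv\<close>); the corresponding derivatives are then of size \<open>\<epsilon>\<close> on the ball. All
constants are explicit in terms of a common bound \<open>K\<close> for the constants \<open>C\<^sub>\<alpha>\<close>, and two
derivatives of \<open>\<beta>\<close> are used.\<close>

section \<open>Partial derivatives of smooth functions on the plane\<close>

lemma Cn_on_UNIV_SucD: "Cn_on (Suc n) UNIV g \<Longrightarrow> Cn_on n UNIV g"
proof (induction n arbitrary: g)
  case 0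
  then show ?case
    by (auto intro!: continuous_at_imp_continuous_on differentiable_imp_continuous_within)
next
  case (Suc n)
  then show ?case by (metis Cn_on.simps(2))
qed

lemma Cn_on_const: "Cn_on n UNIV (\<lambda>x. c)"
  by (induction n arbitrary: c) auto

lemma Cn_on_bounded_linear: "bounded_linear g \<Longrightarrow> Cn_on n UNIV g"
proof (cases n)
  case (Suc m)
  assume g: "bounded_linear g"
  then have "frechet_derivative g (at x) = g" for x
    by (metis bounded_linear_imp_has_derivative frechet_derivative_at)
  with g Suc show ?thesis
    by (auto simp: Cn_on_const bounded_linear_imp_differentiable)
qed (simp add: linear_continuous_on)

lemma Cn_on_add:
  "Cn_on n UNIV f \<Longrightarrow> Cn_on n UNIV g \<Longrightarrow> Cn_on n UNIV (\<lambda>x. f x + g x)"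
proof (induction n arbitrary: f g)
  case (Suc n)
  then have "frechet_derivative (\<lambda>x. f x + g x) (at x)
      = (\<lambda>w. frechet_derivative f (at x) w + frechet_derivative g (at x) w)" for x
    by (intro frechet_derivative_at[symmetric] has_derivative_add)
      (auto simp: frechet_derivative_works)
  with Suc show ?case by auto
qed (auto intro: continuous_intros)

lemma Cn_on_mult:
  fixes f g :: "'a::real_normed_vector \<Rightarrow> real"
  shows "Cn_on n UNIV f \<Longrightarrow> Cn_on n UNIV g \<Longrightarrow> Cn_on n UNIV (\<lambda>x. f x * g x)"
proof (induction n arbitrary: f g)
  case (Suc n)
  then have "frechet_derivative (\<lambda>x. f x * g x) (at x)
      = (\<lambda>w. f x * frechet_derivative g (at x) w + frechet_derivative f (at x) w * g x)" for x
    by (intro frechet_derivative_at[symmetric] has_derivative_mult)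
      (auto simp: frechet_derivative_works)
  with Suc Suc.prems[THEN Cn_on_UNIV_SucD] show ?case by (auto intro!: Cn_on_add Suc.IH)
qed (auto intro: continuous_intros)

lemma smooth_on_add:
  "smooth_on UNIV f \<Longrightarrow> smooth_on UNIV g \<Longrightarrow> smooth_on UNIV (\<lambda>x. f x + g x)"
  by (simp add: smooth_on_def Cn_on_add)

lemma smooth_on_mult:
  fixes f g :: "'a::real_normed_vector \<Rightarrow> real"
  shows "smooth_on UNIV f \<Longrightarrow> smooth_on UNIV g \<Longrightarrow> smooth_on UNIV (\<lambda>x. f x * g x)"
  by (simp add: smooth_on_def Cn_on_mult)

lemma smooth_on_const: "smooth_on UNIV (\<lambda>x. c)"
  by (simp add: smooth_on_def Cn_on_const)

lemma smooth_on_power: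
  fixes f :: "'a::real_normed_vector \<Rightarrow> real"
  shows "smooth_on UNIV f \<Longrightarrow> smooth_on UNIV (\<lambda>x. f x ^ n)"
  by (induction n) (auto intro: smooth_on_mult smooth_on_const)

lemma smooth_on_fst: "smooth_on UNIV (fst :: real \<times> real \<Rightarrow> real)"
  and smooth_on_snd: "smooth_on UNIV (snd :: real \<times> real \<Rightarrow> real)"
  by (simp_all add: smooth_on_def Cn_on_bounded_linear bounded_linear_fst bounded_linear_snd)

lemma has_derivative_partials:
  assumes "g differentiable (at p)"
  shows "(g has_derivative (\<lambda>w. partial_u g p * fst w + partial_v g p * snd w)) (at p)"
    and "partial_u g p = frechet_derivative g (at p) (1, 0)"
    and "partial_v g p = frechet_derivative g (at p) (0, 1)"
proof -
  obtain u v where p: "p = (u, v)" by fastforce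
  let ?d = "frechet_derivative g (at p)"
  have d: "(g has_derivative ?d) (at (u, v))"
    using assms by (simp add: frechet_derivative_works p)
  interpret d: bounded_linear ?d using d by (rule has_derivative_bounded_linear)
  have "((\<lambda>t. g (t, v)) has_derivative (\<lambda>h. ?d (h, 0))) (at u)"
    by (rule has_derivative_compose[where f = "\<lambda>t. (t, v)" and f' = "\<lambda>h. (h, 0)" and g = g, OF _ d])
      (intro has_derivative_Pair has_derivative_ident has_derivative_const)
  moreover have "(\<lambda>h. ?d (h, 0)) = (*) (?d (1, 0))"
  proof
    show "?d (h, 0) = ?d (1, 0) * h" for h
      using d.scaleR[of h "(1, 0)"] by (simp only: scaleR_Pair real_scaleR_def mult_1_right mult_zero_right mult.commute[of _ "?d _"])
  qed
  ultimately have "((\<lambda>t. g (t, v)) has_real_derivative ?d (1, 0)) (at u)"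
    by (simp only: has_field_derivative_def)
  then show u: "partial_u g p = ?d (1, 0)" by (simp add: partial_u_def p DERIV_imp_deriv)
  have "((\<lambda>t. g (u, t)) has_derivative (\<lambda>h. ?d (0, h))) (at v)"
    by (rule has_derivative_compose[where f = "\<lambda>t. (u, t)" and f' = "\<lambda>h. (0, h)" and g = g, OF _ d])
      (intro has_derivative_Pair has_derivative_ident has_derivative_const)
  moreover have "(\<lambda>h. ?d (0, h)) = (*) (?d (0, 1))"
  proof
    show "?d (0, h) = ?d (0, 1) * h" for h
      using d.scaleR[of h "(0, 1)"] by (simp only: scaleR_Pair real_scaleR_def mult_1_right mult_zero_right mult.commute[of _ "?d _"])
  qed
  ultimately have "((\<lambda>t. g (u, t)) has_real_derivative ?d (0, 1)) (at v)"
    by (simp only: has_field_derivative_def)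
  then show v: "partial_v g p = ?d (0, 1)" by (simp add: partial_v_def p DERIV_imp_deriv)
  have "?d = (\<lambda>w. partial_u g p * fst w + partial_v g p * snd w)"
  proof
    fix w
    have "w = fst w *\<^sub>R (1, 0) + snd w *\<^sub>R (0, 1)" by (simp add: prod_eq_iff)
    then have "?d w = ?d (fst w *\<^sub>R (1, 0)) + ?d (snd w *\<^sub>R (0, 1))" by (metis d.add)
    then show "?d w = partial_u g p * fst w + partial_v g p * snd w"
      unfolding u v by (simp only: d.scaleR real_scaleR_def mult.commute[of "?d _"])
  qed
  then show "(g has_derivative (\<lambda>w. partial_u g p * fst w + partial_v g p * snd w)) (at p)"
    using d p by metis
qed

lemma smooth_on_differentiable: "smooth_on UNIV g \<Longrightarrow> g differentiable (at p)"
  unfolding smooth_on_def by (drule spec[of _ "Suc 0"]) simp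

lemma smooth_on_partial:
  assumes "smooth_on UNIV g"
  shows "smooth_on UNIV (partial_u g)" "smooth_on UNIV (partial_v g)"
proof -
  have g: "g differentiable (at p)" for p using assms by (rule smooth_on_differentiable)
  have "Cn_on n UNIV (\<lambda>x. frechet_derivative g (at x) w)" for n w
    using assms[unfolded smooth_on_def, rule_format, of "Suc n"] unfolding Cn_on.simps by blast
  then have d: "smooth_on UNIV (\<lambda>x. frechet_derivative g (at x) w)" for w
    by (auto simp only: smooth_on_def)
  have "partial_u g = (\<lambda>p. frechet_derivative g (at p) (1, 0))"
    by (rule ext, rule has_derivative_partials(2), rule g)
  then show "smooth_on UNIV (partial_u g)" by (simp only: d)
  have "partial_v g = (\<lambda>p. frechet_derivative g (at p) (0, 1))"
    by (rule ext, rule has_derivative_partials(3), rule g)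
  then show "smooth_on UNIV (partial_v g)" by (simp only: d)
qed

lemma partials_along_axes:
  assumes "smooth_on UNIV g"
  shows "((\<lambda>t. g (t, v)) has_real_derivative partial_u g (u, v)) (at u within S)"
    and "((\<lambda>t. g (u, t)) has_real_derivative partial_v g (u, v)) (at v within S)"
proof -
  note d = has_derivative_partials(1)[OF smooth_on_differentiable[OF assms], of "(u, v)"]
  have "((\<lambda>t. g (t, v)) has_derivative
      (\<lambda>h. partial_u g (u, v) * fst (h, 0::real) + partial_v g (u, v) * snd (h, 0::real))) (at u within S)"
    by (rule has_derivative_compose[where f = "\<lambda>t. (t, v)" and f' = "\<lambda>h. (h, 0)" and g = g, OF _ d])
      (intro has_derivative_Pair has_derivative_ident has_derivative_const)
  then show "((\<lambda>t. g (t, v)) has_real_derivative partial_u g (u, v)) (at u within S)"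
    by (simp add: has_field_derivative_def)
  have "((\<lambda>t. g (u, t)) has_derivative
      (\<lambda>h. partial_u g (u, v) * fst (0::real, h) + partial_v g (u, v) * snd (0::real, h))) (at v within S)"
    by (rule has_derivative_compose[where f = "\<lambda>t. (u, t)" and f' = "\<lambda>h. (0, h)" and g = g, OF _ d])
      (intro has_derivative_Pair has_derivative_ident has_derivative_const)
  then show "((\<lambda>t. g (u, t)) has_real_derivative partial_v g (u, v)) (at v within S)"
    by (simp add: has_field_derivative_def)
qed

lemma smooth_on_continuous: "smooth_on UNIV g \<Longrightarrow> continuous_on S g"
  using smooth_on_def[of UNIV g] Cn_on.simps(1) continuous_on_subset by blast

text \<open>The second difference is symmetric in the two variables, so comparing this formula with the one
  for the swapped variables gives the equality of the mixed derivatives.\<close>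

lemma second_difference_mean_value:
  assumes g: "smooth_on UNIV g" and h: "h > 0"
  obtains x y where "u < x" "x < u + h" "v < y" "y < v + h"
    "g (u + h, v + h) - g (u + h, v) - g (u, v + h) + g (u, v)
       = h\<^sup>2 * partial_v (partial_u g) (x, y)"
proof -
  let ?k = "\<lambda>t. g (t, v + h) - g (t, v)"
  have "\<exists>x. u < x \<and> x < u + h \<and> ?k (u + h) - ?k u
      = (u + h - u) * (partial_u g (x, v + h) - partial_u g (x, v))"
    using h by (intro MVT2 DERIV_diff partials_along_axes g) auto
  then obtain x where x: "u < x" "x < u + h" "?k (u + h) - ?k u
      = h * (partial_u g (x, v + h) - partial_u g (x, v))" by auto
  have "\<exists>y. v < y \<and> y < v + h \<and> partial_u g (x, v + h) - partial_u g (x, v)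
      = (v + h - v) * partial_v (partial_u g) (x, y)"
    using h by (intro MVT2 partials_along_axes smooth_on_partial g) auto
  then show ?thesis using x that by (auto simp: power2_eq_square)
qed

lemma smooth_on_swap:
  assumes "smooth_on UNIV (g :: real \<times> real \<Rightarrow> real)"
  shows "smooth_on UNIV (\<lambda>(u, v). g (v, u))"
proof -
  have "Cn_on n UNIV g \<Longrightarrow> Cn_on n UNIV (\<lambda>(u, v). g (v, u))" for n
  proof (induction n arbitrary: g)
    case 0
    then show ?case
      by (auto simp: split_beta intro!: continuous_on_compose2[of UNIV g] continuous_intros)
  next
    case (Suc n)
    have sw: "(prod.swap has_derivative prod.swap) (at x)" for x :: "real \<times> real"
      unfolding prod.swap_def by (auto intro!: derivative_eq_intros)
    have eq: "(\<lambda>(u, v). g (v, u)) = (\<lambda>x. g (prod.swap x))" by auto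
    have d: "((\<lambda>(u, v). g (v, u)) has_derivative
        (\<lambda>w. frechet_derivative g (at (prod.swap x)) (prod.swap w))) (at x)" for x
    proof -
      have "(g has_derivative frechet_derivative g (at (prod.swap x))) (at (prod.swap x))"
        using Suc.prems unfolding Cn_on.simps by (metis UNIV_I frechet_derivative_works)
      then show ?thesis unfolding eq by (rule has_derivative_compose[OF sw])
    qed
    have "Cn_on n UNIV (\<lambda>x. frechet_derivative (\<lambda>(u, v). g (v, u)) (at x) w)" for w
      using Suc.IH[of "\<lambda>x. frechet_derivative g (at x) (prod.swap w)"] Suc.prems
      by (simp add: frechet_derivative_at[OF d, symmetric] split_beta prod.swap_def)
    then show ?case unfolding Cn_on.simps differentiable_def using d by blast
  qed
  then show ?thesis using assms by (simp add: smooth_on_def)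
qed

text \<open>Both mixed derivatives are the limit of the same second difference quotient.\<close>

lemma partial_commute:
  assumes g: "smooth_on UNIV g"
  shows "partial_u (partial_v g) = partial_v (partial_u g)"
proof
  fix p :: "real \<times> real"
  obtain u v where p: "p = (u, v)" by fastforce
  define d where "d h = (g (u + h, v + h) - g (u + h, v) - g (u, v + h) + g (u, v)) / h\<^sup>2" for h
  let ?g = "\<lambda>(u, v). g (v, u)"
  have lim: "(d \<longlongrightarrow> G (u, v)) (at_right 0)"
    if G: "continuous_on UNIV G"
      and ex: "\<And>h. h > 0 \<Longrightarrow> \<exists>x y. u < x \<and> x < u + h \<and> v < y \<and> y < v + h \<and> d h = G (x, y)" for G
  proof (rule tendstoI)
    fix e :: real assume "e > 0"
    then obtain \<delta> where \<delta>: "\<delta> > 0" "\<And>q. dist q (u, v) < \<delta> \<Longrightarrow> dist (G q) (G (u, v)) < e"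
      using G unfolding continuous_on_iff by (metis UNIV_I)
    have "dist (d h) (G (u, v)) < e" if h: "0 < h" "h < \<delta> / 2" for h
    proof -
      obtain x y where xy: "u < x" "x < u + h" "v < y" "y < v + h" "d h = G (x, y)"
        using ex[OF h(1)] by blast
      have "dist (x, y) (u, v) \<le> \<bar>x - u\<bar> + \<bar>y - v\<bar>"
        using norm_Pair_le[of "x - u" "y - v"] by (simp add: dist_norm)
      then have "dist (x, y) (u, v) < \<delta>" using xy h by linarith
      then show ?thesis unfolding xy(5) by (rule \<delta>(2))
    qed
    then show "\<forall>\<^sub>F h in at_right 0. dist (d h) (G (u, v)) < e"
      unfolding eventually_at_right_field using \<delta>(1) by (intro exI[of _ "\<delta> / 2"]) auto
  qed
  have "(d \<longlongrightarrow> partial_v (partial_u g) (u, v)) (at_right 0)"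
  proof (rule lim)
    show "continuous_on UNIV (partial_v (partial_u g))"
      by (intro smooth_on_continuous smooth_on_partial g)
    fix h :: real assume "h > 0"
    from second_difference_mean_value[OF g this, of u v] obtain x y where
      "u < x" "x < u + h" "v < y" "y < v + h"
      and e: "g (u + h, v + h) - g (u + h, v) - g (u, v + h) + g (u, v)
         = h\<^sup>2 * partial_v (partial_u g) (x, y)" by metis
    moreover from e have "d h = partial_v (partial_u g) (x, y)"
      using \<open>h > 0\<close> by (simp add: d_def)
    ultimately show "\<exists>x y. u < x \<and> x < u + h \<and> v < y \<and> y < v + h \<and> d h = partial_v (partial_u g) (x, y)"
      by blast
  qed
  moreover have "(d \<longlongrightarrow> partial_u (partial_v g) (u, v)) (at_right 0)"
  proof (rule lim)
    show "continuous_on UNIV (partial_u (partial_v g))"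
      by (intro smooth_on_continuous smooth_on_partial g)
    fix h :: real assume "h > 0"
    have eq: "partial_v (partial_u ?g) (y, x) = partial_u (partial_v g) (x, y)" for x y
      by (simp add: partial_u_def partial_v_def)
    from second_difference_mean_value[OF smooth_on_swap[OF g] \<open>h > 0\<close>, of v u]
    obtain y x where "v < y" "y < v + h" "u < x" "x < u + h"
      and e: "g (u + h, v + h) - g (u, v + h) - g (u + h, v) + g (u, v)
         = h\<^sup>2 * partial_u (partial_v g) (x, y)" unfolding eq by auto
    have "d h = (g (u + h, v + h) - g (u, v + h) - g (u + h, v) + g (u, v)) / h\<^sup>2"
      unfolding d_def by (rule arg_cong[of _ _ "\<lambda>t. t / h\<^sup>2"]) linarith
    with e have "d h = partial_u (partial_v g) (x, y)" using \<open>h > 0\<close> by simp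
    with \<open>v < y\<close> \<open>y < v + h\<close> \<open>u < x\<close> \<open>x < u + h\<close>
    show "\<exists>x y. u < x \<and> x < u + h \<and> v < y \<and> y < v + h \<and> d h = partial_u (partial_v g) (x, y)"
      by blast
  qed
  ultimately show "partial_u (partial_v g) p = partial_v (partial_u g) p"
    unfolding p by (intro tendsto_unique[of "at_right 0"]) auto
qed

lemma smooth_on_partial_deriv: "smooth_on UNIV g \<Longrightarrow> smooth_on UNIV (partial_deriv a b g)"
proof -
  assume g: "smooth_on UNIV g"
  have "smooth_on UNIV ((partial_v ^^ b) g)" by (induction b) (auto intro: smooth_on_partial g)
  then show ?thesis
    unfolding partial_deriv_def by (induction a) (auto intro: smooth_on_partial)
qed

lemma partial_u_partial_deriv: "partial_u (partial_deriv a b g) = partial_deriv (Suc a) b g"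
  by (simp add: partial_deriv_def)

lemma partial_v_partial_deriv:
  assumes "smooth_on UNIV g"
  shows "partial_v (partial_deriv a b g) = partial_deriv a (Suc b) g"
proof (induction a)
  case (Suc a)
  then show ?case
    using partial_commute[OF smooth_on_partial_deriv[OF assms, of a b]]
    by (simp add: partial_u_partial_deriv[symmetric])
qed (simp add: partial_deriv_def)

lemma partial_deriv_u:
  assumes "smooth_on UNIV g"
  shows "((\<lambda>t. partial_deriv a b g (t, v)) has_real_derivative partial_deriv (Suc a) b g (u, v)) (at u within S)"
  using partials_along_axes(1)[OF smooth_on_partial_deriv[OF assms]] by (simp only: partial_u_partial_deriv)

lemma partial_deriv_v:
  assumes "smooth_on UNIV g"
  shows "((\<lambda>t. partial_deriv a b g (u, t)) has_real_derivative partial_deriv a (Suc b) g (u, v)) (at v within S)"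
  using partials_along_axes(2)[OF smooth_on_partial_deriv[OF assms]]
  by (simp only: partial_v_partial_deriv[OF assms])

lemma partial_deriv_total:
  assumes "smooth_on UNIV g"
  shows "(partial_deriv a b g has_derivative
    (\<lambda>w. partial_deriv (Suc a) b g p * fst w + partial_deriv a (Suc b) g p * snd w)) (at p)"
  using has_derivative_partials(1)[OF smooth_on_differentiable[OF smooth_on_partial_deriv[OF assms]]]
  by (simp only: partial_u_partial_deriv partial_v_partial_deriv[OF assms])

lemma partial_deriv_curve:
  assumes g: "smooth_on UNIV g"
    and x: "(x has_real_derivative x') (at t within S)" and y: "(y has_real_derivative y') (at t within S)"
  shows "((\<lambda>t. partial_deriv a b g (x t, y t)) has_real_derivative
    x' * partial_deriv (Suc a) b g (x t, y t) + y' * partial_deriv a (Suc b) g (x t, y t)) (at t within S)"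
proof -
  have "((\<lambda>t. (x t, y t)) has_derivative (\<lambda>h. (x' * h, y' * h))) (at t within S)"
    using x y by (intro has_derivative_Pair) (simp_all add: has_field_derivative_def)
  from has_derivative_compose[OF this, of "partial_deriv a b g", OF partial_deriv_total[OF g]]
  have "((\<lambda>t. partial_deriv a b g (x t, y t)) has_derivative
      (\<lambda>h. partial_deriv (Suc a) b g (x t, y t) * (x' * h) + partial_deriv a (Suc b) g (x t, y t) * (y' * h)))
      (at t within S)" by simp
  then show ?thesis unfolding has_field_derivative_def
    by (rule has_derivative_eq_rhs) (auto simp: algebra_simps)
qed

lemma partial_deriv_0: "partial_deriv 0 0 g = g"
  by (simp add: partial_deriv_def)

lemma continuous_on_partial_deriv: "smooth_on UNIV g \<Longrightarrow> continuous_on S (partial_deriv a b g)"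
  by (intro smooth_on_continuous smooth_on_partial_deriv)

lemma mem_ball_Pair: "r \<ge> 0 \<Longrightarrow> (u, v) \<in> ball (0, 0) r \<longleftrightarrow> u\<^sup>2 + v\<^sup>2 < r\<^sup>2" for u v r :: real
  using real_sqrt_less_iff[of "u\<^sup>2 + v\<^sup>2" "r\<^sup>2"]
  by (simp add: dist_Pair_Pair dist_real_def)

lemma partials_cong_open:
  assumes U: "open U" and eq: "\<And>p. p \<in> U \<Longrightarrow> f p = g p" and p: "p \<in> U"
  shows "partial_u f p = partial_u g p" "partial_v f p = partial_v g p"
proof -
  obtain u v where uv: "p = (u, v)" by fastforce
  have "open ((\<lambda>t. (t, v)) -` U)" by (rule open_vimage[OF U]) (intro continuous_intros)
  then have "\<forall>\<^sub>F t in nhds u. t \<in> (\<lambda>t. (t, v)) -` U" using p uv by (intro eventually_nhds_in_open) auto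
  then have "\<forall>\<^sub>F t in nhds u. f (t, v) = g (t, v)" by (rule eventually_mono) (simp add: eq)
  then show "partial_u f p = partial_u g p" unfolding partial_u_def uv by (simp add: deriv_cong_ev)
  have "open ((\<lambda>t. (u, t)) -` U)" by (rule open_vimage[OF U]) (intro continuous_intros)
  then have "\<forall>\<^sub>F t in nhds v. t \<in> (\<lambda>t. (u, t)) -` U" using p uv by (intro eventually_nhds_in_open) auto
  then have "\<forall>\<^sub>F t in nhds v. f (u, t) = g (u, t)" by (rule eventually_mono) (simp add: eq)
  then show "partial_v f p = partial_v g p" unfolding partial_v_def uv by (simp add: deriv_cong_ev)
qed

text \<open>Partial derivatives are determined by the germ. This transfers the bounds on the derivatives of
  \<open>f\<close>, which is only known on a ball, to a globally smooth function that agrees with it there.\<close>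

lemma partial_deriv_cong_open:
  assumes U: "open U" and eq: "\<And>p. p \<in> U \<Longrightarrow> f p = g p" and p: "p \<in> U"
  shows "partial_deriv a b f p = partial_deriv a b g p"
proof -
  have v: "(partial_v ^^ b) f q = (partial_v ^^ b) g q" if "q \<in> U" for q
    using that
  proof (induction b arbitrary: q)
    case (Suc b)
    show ?case using partials_cong_open(2)[OF U Suc.IH Suc.prems] by simp
  qed (simp add: eq)
  have "(partial_u ^^ a) ((partial_v ^^ b) f) q = (partial_u ^^ a) ((partial_v ^^ b) g) q" if "q \<in> U" for q
    using that
  proof (induction a arbitrary: q)
    case (Suc a)
    show ?case using partials_cong_open(1)[OF U Suc.IH Suc.prems] by simp
  qed (simp add: v)
  then show ?thesis using p by (simp add: partial_deriv_def)
qed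

lemma partial_deriv_zero: "partial_deriv a b (\<lambda>p. 0) = (\<lambda>p. 0)"
proof -
  have "partial_u (\<lambda>p. 0) = (\<lambda>p. 0)" "partial_v (\<lambda>p. 0) = (\<lambda>p. 0)"
    by (auto simp: partial_u_def partial_v_def)
  then have "(partial_v ^^ b) (\<lambda>p. 0) = (\<lambda>p. 0)" "(partial_u ^^ a) (\<lambda>p. 0) = (\<lambda>p. 0)"
    by (induction b, simp_all) (induction a, simp_all)
  then show ?thesis by (simp add: partial_deriv_def)
qed

lemma partial_deriv_outside_supp:
  assumes "p \<notin> supp g"
  shows "partial_deriv a b g p = 0"
proof -
  have "partial_deriv a b g p = partial_deriv a b (\<lambda>p. 0) p"
  proof (rule partial_deriv_cong_open)
    show "open (- supp g)" by (simp add: supp_def open_Compl)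
    show "p \<in> - supp g" using assms by simp
    show "g q = 0" if "q \<in> - supp g" for q
      using that closure_subset[of "{x. g x \<noteq> 0}"] by (auto simp: supp_def)
  qed
  then show ?thesis by (simp add: partial_deriv_zero)
qed

text \<open>The supremum defining the norm is a genuine one: each derivative is continuous and vanishes off
  the compact support, and only finitely many of them occur.\<close>

lemma partial_deriv_le_CN_norm:
  assumes g: "smooth_on UNIV g" "compact (supp g)" and ab: "a + b \<le> N"
  shows "\<bar>partial_deriv a b g z\<bar> \<le> CN_norm N g"
proof -
  have bdd: "bdd_above (range (\<lambda>z. \<bar>partial_deriv a b g z\<bar>))" for a b
  proof -
    have "compact (partial_deriv a b g ` supp g)"
      by (intro compact_continuous_image continuous_on_partial_deriv g)
    then obtain B where B: "\<forall>x\<in>partial_deriv a b g ` supp g. norm x \<le> B"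
      using compact_imp_bounded bounded_iff by blast
    have "\<bar>partial_deriv a b g z\<bar> \<le> max B 0" for z
      using B partial_deriv_outside_supp[of z g a b] by (cases "z \<in> supp g") force+
    then show ?thesis by (intro bdd_aboveI[of _ "max B 0"]) auto
  qed
  let ?S = "{\<bar>partial_deriv a b g z\<bar> | a b z. a + b \<le> N}"
  have "?S \<subseteq> (\<Union>(a, b)\<in>{..N} \<times> {..N}. range (\<lambda>z. \<bar>partial_deriv a b g z\<bar>))" by fastforce
  moreover have "bdd_above (\<Union>(a, b)\<in>{..N} \<times> {..N}. range (\<lambda>z. \<bar>partial_deriv a b g z\<bar>))"
    by (subst bdd_above_UN) (auto intro: bdd)
  ultimately have "bdd_above ?S" by (rule bdd_above_mono[rotated])
  then show ?thesis unfolding CN_norm_def by (intro cSup_upper) (use ab in blast)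
qed

section \<open>Van der Corput's lemma\<close>

lemma has_vector_derivative_cis:
  assumes "(p has_real_derivative p') (at x within S)"
  shows "((\<lambda>t. cis (p t)) has_vector_derivative p' *\<^sub>R (\<i> * cis (p x))) (at x within S)"
  using has_derivative_cis[OF assms[unfolded has_field_derivative_def]]
  by (simp add: has_vector_derivative_def mult.commute)

lemma norm_integral_le:
  fixes g :: "real \<Rightarrow> complex"
  assumes "a \<le> b" "0 \<le> B" "\<And>x. x \<in> {a..b} \<Longrightarrow> norm (g x) \<le> B"
  shows "norm (integral {a..b} g) \<le> B * (b - a)"
proof (cases "g integrable_on {a..b}")
  case True
  then show ?thesis
    using has_integral_bound[of B g "integral {a..b} g" a b] assms by (simp add: has_integral_integral)
next
  case False
  then show ?thesis using assms by (simp add: not_integrable_integral)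
qed

lemma integral_cis_minus:
  "norm (integral S (\<lambda>x. cis (- p x))) = norm (integral S (\<lambda>x. cis (p x)))"
proof -
  have "cnj (integral S (\<lambda>x. cis (p x))) = integral S (\<lambda>x. cis (- p x))"
    using integral_cnj[of S "\<lambda>x. cis (p x)"] by (simp add: cis_cnj)
  then show ?thesis by (metis complex_mod_cnj)
qed

text \<open>The integrand is \<open>1/(i p')\<close> times a derivative. As \<open>p'\<close> is monotone, the total variation of
  \<open>1/p'\<close> telescopes to its values at the two ends.\<close>

lemma van_der_Corput_first:
  assumes ab: "a \<le> b" and \<delta>: "\<delta> > 0"
    and p: "\<And>x. x \<in> {a..b} \<Longrightarrow> (p has_real_derivative p1 x) (at x within {a..b})"
    and p1: "\<And>x. x \<in> {a..b} \<Longrightarrow> (p1 has_real_derivative p2 x) (at x within {a..b})"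
    and p2: "\<And>x. x \<in> {a..b} \<Longrightarrow> p2 x \<ge> 0"
    and large: "(\<forall>x\<in>{a..b}. p1 x \<ge> \<delta>) \<or> (\<forall>x\<in>{a..b}. p1 x \<le> - \<delta>)"
  shows "norm (integral {a..b} (\<lambda>x. cis (p x))) \<le> 4 / \<delta>"
proof -
  let ?I = "{a..b}"
  have nz: "p1 x \<noteq> 0" and inv: "\<bar>inverse (p1 x)\<bar> \<le> 1 / \<delta>" if "x \<in> ?I" for x
  proof -
    have "\<bar>p1 x\<bar> \<ge> \<delta>" using large that by fastforce
    then show "p1 x \<noteq> 0" "\<bar>inverse (p1 x)\<bar> \<le> 1 / \<delta>"
      using \<delta> by (auto simp: field_simps abs_if split: if_splits)
  qed
  \<comment> \<open>the boundary term of the integration by parts, with derivative the integrand plus an error\<close>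
  define F where "F x = (- inverse (p1 x)) *\<^sub>R (\<i> * cis (p x))" for x
  let ?w = "\<lambda>x. p2 x * (inverse (p1 x))\<^sup>2"
  have "(F has_vector_derivative cis (p x) + ?w x *\<^sub>R (\<i> * cis (p x))) (at x within ?I)"
    if x: "x \<in> ?I" for x
  proof -
    have "((\<lambda>x. - inverse (p1 x)) has_real_derivative ?w x) (at x within ?I)"
      using p1[OF x] nz[OF x]
      by (auto intro!: derivative_eq_intros simp: power2_eq_square)
    moreover have "((\<lambda>x. \<i> * cis (p x)) has_vector_derivative \<i> * (p1 x *\<^sub>R (\<i> * cis (p x)))) (at x within ?I)"
      by (intro has_vector_derivative_mult_right has_vector_derivative_cis p x)
    ultimately have "(F has_vector_derivative (- inverse (p1 x)) *\<^sub>R (\<i> * (p1 x *\<^sub>R (\<i> * cis (p x))))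
        + ?w x *\<^sub>R (\<i> * cis (p x))) (at x within ?I)"
      unfolding F_def by (rule has_vector_derivative_scaleR)
    moreover have "(- inverse (p1 x)) *\<^sub>R (\<i> * (p1 x *\<^sub>R (\<i> * cis (p x)))) = cis (p x)"
      using nz[OF x] by (simp add: mult.assoc[symmetric])
    ultimately show ?thesis by simp
  qed
  from fundamental_theorem_of_calculus[OF ab this]
  have 1: "((\<lambda>x. cis (p x) + ?w x *\<^sub>R (\<i> * cis (p x))) has_integral F b - F a) ?I" .
  have "continuous_on ?I p" using p by (rule DERIV_continuous_on)
  then have "(\<lambda>x. cis (p x)) integrable_on ?I"
    by (intro integrable_continuous_real continuous_intros)
  then have 2: "((\<lambda>x. cis (p x)) has_integral integral ?I (\<lambda>x. cis (p x))) ?I"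
    by (rule integrable_integral)
  define E where "E = F b - F a - integral ?I (\<lambda>x. cis (p x))"
  have 3: "((\<lambda>x. ?w x *\<^sub>R (\<i> * cis (p x))) has_integral E) ?I"
    using has_integral_diff[OF 1 2] by (simp add: E_def)
  have "(?w has_integral (- inverse (p1 b)) - (- inverse (p1 a))) ?I"
  proof (rule fundamental_theorem_of_calculus[OF ab])
    fix x assume x: "x \<in> ?I"
    show "((\<lambda>x. - inverse (p1 x)) has_vector_derivative ?w x) (at x within ?I)"
      using p1[OF x] nz[OF x] unfolding has_real_derivative_iff_has_vector_derivative[symmetric]
      by (auto intro!: derivative_eq_intros simp: power2_eq_square)
  qed
  then have w: "(?w has_integral inverse (p1 a) - inverse (p1 b)) ?I" by simp
  have "norm E \<le> inverse (p1 a) - inverse (p1 b)"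
    unfolding integral_unique[OF 3, symmetric] integral_unique[OF w, symmetric]
    using 3 w p2 by (intro integral_norm_bound_integral) (auto simp: norm_mult abs_mult)
  moreover have "norm (F x) \<le> 1 / \<delta>" if "x \<in> ?I" for x
    using inv[OF that] by (simp add: F_def norm_mult)
  then have "norm (F a) \<le> 1 / \<delta>" "norm (F b) \<le> 1 / \<delta>" using ab by auto
  moreover have "\<bar>inverse (p1 a)\<bar> \<le> 1 / \<delta>" "\<bar>inverse (p1 b)\<bar> \<le> 1 / \<delta>" using inv ab by auto
  moreover have "norm (F b - F a - E) \<le> norm (F b) + norm (F a) + norm E"
    by (meson norm_triangle_ineq4 order_trans add_right_mono)
  moreover have "integral ?I (\<lambda>x. cis (p x)) = F b - F a - E" by (simp add: E_def)
  ultimately show ?thesis by (simp only:)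
qed

text \<open>The recursion mirrors the induction on the order in van der Corput's lemma: two outer pieces are
  estimated by the previous order, and the piece between them by its length. The value at 0 is a
  dummy.\<close>

fun vdC_const :: "nat \<Rightarrow> real" where
  "vdC_const 0 = 0"
| "vdC_const (Suc 0) = 4"
| "vdC_const (Suc (Suc n)) = 2 * vdC_const (Suc n) + 2"

lemma vdC_const_nonneg: "vdC_const n \<ge> 0"
  by (induction n rule: vdC_const.induct) auto

lemma derivative_ge_imp_growth:
  fixes g :: "real \<Rightarrow> real"
  assumes g: "\<And>x. x \<in> {a..b} \<Longrightarrow> (g has_real_derivative g' x) (at x within {a..b})"
    and g': "\<And>x. x \<in> {a..b} \<Longrightarrow> g' x \<ge> L"
    and that: "a \<le> x" "x \<le> y" "y \<le> b"
  shows "g y - g x \<ge> L * (y - x)"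
proof -
  have "(\<lambda>x. g x - L * x) x \<le> (\<lambda>x. g x - L * x) y"
  proof (rule DERIV_nonneg_imp_increasing_open[OF that(2)])
    show "continuous_on {x..y} (\<lambda>x. g x - L * x)"
      using DERIV_continuous_on[of "{a..b}" g g'] g that
      by (auto intro!: continuous_intros intro: continuous_on_subset)
    fix t assume t: "x < t" "t < y"
    have "(g has_real_derivative g' t) (at t within {a<..<b})"
      using g[of t] t that by (auto intro: DERIV_subset)
    then have "(g has_real_derivative g' t) (at t)"
      using t that by (simp add: at_within_open[of t "{a<..<b}"])
    then have "((\<lambda>x. g x - L * x) has_real_derivative g' t - L) (at t)"
      by (auto intro!: derivative_eq_intros)
    moreover have "g' t - L \<ge> 0" using g'[of t] t that by simp
    ultimately show "\<exists>y. ((\<lambda>x. g x - L * x) has_real_derivative y) (at t) \<and> 0 \<le> y" by blast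
  qed
  then show ?thesis by (simp add: algebra_simps)
qed

text \<open>A function with derivative at least \<open>L\<close> is smaller than \<open>\<delta>\<close> in absolute value at most on an
  interval of length \<open>2\<delta>/L\<close> around its zero.\<close>

lemma sign_change_split:
  assumes ab: "a \<le> b" and L: "L > 0"
    and g: "\<And>x. x \<in> {a..b} \<Longrightarrow> (g has_real_derivative g' x) (at x within {a..b})"
    and g': "\<And>x. x \<in> {a..b} \<Longrightarrow> g' x \<ge> L"
    and \<delta>: "\<delta> > 0"
  obtains c d where "a \<le> c" "c \<le> d" "d \<le> b" "d - c \<le> 2 * \<delta> / L"
    "a < c \<Longrightarrow> \<forall>x\<in>{a..c}. g x \<le> - \<delta>" "d < b \<Longrightarrow> \<forall>x\<in>{d..b}. g x \<ge> \<delta>"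
proof -
  have inc: "g y - g x \<ge> L * (y - x)" if "a \<le> x" "x \<le> y" "y \<le> b" for x y
    using derivative_ge_imp_growth[OF g g' that] .
  \<comment> \<open>if \<open>g\<close> has no zero, the end at which it is closest to 0 takes its place\<close>
  have "\<exists>z\<in>{a..b}. (a < z \<longrightarrow> g z \<le> 0) \<and> (z < b \<longrightarrow> g z \<ge> 0)"
  proof (cases "g a \<ge> 0 \<or> g b \<le> 0")
    case False
    have "continuous_on {a..b} g" using g by (rule DERIV_continuous_on)
    then obtain z where "a \<le> z" "z \<le> b" "g z = 0"
      using IVT'[of g a 0 b] False ab by auto
    then show ?thesis by (intro bexI[of _ z]) auto
  next
    case True
    then show ?thesis
    proof
      assume "g a \<ge> 0"
      then show ?thesis using ab by (intro bexI[of _ a]) auto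
    next
      assume "g b \<le> 0"
      then show ?thesis using ab by (intro bexI[of _ b]) auto
    qed
  qed
  then obtain z where z: "z \<in> {a..b}" "a < z \<Longrightarrow> g z \<le> 0" "z < b \<Longrightarrow> g z \<ge> 0" by blast
  define c where "c = max a (z - \<delta> / L)"
  define d where "d = min b (z + \<delta> / L)"
  have \<delta>L: "\<delta> / L > 0" "L * (\<delta> / L) = \<delta>" using L \<delta> by auto
  show ?thesis
  proof (rule that)
    show "a \<le> c" "c \<le> d" "d \<le> b" "d - c \<le> 2 * \<delta> / L"
      using z(1) \<delta>L(1) unfolding c_def d_def by auto
    show "\<forall>x\<in>{a..c}. g x \<le> - \<delta>" if "a < c"
    proof
      fix x assume x: "x \<in> {a..c}"
      have c: "c = z - \<delta> / L" using that by (auto simp: c_def max_def split: if_splits)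
      then have "\<delta> / L \<le> z - x" using x by simp
      then have "L * (\<delta> / L) \<le> L * (z - x)" using L by (intro mult_left_mono) auto
      moreover have "g z - g x \<ge> L * (z - x)" using z(1) x c \<delta>L(1) by (intro inc) auto
      moreover have "g z \<le> 0" using c \<delta>L(1) that by (intro z(2)) simp
      ultimately show "g x \<le> - \<delta>" using \<delta>L(2) by linarith
    qed
    show "\<forall>x\<in>{d..b}. g x \<ge> \<delta>" if "d < b"
    proof
      fix x assume x: "x \<in> {d..b}"
      have d: "d = z + \<delta> / L" using that by (auto simp: d_def min_def split: if_splits)
      then have "\<delta> / L \<le> x - z" using x by simp
      then have "L * (\<delta> / L) \<le> L * (x - z)" using L by (intro mult_left_mono) auto
      moreover have "g x - g z \<ge> L * (x - z)" using z(1) x d \<delta>L(1) by (intro inc) auto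
      moreover have "g z \<ge> 0" using d \<delta>L(1) that by (intro z(3)) simp
      ultimately show "g x \<ge> \<delta>" using \<delta>L(2) by linarith
    qed
  qed
qed

text \<open>Induction on \<open>k\<close>. Where the derivative of order \<open>k - 1\<close> is at least \<open>\<delta>\<close> in absolute value, the
  previous order applies; the rest is an interval of length \<open>2\<delta>/L\<close>. The two contributions balance
  for \<open>\<delta> = L\<^bsup>(k-1)/k\<^esup>\<close>.\<close>

theorem van_der_Corput:
  assumes "k \<ge> 2" "a \<le> b" "L > 0"
    and "\<And>i x. i < k \<Longrightarrow> x \<in> {a..b} \<Longrightarrow> (p i has_real_derivative p (Suc i) x) (at x within {a..b})"
    and "(\<forall>x\<in>{a..b}. p k x \<ge> L) \<or> (\<forall>x\<in>{a..b}. p k x \<le> - L)"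
  shows "norm (integral {a..b} (\<lambda>x. cis (p 0 x))) \<le> vdC_const k * L powr (- (1 / real k))"
  using assms
proof (induction k arbitrary: a b L p rule: less_induct)
  case (less k)
  \<comment> \<open>Complex conjugation turns the case \<open>p k \<le> - L\<close> into this one.\<close>
  have pos: "norm (integral {a..b} (\<lambda>x. cis (p 0 x))) \<le> vdC_const k * L powr (- (1 / real k))"
    if p: "\<And>i x. i < k \<Longrightarrow> x \<in> {a..b} \<Longrightarrow> (p i has_real_derivative p (Suc i) x) (at x within {a..b})"
      and pk: "\<forall>x\<in>{a..b}. p k x \<ge> L" for p
  proof -
    define m where "m = k - 1"
    have k: "k = Suc m" "m \<ge> 1" using less.prems(1) by (auto simp: m_def)
    \<comment> \<open>the threshold at which both contributions are of order \<open>L powr (- 1 / k)\<close>\<close>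
    define \<delta> where "\<delta> = L powr (real m / real k)"
    have \<delta>: "\<delta> > 0" using less.prems(3) by (simp add: \<delta>_def)
    let ?t = "L powr (- (1 / real k))"
    have eq1: "\<delta> powr (- (1 / real m)) = ?t"
      using k by (simp add: \<delta>_def powr_powr field_simps)
    have "\<delta> = L * ?t"
    proof -
      have "\<delta> = L powr (1 + - (1 / real k))"
        unfolding \<delta>_def using k by (intro arg_cong[of _ _ "(powr) L"]) (simp add: field_simps)
      also have "\<dots> = L * ?t" using less.prems(3) by (simp only: powr_add) simp
      finally show ?thesis .
    qed
    then have eq2: "2 * \<delta> / L = 2 * ?t" using less.prems(3) by simp
    let ?h = "\<lambda>x. cis (p 0 x)"
    have piece: "norm (integral {c..d} ?h) \<le> vdC_const m * ?t"
      if cd: "a \<le> c" "c \<le> d" "d \<le> b"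
        and large: "c < d \<Longrightarrow> (\<forall>x\<in>{c..d}. p m x \<ge> \<delta>) \<or> (\<forall>x\<in>{c..d}. p m x \<le> - \<delta>)" for c d
    proof (cases "c < d")
      case True
      have p': "(p i has_real_derivative p (Suc i) x) (at x within {c..d})" if "i < k" "x \<in> {c..d}" for i x
        using p[of i x] that cd by (auto intro: DERIV_subset)
      show ?thesis
      proof (cases "m = 1")
        case True
        have "norm (integral {c..d} ?h) \<le> 4 / \<delta>"
        proof (rule van_der_Corput_first[OF cd(2) \<delta>])
          show "(p 0 has_real_derivative p 1 x) (at x within {c..d})" if "x \<in> {c..d}" for x
            using p'[of 0 x] that k by simp
          show "(p 1 has_real_derivative p 2 x) (at x within {c..d})" if "x \<in> {c..d}" for x
            using p'[of 1 x] that k True by (simp add: numeral_2_eq_2)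
          show "p 2 x \<ge> 0" if "x \<in> {c..d}" for x
          proof -
            have "k = 2" using k(1) True by simp
            moreover have "x \<in> {a..b}" using that cd by simp
            ultimately have "L \<le> p 2 x" using pk by metis
            then show ?thesis using less.prems(3) by linarith
          qed
          show "(\<forall>x\<in>{c..d}. p 1 x \<ge> \<delta>) \<or> (\<forall>x\<in>{c..d}. p 1 x \<le> - \<delta>)"
            using large \<open>c < d\<close> True by simp
        qed
        also have "4 / \<delta> = vdC_const m * ?t"
          using True \<delta> eq1[symmetric] by (simp add: powr_minus_divide)
        finally show ?thesis .
      next
        case False
        have "norm (integral {c..d} ?h) \<le> vdC_const m * \<delta> powr (- (1 / real m))"
        proof (rule less.IH)
          show "m < k" "2 \<le> m" "c \<le> d" "0 < \<delta>" using k False cd \<delta> by auto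
          show "(p i has_real_derivative p (Suc i) x) (at x within {c..d})" if "i < m" "x \<in> {c..d}" for i x
            using p' that k by simp
        qed (use large \<open>c < d\<close> in blast)
        then show ?thesis by (simp only: eq1)
      qed
    next
      case False
      then show ?thesis using cd by (simp add: vdC_const_nonneg)
    qed
    obtain c d where cd: "a \<le> c" "c \<le> d" "d \<le> b" "d - c \<le> 2 * \<delta> / L"
      "a < c \<Longrightarrow> \<forall>x\<in>{a..c}. p m x \<le> - \<delta>" "d < b \<Longrightarrow> \<forall>x\<in>{d..b}. p m x \<ge> \<delta>"
      using sign_change_split[OF less.prems(2,3), of "p m" "p k" \<delta>] p pk k \<delta> by auto
    have "continuous_on {a..b} (p 0)"
      using p[of 0] k by (intro DERIV_continuous_on[of _ _ "p (Suc 0)"]) auto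
    then have int: "?h integrable_on {a..b}"
      by (intro integrable_continuous_real continuous_intros)
    have "integral {a..c} ?h + integral {c..b} ?h = integral {a..b} ?h"
      by (rule Henstock_Kurzweil_Integration.integral_combine) (use cd int in auto)
    moreover have "integral {c..d} ?h + integral {d..b} ?h = integral {c..b} ?h"
      by (rule Henstock_Kurzweil_Integration.integral_combine)
        (use cd in \<open>auto intro: integrable_subinterval_real[OF int]\<close>)
    ultimately have "integral {a..b} ?h = integral {a..c} ?h + (integral {c..d} ?h + integral {d..b} ?h)"
      by simp
    then have "norm (integral {a..b} ?h)
        \<le> norm (integral {a..c} ?h) + (norm (integral {c..d} ?h) + norm (integral {d..b} ?h))"
      by (metis norm_triangle_ineq norm_triangle_mono order_refl)
    moreover have "norm (integral {a..c} ?h) \<le> vdC_const m * ?t"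
      "norm (integral {d..b} ?h) \<le> vdC_const m * ?t"
      using cd by (auto intro!: piece)
    moreover have "norm (integral {c..d} ?h) \<le> 1 * (d - c)"
      using cd by (intro norm_integral_le) auto
    moreover have "vdC_const k = 2 * vdC_const m + 2" using k by (cases m) auto
    ultimately show ?thesis using cd(4) eq2 by (simp add: algebra_simps)
  qed
  from less.prems(5) show ?case
  proof
    assume "\<forall>x\<in>{a..b}. p k x \<ge> L"
    then show ?thesis using pos[of p] less.prems(4) by blast
  next
    assume "\<forall>x\<in>{a..b}. p k x \<le> - L"
    then have "norm (integral {a..b} (\<lambda>x. cis (- p 0 x))) \<le> vdC_const k * L powr (- (1 / real k))"
      using pos[of "\<lambda>i x. - p i x"] less.prems(4) by (force intro: DERIV_minus)
    then show ?thesis by (simp only: integral_cis_minus)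
  qed
qed

text \<open>Integration by parts against the primitive \<open>G\<close> of the exponential, which is bounded by van der
  Corput's lemma on every initial segment of the interval. The boundary term is kept, since the
  integral over \<open>u\<close> will be cut at points where the amplitude is not zero.\<close>

theorem van_der_Corput_amplitude:
  fixes A A' :: "real \<Rightarrow> complex"
  assumes k: "k \<ge> 2" and ab: "a \<le> b" and L: "L > 0"
    and p: "\<And>i x. i < k \<Longrightarrow> x \<in> {a..b} \<Longrightarrow> (p i has_real_derivative p (Suc i) x) (at x within {a..b})"
    and pk: "(\<forall>x\<in>{a..b}. p k x \<ge> L) \<or> (\<forall>x\<in>{a..b}. p k x \<le> - L)"
    and A: "\<And>x. x \<in> {a..b} \<Longrightarrow> (A has_vector_derivative A' x) (at x within {a..b})"
    and S: "\<And>x. x \<in> {a..b} \<Longrightarrow> norm (A x) \<le> S"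
    and S': "\<And>x. x \<in> {a..b} \<Longrightarrow> norm (A' x) \<le> S'"
  shows "norm (integral {a..b} (\<lambda>x. cis (p 0 x) * A x))
    \<le> vdC_const k * L powr (- (1 / real k)) * (S + S' * (b - a))"
proof -
  let ?I = "{a..b}"
  define K where "K = vdC_const k * L powr (- (1 / real k))"
  have K: "K \<ge> 0" by (simp add: K_def vdC_const_nonneg)
  define G where "G x = integral {a..x} (\<lambda>x. cis (p 0 x))" for x
  have cont: "continuous_on ?I (p 0)"
    using p[of 0] k by (intro DERIV_continuous_on[of _ _ "p (Suc 0)"]) auto
  have GK: "norm (G x) \<le> K" if x: "x \<in> ?I" for x
    unfolding G_def K_def
  proof (rule van_der_Corput[OF k _ L])
    show "(p i has_real_derivative p (Suc i) t) (at t within {a..x})" if "i < k" "t \<in> {a..x}" for i t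
      using p[of i t] that x by (auto intro: DERIV_subset)
  qed (use x pk in auto)
  have G': "(G has_vector_derivative cis (p 0 x)) (at x within ?I)" if "x \<in> ?I" for x
    unfolding G_def using cont that
    by (intro integral_has_vector_derivative continuous_intros)
  have "((\<lambda>x. G x * A' x + cis (p 0 x) * A x) has_integral G b * A b - G a * A a) ?I"
    by (rule fundamental_theorem_of_calculus[OF ab]) (intro has_vector_derivative_mult G' A)
  moreover have "G a = 0" by (simp add: G_def)
  ultimately have 1: "((\<lambda>x. G x * A' x + cis (p 0 x) * A x) has_integral G b * A b) ?I" by simp
  have "continuous_on ?I A" by (rule continuous_on_vector_derivative[OF A])
  then have "(\<lambda>x. cis (p 0 x) * A x) integrable_on ?I"
    using cont by (intro integrable_continuous_real continuous_intros)
  then have 2: "((\<lambda>x. cis (p 0 x) * A x) has_integral integral ?I (\<lambda>x. cis (p 0 x) * A x)) ?I"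
    by (rule integrable_integral)
  have 3: "((\<lambda>x. G x * A' x) has_integral G b * A b - integral ?I (\<lambda>x. cis (p 0 x) * A x)) ?I"
    using has_integral_diff[OF 1 2] by simp
  have S'0: "S' \<ge> 0" using order_trans[OF norm_ge_zero S'[of a]] ab by simp
  have "norm (integral ?I (\<lambda>x. G x * A' x)) \<le> (K * S') * (b - a)"
    using ab K S'0 by (intro norm_integral_le) (simp_all only: norm_mult mult_mono GK S' norm_ge_zero mult_nonneg_nonneg)
  then have "norm (G b * A b - integral ?I (\<lambda>x. cis (p 0 x) * A x)) \<le> K * S' * (b - a)"
    by (simp only: integral_unique[OF 3])
  moreover have "norm (G b * A b) \<le> K * S"
    unfolding norm_mult using ab K by (intro mult_mono GK S) auto
  ultimately have "norm (integral ?I (\<lambda>x. cis (p 0 x) * A x)) \<le> K * S + K * S' * (b - a)"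
    using norm_triangle_sub[of "integral ?I (\<lambda>x. cis (p 0 x) * A x)" "G b * A b"]
    by (simp add: norm_minus_commute)
  then show ?thesis by (simp add: K_def algebra_simps)
qed

section \<open>Oscillatory integrals along one fiber\<close>

text \<open>For \<open>j = 0\<close> and \<open>g = f'\<close> this is the quotient \<open>(f(v) - f(c)) / (v - c)\<close>, extended smoothly to
  \<open>v = c\<close> (Hadamard's lemma); the weights \<open>t\<^sup>j\<close> appear in its derivatives with respect to \<open>v\<close>.\<close>

definition mean_along :: "nat \<Rightarrow> real \<Rightarrow> (real \<Rightarrow> real) \<Rightarrow> real \<Rightarrow> real"
  where "mean_along j c g v = integral {0..1} (\<lambda>t. t ^ j * g (c + t * (v - c)))"

context
  fixes a b c :: real
  assumes c: "c \<in> {a..b}"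
begin

lemma segment_in_interval: "v \<in> {a..b} \<Longrightarrow> t \<in> {0..1} \<Longrightarrow> c + t * (v - c) \<in> {a..b}"
proof -
  assume v: "v \<in> {a..b}" and t: "t \<in> {0..1::real}"
  have "c + t * (v - c) = (1 - t) * c + t * v" by (simp add: algebra_simps)
  moreover have "(1 - t) *\<^sub>R c + t *\<^sub>R v \<in> {a..b}"
    using convex_real_interval(5)[of a b] c v t by (intro convexD) auto
  ultimately show ?thesis by simp
qed

lemma mean_along_integrable:
  assumes "continuous_on {a..b} g" "v \<in> {a..b}"
  shows "(\<lambda>t. t ^ j * g (c + t * (v - c))) integrable_on {0..1}"
  using assms(2)
  by (intro integrable_continuous_real continuous_intros continuous_on_compose2[OF assms(1)])
    (use segment_in_interval in blast)

lemma mean_along_deriv: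
  assumes g: "\<And>x. x \<in> {a..b} \<Longrightarrow> (g has_real_derivative g' x) (at x within {a..b})"
    and g': "continuous_on {a..b} g'" and v: "v \<in> {a..b}"
  shows "(mean_along j c g has_real_derivative mean_along (Suc j) c g' v) (at v within {a..b})"
proof -
  have cg: "continuous_on {a..b} g" using g by (rule DERIV_continuous_on)
  have "((\<lambda>v. integral (cbox 0 1) (\<lambda>t. t ^ j * g (c + t * (v - c)))) has_field_derivative
      integral (cbox 0 1) (\<lambda>t. t ^ Suc j * g' (c + t * (v - c)))) (at v within {a..b})"
  proof (rule leibniz_rule_field_derivative[where fx = "\<lambda>v t. t ^ Suc j * g' (c + t * (v - c))"])
    fix x t :: real assume x: "x \<in> {a..b}" and t: "t \<in> cbox 0 1"
    have "(g \<circ> (\<lambda>v. c + t * (v - c)) has_real_derivative g' (c + t * (x - c)) * t) (at x within {a..b})"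
    proof (rule DERIV_image_chain)
      have "(\<lambda>v. c + t * (v - c)) ` {a..b} \<subseteq> {a..b}" using segment_in_interval t by auto
      then show "(g has_real_derivative g' (c + t * (x - c))) (at (c + t * (x - c)) within (\<lambda>v. c + t * (v - c)) ` {a..b})"
        using g[OF segment_in_interval[OF x]] t by (auto intro: DERIV_subset)
      show "((\<lambda>v. c + t * (v - c)) has_real_derivative t) (at x within {a..b})"
        by (auto intro!: derivative_eq_intros)
    qed
    then have "((\<lambda>v. g (c + t * (v - c))) has_real_derivative g' (c + t * (x - c)) * t) (at x within {a..b})"
      by (simp add: o_def)
    then have "((\<lambda>v. t ^ j * g (c + t * (v - c))) has_real_derivative t ^ j * (g' (c + t * (x - c)) * t)) (at x within {a..b})"
      by (rule DERIV_cmult)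
    then show "((\<lambda>x. t ^ j * g (c + t * (x - c))) has_real_derivative t ^ Suc j * g' (c + t * (x - c))) (at x within {a..b})"
      by (simp add: mult_ac)
  next
    show "(\<lambda>t. t ^ j * g (c + t * (x - c))) integrable_on cbox 0 1" if "x \<in> {a..b}" for x
      using mean_along_integrable[OF cg that] by simp
  next
    show "continuous_on ({a..b} \<times> cbox 0 1) (\<lambda>(x, t). t ^ Suc j * g' (c + t * (x - c)))"
      unfolding case_prod_unfold
      by (intro continuous_intros continuous_on_compose2[OF g'])
        (use segment_in_interval in auto)
  qed (use v in auto)
  then show ?thesis unfolding mean_along_def by simp
qed

lemma mean_along_bound:
  assumes "continuous_on {a..b} g" "v \<in> {a..b}" and B: "\<And>x. x \<in> {a..b} \<Longrightarrow> \<bar>g x\<bar> \<le> B"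
  shows "\<bar>mean_along j c g v\<bar> \<le> B"
proof -
  have "B \<ge> 0" using B[OF c] by linarith
  have "\<bar>t ^ j * g (c + t * (v - c))\<bar> \<le> B" if t: "t \<in> {0..1}" for t
  proof -
    have "\<bar>t ^ j\<bar> \<le> 1" using t by (simp add: power_le_one)
    moreover have "\<bar>g (c + t * (v - c))\<bar> \<le> B" using B segment_in_interval assms(2) t by blast
    ultimately have "\<bar>t ^ j\<bar> * \<bar>g (c + t * (v - c))\<bar> \<le> 1 * B" by (intro mult_mono) auto
    then show ?thesis by (simp add: abs_mult)
  qed
  then have "norm (integral {0..1} (\<lambda>t. t ^ j * g (c + t * (v - c)))) \<le> integral {0..1} (\<lambda>t::real. B)"
    using mean_along_integrable[OF assms(1,2)] by (intro integral_norm_bound_integral) auto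
  then show ?thesis by (simp add: mean_along_def)
qed

lemma mean_along_ge:
  assumes "continuous_on {a..b} g" "v \<in> {a..b}" and B: "\<And>x. x \<in> {a..b} \<Longrightarrow> g x \<ge> B"
  shows "mean_along 0 c g v \<ge> B"
proof -
  have "integral {0..1} (\<lambda>t::real. B) \<le> integral {0..1} (\<lambda>t. t ^ 0 * g (c + t * (v - c)))"
    using mean_along_integrable[OF assms(1,2), of 0] segment_in_interval[OF assms(2)]
    by (intro integral_le) (auto intro!: B)
  then show ?thesis by (simp add: mean_along_def)
qed

lemma mean_along_eq:
  assumes g: "\<And>x. x \<in> {a..b} \<Longrightarrow> (g has_real_derivative g' x) (at x within {a..b})"
    and v: "v \<in> {a..b}"
  shows "g v - g c = (v - c) * mean_along 0 c g' v"
proof -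
  have "((\<lambda>t. (v - c) * g' (c + t * (v - c))) has_integral g (c + 1 * (v - c)) - g (c + 0 * (v - c))) {0..1}"
  proof (rule fundamental_theorem_of_calculus)
    fix t :: real assume t: "t \<in> {0..1}"
    have "(g \<circ> (\<lambda>t. c + t * (v - c)) has_real_derivative g' (c + t * (v - c)) * (v - c)) (at t within {0..1})"
    proof (rule DERIV_image_chain)
      have "(\<lambda>t. c + t * (v - c)) ` {0..1} \<subseteq> {a..b}" using segment_in_interval[OF v] by blast
      then show "(g has_real_derivative g' (c + t * (v - c))) (at (c + t * (v - c)) within (\<lambda>t. c + t * (v - c)) ` {0..1})"
        using g[OF segment_in_interval[OF v t]] by (rule DERIV_subset[rotated])
      show "((\<lambda>t. c + t * (v - c)) has_real_derivative v - c) (at t within {0..1})"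
        by (auto intro!: derivative_eq_intros)
    qed
    then show "((\<lambda>t. g (c + t * (v - c))) has_vector_derivative (v - c) * g' (c + t * (v - c))) (at t within {0..1})"
      by (simp add: o_def has_real_derivative_iff_has_vector_derivative mult.commute)
  qed simp
  from integral_unique[OF this] show ?thesis by (simp add: mean_along_def)
qed

end

text \<open>Here \<open>g\<close> vanishes at the critical point \<open>c\<close> of \<open>\<phi>\<close>. Both \<open>g\<close> and \<open>\<phi>1\<close> are \<open>x - c\<close> times a smooth
  function, and the one for \<open>\<phi>1\<close> is at least 1, so \<open>g = \<phi>1 q\<close> with two derivatives of \<open>q\<close> under
  control. Hence \<open>i lam g w\<close> times the exponential is a derivative up to the harmless amplitude
  \<open>- (q w)'\<close>, and the factor \<open>lam\<close> disappears before van der Corput's lemma is applied.\<close>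

lemma stationary_fiber_bound:
  fixes \<phi> \<phi>1 \<phi>2 \<phi>3 \<phi>4 g g1 g2 g3 w w1 w2 z z1 :: "real \<Rightarrow> real"
  assumes c: "c \<in> {a..b}" and lam: "lam > 0" and K: "K \<ge> 1" and len: "b - a \<le> 2"
    and \<phi>: "\<And>x. x \<in> {a..b} \<Longrightarrow> (\<phi> has_real_derivative \<phi>1 x) (at x within {a..b})"
    and \<phi>1: "\<And>x. x \<in> {a..b} \<Longrightarrow> (\<phi>1 has_real_derivative \<phi>2 x) (at x within {a..b})"
    and \<phi>2: "\<And>x. x \<in> {a..b} \<Longrightarrow> (\<phi>2 has_real_derivative \<phi>3 x) (at x within {a..b})"
    and \<phi>3: "\<And>x. x \<in> {a..b} \<Longrightarrow> (\<phi>3 has_real_derivative \<phi>4 x) (at x within {a..b})"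
    and \<phi>4: "continuous_on {a..b} \<phi>4"
    and \<phi>b: "\<And>x. x \<in> {a..b} \<Longrightarrow> \<phi>2 x \<ge> 1 \<and> \<bar>\<phi>3 x\<bar> \<le> K \<and> \<bar>\<phi>4 x\<bar> \<le> K"
    and crit: "\<phi>1 c = 0"
    and g: "\<And>x. x \<in> {a..b} \<Longrightarrow> (g has_real_derivative g1 x) (at x within {a..b})"
    and g1: "\<And>x. x \<in> {a..b} \<Longrightarrow> (g1 has_real_derivative g2 x) (at x within {a..b})"
    and g2: "\<And>x. x \<in> {a..b} \<Longrightarrow> (g2 has_real_derivative g3 x) (at x within {a..b})"
    and g3: "continuous_on {a..b} g3"
    and gb: "\<And>x. x \<in> {a..b} \<Longrightarrow> \<bar>g1 x\<bar> \<le> K \<and> \<bar>g2 x\<bar> \<le> K \<and> \<bar>g3 x\<bar> \<le> K"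
    and gc: "g c = 0"
    and w: "\<And>x. x \<in> {a..b} \<Longrightarrow> (w has_real_derivative w1 x) (at x within {a..b})"
    and w1: "\<And>x. x \<in> {a..b} \<Longrightarrow> (w1 has_real_derivative w2 x) (at x within {a..b})"
    and z: "\<And>x. x \<in> {a..b} \<Longrightarrow> (z has_real_derivative z1 x) (at x within {a..b})"
    and wb: "\<And>x. x \<in> {a..b} \<Longrightarrow> \<bar>w x\<bar> \<le> M \<and> \<bar>w1 x\<bar> \<le> M \<and> \<bar>w2 x\<bar> \<le> M"
    and zb: "\<And>x. x \<in> {a..b} \<Longrightarrow> \<bar>z x\<bar> \<le> M \<and> \<bar>z1 x\<bar> \<le> M"
    and w0: "w a = 0" "w b = 0"
  shows "norm (integral {a..b} (\<lambda>x. cis (lam * \<phi> x) * (of_real (z x) + \<i> * of_real (lam * g x * w x))))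
    \<le> vdC_const 2 * lam powr (- (1 / 2)) * (28 * K ^ 3 * M)"
proof -
  let ?I = "{a..b}"
  have ab: "a \<le> b" using c by simp
  have cI: "continuous_on ?I \<phi>2" "continuous_on ?I \<phi>3" "continuous_on ?I g1" "continuous_on ?I g2"
    using DERIV_continuous_on[OF \<phi>2] DERIV_continuous_on[OF \<phi>3]
      DERIV_continuous_on[OF g1] DERIV_continuous_on[OF g2] by auto
  define n where "n = mean_along 0 c g1"
  define n1 where "n1 = mean_along (Suc 0) c g2"
  define n2 where "n2 = mean_along (Suc (Suc 0)) c g3"
  define d where "d = mean_along 0 c \<phi>2"
  define d1 where "d1 = mean_along (Suc 0) c \<phi>3"
  define d2 where "d2 = mean_along (Suc (Suc 0)) c \<phi>4"
  note defs = n_def n1_def n2_def d_def d1_def d2_def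
  have n: "(n has_real_derivative n1 x) (at x within ?I)" "(n1 has_real_derivative n2 x) (at x within ?I)"
    and d: "(d has_real_derivative d1 x) (at x within ?I)" "(d1 has_real_derivative d2 x) (at x within ?I)"
    if "x \<in> ?I" for x
    unfolding defs by (intro mean_along_deriv[OF c] \<phi>2 \<phi>3 \<phi>4 g1 g2 g3 cI that; assumption)+
  have nb: "\<bar>n x\<bar> \<le> K" "\<bar>n1 x\<bar> \<le> K" "\<bar>n2 x\<bar> \<le> K" and db: "\<bar>d1 x\<bar> \<le> K" "\<bar>d2 x\<bar> \<le> K"
    if "x \<in> ?I" for x
    unfolding defs using gb \<phi>b by (intro mean_along_bound[OF c _ that] \<phi>4 g3 cI; blast)+
  have d0: "d x \<ge> 1" if "x \<in> ?I" for x
    unfolding defs using \<phi>b by (intro mean_along_ge[OF c _ that] cI; blast)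
  define q where "q x = n x / d x" for x
  define q1 where "q1 x = (n1 x - q x * d1 x) / d x" for x
  define q2 where "q2 x = (n2 x - 2 * q1 x * d1 x - q x * d2 x) / d x" for x
  have q: "(q has_real_derivative q1 x) (at x within ?I)" "(q1 has_real_derivative q2 x) (at x within ?I)"
    if x: "x \<in> ?I" for x
  proof -
    have nz: "d x \<noteq> 0" using d0[OF x] by simp
    have "(n1 x * d x - n x * d1 x) / (d x * d x) = q1 x"
      using nz by (simp add: q1_def q_def field_simps)
    then show q': "(q has_real_derivative q1 x) (at x within ?I)"
      unfolding q_def using DERIV_divide[OF n(1)[OF x] d(1)[OF x] nz] by simp
    have "((\<lambda>x. n1 x - q x * d1 x) has_real_derivative n2 x - (q1 x * d1 x + d2 x * q x)) (at x within ?I)"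
      by (intro DERIV_diff DERIV_mult n d q' x)
    from DERIV_divide[OF this d(1)[OF x] nz]
    have "(q1 has_real_derivative ((n2 x - (q1 x * d1 x + d2 x * q x)) * d x
        - (n1 x - q x * d1 x) * d1 x) / (d x * d x)) (at x within ?I)"
      unfolding q1_def .
    moreover have "((n2 x - (q1 x * d1 x + d2 x * q x)) * d x - (n1 x - q x * d1 x) * d1 x) / (d x * d x)
        = ((n2 x - (q1 x * d1 x + d2 x * q x)) - q1 x * d1 x) / d x"
      using nz by (simp add: q1_def divide_simps)
    moreover have "\<dots> = q2 x" by (simp add: q2_def algebra_simps)
    ultimately show "(q1 has_real_derivative q2 x) (at x within ?I)" by simp
  qed
  have div: "\<bar>y / d x\<bar> \<le> B" if "\<bar>y\<bar> \<le> B" "x \<in> ?I" for x y B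
  proof -
    have "\<bar>y\<bar> / d x \<le> \<bar>y\<bar> / 1" using d0[OF that(2)] by (intro divide_left_mono) auto
    then show ?thesis using that d0[OF that(2)] by simp
  qed
  have K2: "K \<le> K * K" "1 \<le> K * K" "K * K \<le> K * K * K" "K \<le> K * K * K"
    using K mult_mono[of 1 K 1 K] mult_mono[of 1 K K K] mult_mono[of 1 K "K * K" "K * K"]
    by (simp_all add: mult.assoc)
  have mm: "\<bar>x * y\<bar> \<le> X * Y" if "\<bar>x\<bar> \<le> X" "\<bar>y\<bar> \<le> Y" for x y X Y :: real
    unfolding abs_mult using that by (intro mult_mono) auto
  have qb0: "\<bar>q x\<bar> \<le> K" if "x \<in> ?I" for x
    unfolding q_def by (intro div nb that)
  have qb1: "\<bar>q1 x\<bar> \<le> 2 * (K * K)" if "x \<in> ?I" for x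
    unfolding q1_def
  proof (rule div[OF _ that])
    have "\<bar>q x * d1 x\<bar> \<le> K * K" by (intro mm qb0 db that)
    then show "\<bar>n1 x - q x * d1 x\<bar> \<le> 2 * (K * K)" using nb(2)[OF that] K2 by linarith
  qed
  have qb2: "\<bar>q2 x\<bar> \<le> 6 * (K * K * K)" if "x \<in> ?I" for x
    unfolding q2_def
  proof (rule div[OF _ that])
    have "\<bar>q x * d2 x\<bar> \<le> K * K" by (intro mm qb0 db that)
    moreover have "\<bar>q1 x * d1 x\<bar> \<le> 2 * (K * K) * K" by (intro mm qb1 db that)
    ultimately show "\<bar>n2 x - 2 * q1 x * d1 x - q x * d2 x\<bar> \<le> 6 * (K * K * K)"
      using nb(3)[OF that] K2 by linarith
  qed
  define P where "P x = q x * w x" for x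
  define P1 where "P1 x = q1 x * w x + q x * w1 x" for x
  define P2 where "P2 x = q2 x * w x + 2 * q1 x * w1 x + q x * w2 x" for x
  have P: "(P has_real_derivative P1 x) (at x within ?I)" "(P1 has_real_derivative P2 x) (at x within ?I)"
    if x: "x \<in> ?I" for x
  proof -
    show "(P has_real_derivative P1 x) (at x within ?I)"
      unfolding P_def P1_def by (rule DERIV_cong[OF DERIV_mult[OF q(1)[OF x] w[OF x]]]) simp
    show "(P1 has_real_derivative P2 x) (at x within ?I)"
      unfolding P1_def P2_def
      by (rule DERIV_cong[OF DERIV_add[OF DERIV_mult[OF q(2)[OF x] w[OF x]]
            DERIV_mult[OF q(1)[OF x] w1[OF x]]]]) simp
  qed
  \<comment> \<open>the factor \<open>x - c\<close> cancels\<close>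
  have gq: "g x = \<phi>1 x * q x" if x: "x \<in> ?I" for x
  proof -
    have "g x = (x - c) * n x" using mean_along_eq[OF c g x] gc by (simp add: n_def)
    moreover have "\<phi>1 x = (x - c) * d x" using mean_along_eq[OF c \<phi>1 x] crit by (simp add: d_def)
    ultimately show ?thesis using d0[OF x] by (simp add: q_def)
  qed
  have M: "M \<ge> 0" using wb[OF c] by linarith
  let ?e = "\<lambda>x. cis (lam * \<phi> x)"
  let ?A = "\<lambda>x. complex_of_real (z x - P1 x)"
  have d\<phi>: "((\<lambda>x. lam * \<phi> x) has_real_derivative lam * \<phi>1 x) (at x within ?I)" if "x \<in> ?I" for x
    by (intro DERIV_cmult \<phi> that)
  have "((\<lambda>x. ?e x * of_real (P1 x) + (lam * \<phi>1 x) *\<^sub>R (\<i> * ?e x) * of_real (P x))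
      has_integral ?e b * of_real (P b) - ?e a * of_real (P a)) ?I"
    by (intro fundamental_theorem_of_calculus[OF ab] has_vector_derivative_mult
      has_vector_derivative_cis has_vector_derivative_of_real d\<phi> P)
  then have 1: "((\<lambda>x. ?e x * of_real (P1 x) + (lam * \<phi>1 x) *\<^sub>R (\<i> * ?e x) * of_real (P x)) has_integral 0) ?I"
    by (simp add: P_def w0)
  have "continuous_on ?I \<phi>" "continuous_on ?I z" "continuous_on ?I P1"
    using DERIV_continuous_on[OF \<phi>] DERIV_continuous_on[OF z] DERIV_continuous_on[OF P(2)] by auto
  then have "(\<lambda>x. ?e x * ?A x) integrable_on ?I"
    by (intro integrable_continuous_real continuous_intros)
  then have 2: "((\<lambda>x. ?e x * ?A x) has_integral integral ?I (\<lambda>x. ?e x * ?A x)) ?I"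
    by (rule integrable_integral)
  have "((\<lambda>x. ?e x * (of_real (z x) + \<i> * of_real (lam * g x * w x))) has_integral
      0 + integral ?I (\<lambda>x. ?e x * ?A x)) ?I"
    by (rule has_integral_eq[OF _ has_integral_add[OF 1 2]])
      (simp add: gq P_def scaleR_conv_of_real algebra_simps)
  then have eq: "integral ?I (\<lambda>x. ?e x * (of_real (z x) + \<i> * of_real (lam * g x * w x)))
      = integral ?I (\<lambda>x. ?e x * ?A x)" by (simp add: integral_unique)
  define p where "p i = (\<lambda>x. lam * (if i = 0 then \<phi> x else if i = 1 then \<phi>1 x else \<phi>2 x))" for i :: nat
  have "norm (integral ?I (\<lambda>x. cis (p 0 x) * ?A x))
    \<le> vdC_const 2 * lam powr (- (1 / real 2)) * (4 * (K * K) * M + 12 * (K * K * K) * M * (b - a))"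
  proof (rule van_der_Corput_amplitude[OF _ ab lam, where A' = "\<lambda>x. of_real (z1 x - P2 x)"])
    show "(p i has_real_derivative p (Suc i) x) (at x within ?I)" if "i < 2" "x \<in> ?I" for i x
      using that \<phi> \<phi>1 less_2_cases[of i] by (auto simp: p_def intro!: DERIV_cmult)
    have "p 2 x \<ge> lam" if "x \<in> ?I" for x
      using \<phi>b[OF that] lam mult_left_mono[of 1 "\<phi>2 x" lam] by (simp add: p_def)
    then show "(\<forall>x\<in>?I. lam \<le> p 2 x) \<or> (\<forall>x\<in>?I. p 2 x \<le> - lam)" by blast
    fix x assume x: "x \<in> ?I"
    show "((\<lambda>x. ?A x) has_vector_derivative of_real (z1 x - P2 x)) (at x within ?I)"
      by (intro has_vector_derivative_of_real DERIV_diff z P x)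
    have M': "M \<le> K * K * M" "K * M \<le> K * K * M" "K * K * M \<le> K * K * K * M" "M \<le> K * K * K * M"
      "K * M \<le> K * K * K * M"
      using K2[THEN mult_right_mono, OF M] by simp_all
    have "\<bar>q1 x * w x\<bar> \<le> 2 * (K * K) * M" "\<bar>q x * w1 x\<bar> \<le> K * M"
      using wb[OF x] by (auto intro!: mm qb0 qb1 x)
    then have "\<bar>z x - P1 x\<bar> \<le> 4 * (K * K) * M"
      using zb[OF x] M' unfolding P1_def by linarith
    then show "norm (?A x) \<le> 4 * (K * K) * M" unfolding norm_of_real .
    have "\<bar>q2 x * w x\<bar> \<le> 6 * (K * K * K) * M" "\<bar>q1 x * w1 x\<bar> \<le> 2 * (K * K) * M" "\<bar>q x * w2 x\<bar> \<le> K * M"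
      using wb[OF x] by (auto intro!: mm qb0 qb1 qb2 x)
    then have "\<bar>z1 x - P2 x\<bar> \<le> 12 * (K * K * K) * M"
      using zb[OF x] M' unfolding P2_def by linarith
    then show "norm (complex_of_real (z1 x - P2 x)) \<le> 12 * (K * K * K) * M" unfolding norm_of_real .
  qed simp
  also have "\<dots> \<le> vdC_const 2 * lam powr (- (1 / real 2)) * (28 * K ^ 3 * M)"
  proof (intro mult_left_mono mult_nonneg_nonneg vdC_const_nonneg)
    have "12 * (K * K * K) * M * (b - a) \<le> 12 * (K * K * K) * M * 2"
      using len K M by (intro mult_left_mono) auto
    moreover have "K * K * M \<le> K * K * K * M" by (rule mult_right_mono[OF K2(3) M])
    ultimately show "4 * (K * K) * M + 12 * (K * K * K) * M * (b - a) \<le> 28 * K ^ 3 * M"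
      unfolding power3_eq_cube by linarith
  qed simp
  finally show ?thesis unfolding eq by (simp add: p_def)
qed

text \<open>At the end \<open>a\<close> the derivative of the phase may be arbitrarily small, but it grows at least like
  \<open>x - a\<close> and \<open>w\<close> vanishes there to second order. So \<open>w / \<phi>1\<close> has a bounded derivative, and a single
  integration by parts gives the decay \<open>1 / lam\<close>, uniformly in \<open>\<phi>1 a\<close>.\<close>

lemma nonstationary_fiber_bound:
  fixes \<phi> \<phi>1 \<phi>2 w w1 w2 :: "real \<Rightarrow> real"
  assumes ab: "a \<le> b" and lam: "lam > 0"
    and \<phi>: "\<And>x. x \<in> {a..b} \<Longrightarrow> (\<phi> has_real_derivative \<phi>1 x) (at x within {a..b})"
    and \<phi>1: "\<And>x. x \<in> {a..b} \<Longrightarrow> (\<phi>1 has_real_derivative \<phi>2 x) (at x within {a..b})"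
    and \<phi>2: "\<And>x. x \<in> {a..b} \<Longrightarrow> 1 \<le> \<phi>2 x \<and> \<phi>2 x \<le> 3"
    and pos: "\<phi>1 a > 0"
    and w: "\<And>x. x \<in> {a..b} \<Longrightarrow> (w has_real_derivative w1 x) (at x within {a..b})"
    and w1: "\<And>x. x \<in> {a..b} \<Longrightarrow> (w1 has_real_derivative w2 x) (at x within {a..b})"
    and w2: "\<And>x. x \<in> {a..b} \<Longrightarrow> \<bar>w2 x\<bar> \<le> M"
    and w0: "w a = 0" "w1 a = 0" "w b = 0"
  shows "norm (integral {a..b} (\<lambda>x. cis (lam * \<phi> x) * of_real (w x))) \<le> 4 * M * (b - a) / lam"
proof -
  let ?I = "{a..b}"
  have M: "M \<ge> 0" using w2[of a] ab by simp
  have \<phi>a: "\<phi>1 x > x - a" if "x \<in> ?I" for x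
  proof -
    have "\<phi>1 x - \<phi>1 a \<ge> 1 * (x - a)"
      using \<phi>2 that by (intro derivative_ge_imp_growth[OF \<phi>1]) auto
    then show ?thesis using pos by simp
  qed
  have w1b: "\<bar>w1 x\<bar> \<le> M * (x - a)" if x: "x \<in> ?I" for x
    using field_differentiable_bound[of ?I w1 w2 M x a] w1 w2 x ab w0 by auto
  have wb: "\<bar>w x\<bar> \<le> M * (x - a) * (x - a)" if x: "x \<in> ?I" for x
  proof -
    have "norm (w x - w a) \<le> M * (x - a) * norm (x - a)"
    proof (rule field_differentiable_bound[of "{a..x}"])
      fix t assume t: "t \<in> {a..x}"
      show "(w has_real_derivative w1 t) (at t within {a..x})"
        using w[of t] t x by (auto intro: DERIV_subset)
      have "\<bar>w1 t\<bar> \<le> M * (t - a)" using t x by (intro w1b) auto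
      also have "\<dots> \<le> M * (x - a)" using t M by (intro mult_left_mono) auto
      finally show "norm (w1 t) \<le> M * (x - a)" by simp
    qed (use x in auto)
    then show ?thesis using w0 x by simp
  qed
  define Q where "Q x = w x / \<phi>1 x" for x
  define Q1 where "Q1 x = w1 x / \<phi>1 x - w x * \<phi>2 x / (\<phi>1 x)\<^sup>2" for x
  have Q: "(Q has_real_derivative Q1 x) (at x within ?I)" if x: "x \<in> ?I" for x
  proof -
    have nz: "\<phi>1 x \<noteq> 0" using \<phi>a[OF x] x by auto
    show ?thesis unfolding Q_def
      by (rule derivative_eq_intros w \<phi>1 x nz refl)+
        (use nz in \<open>simp add: Q1_def field_simps power2_eq_square\<close>)
  qed
  have Q1b: "\<bar>Q1 x\<bar> \<le> 4 * M" if x: "x \<in> ?I" for x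
  proof -
    have f: "\<phi>1 x > 0" "x - a \<le> \<phi>1 x" "0 \<le> x - a" using \<phi>a[OF x] x by auto
    have "\<bar>w1 x\<bar> \<le> M * \<phi>1 x" using w1b[OF x] mult_left_mono[OF f(2) M] by linarith
    then have 1: "\<bar>w1 x / \<phi>1 x\<bar> \<le> M" using f by (simp add: field_simps)
    have "M * (x - a) * (x - a) \<le> M * \<phi>1 x * \<phi>1 x" using f M by (intro mult_mono) auto
    then have "\<bar>w x\<bar> \<le> M * \<phi>1 x * \<phi>1 x" using wb[OF x] by linarith
    then have "\<bar>w x\<bar> * \<phi>2 x \<le> M * \<phi>1 x * \<phi>1 x * 3" using \<phi>2[OF x] M f by (intro mult_mono) auto
    then have 2: "\<bar>w x * \<phi>2 x / (\<phi>1 x)\<^sup>2\<bar> \<le> 3 * M"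
      using f \<phi>2[OF x] by (simp add: abs_mult power2_eq_square divide_le_eq mult_ac)
    show ?thesis using 1 2 unfolding Q1_def by linarith
  qed
  let ?e = "\<lambda>x. cis (lam * \<phi> x)"
  have d\<phi>: "((\<lambda>x. lam * \<phi> x) has_real_derivative lam * \<phi>1 x) (at x within ?I)" if "x \<in> ?I" for x
    by (intro DERIV_cmult \<phi> that)
  have "((\<lambda>x. ?e x * of_real (Q1 x) + (lam * \<phi>1 x) *\<^sub>R (\<i> * ?e x) * of_real (Q x))
      has_integral ?e b * of_real (Q b) - ?e a * of_real (Q a)) ?I"
    by (intro fundamental_theorem_of_calculus[OF ab] has_vector_derivative_mult
      has_vector_derivative_cis has_vector_derivative_of_real d\<phi> Q)
  then have 1: "((\<lambda>x. ?e x * of_real (Q1 x) + (lam * \<phi>1 x) *\<^sub>R (\<i> * ?e x) * of_real (Q x)) has_integral 0) ?I"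
    by (simp add: Q_def w0)
  have "continuous_on ?I \<phi>" "continuous_on ?I w"
    using DERIV_continuous_on[OF \<phi>] DERIV_continuous_on[OF w] by auto
  then have "(\<lambda>x. ?e x * of_real (w x)) integrable_on ?I"
    by (intro integrable_continuous_real continuous_intros)
  then have 2: "((\<lambda>x. \<i> * of_real lam * (?e x * of_real (w x))) has_integral
      \<i> * of_real lam * integral ?I (\<lambda>x. ?e x * of_real (w x))) ?I"
    by (intro has_integral_mult_right integrable_integral)
  have "((\<lambda>x. ?e x * of_real (Q1 x)) has_integral
      0 - \<i> * of_real lam * integral ?I (\<lambda>x. ?e x * of_real (w x))) ?I"
  proof (rule has_integral_eq[OF _ has_integral_diff[OF 1 2]])
    fix x assume x: "x \<in> ?I"
    have nz: "\<phi>1 x \<noteq> 0" using \<phi>a[OF x] x by auto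
    then have "w x = \<phi>1 x * Q x" by (simp add: Q_def)
    then show "?e x * of_real (Q1 x) + (lam * \<phi>1 x) *\<^sub>R (\<i> * ?e x) * of_real (Q x)
        - \<i> * of_real lam * (?e x * of_real (w x)) = ?e x * of_real (Q1 x)"
      by (simp add: scaleR_conv_of_real algebra_simps)
  qed
  from integral_unique[OF this]
  have "norm (\<i> * of_real lam * integral ?I (\<lambda>x. ?e x * of_real (w x)))
      = norm (integral ?I (\<lambda>x. ?e x * of_real (Q1 x)))" by (simp add: norm_minus_commute)
  also have "\<dots> \<le> 4 * M * (b - a)"
    using ab M Q1b by (intro norm_integral_le) (auto simp: norm_mult)
  finally show ?thesis using lam by (simp add: norm_mult pos_le_divide_eq mult.commute)
qed

lemma nonstationary_fiber_bound_reflected: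
  fixes \<phi> \<phi>1 \<phi>2 w w1 w2 :: "real \<Rightarrow> real"
  assumes ab: "a \<le> b" and lam: "lam > 0"
    and \<phi>: "\<And>x. x \<in> {a..b} \<Longrightarrow> (\<phi> has_real_derivative \<phi>1 x) (at x within {a..b})"
    and \<phi>1: "\<And>x. x \<in> {a..b} \<Longrightarrow> (\<phi>1 has_real_derivative \<phi>2 x) (at x within {a..b})"
    and \<phi>2: "\<And>x. x \<in> {a..b} \<Longrightarrow> 1 \<le> \<phi>2 x \<and> \<phi>2 x \<le> 3"
    and neg: "\<phi>1 b < 0"
    and w: "\<And>x. x \<in> {a..b} \<Longrightarrow> (w has_real_derivative w1 x) (at x within {a..b})"
    and w1: "\<And>x. x \<in> {a..b} \<Longrightarrow> (w1 has_real_derivative w2 x) (at x within {a..b})"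
    and w2: "\<And>x. x \<in> {a..b} \<Longrightarrow> \<bar>w2 x\<bar> \<le> M"
    and w0: "w a = 0" "w1 b = 0" "w b = 0"
  shows "norm (integral {a..b} (\<lambda>x. cis (lam * \<phi> x) * of_real (w x))) \<le> 4 * M * (b - a) / lam"
proof -
  have refl_deriv: "((\<lambda>x. g (- x)) has_real_derivative - g' (- x)) (at x within {- b..- a})"
    if "\<And>x. x \<in> {a..b} \<Longrightarrow> (g has_real_derivative g' x) (at x within {a..b})" "x \<in> {- b..- a}"
    for g g' :: "real \<Rightarrow> real" and x
  proof -
    have "(g \<circ> uminus has_real_derivative g' (- x) * (- 1)) (at x within {- b..- a})"
    proof (rule DERIV_image_chain)
      show "(g has_real_derivative g' (- x)) (at (- x) within uminus ` {- b..- a})"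
        using that by (simp add: image_uminus_atLeastAtMost)
      show "(uminus has_real_derivative - 1) (at x within {- b..- a})"
        by (auto intro!: derivative_eq_intros)
    qed
    then show ?thesis by (simp add: o_def)
  qed
  have "norm (integral {- b..- a} (\<lambda>x. cis (lam * \<phi> (- x)) * of_real (w (- x))))
      \<le> 4 * M * (- a - - b) / lam"
  proof (rule nonstationary_fiber_bound[where \<phi> = "\<lambda>x. \<phi> (- x)" and w = "\<lambda>x. w (- x)"])
    show "((\<lambda>x. \<phi> (- x)) has_real_derivative - \<phi>1 (- x)) (at x within {- b..- a})" if "x \<in> {- b..- a}" for x
      by (intro refl_deriv \<phi> that)
    show "((\<lambda>x. - \<phi>1 (- x)) has_real_derivative \<phi>2 (- x)) (at x within {- b..- a})" if "x \<in> {- b..- a}" for x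
      using DERIV_minus[OF refl_deriv[OF \<phi>1 that]] by simp
    show "((\<lambda>x. w (- x)) has_real_derivative - w1 (- x)) (at x within {- b..- a})" if "x \<in> {- b..- a}" for x
      by (intro refl_deriv w that)
    show "((\<lambda>x. - w1 (- x)) has_real_derivative w2 (- x)) (at x within {- b..- a})" if "x \<in> {- b..- a}" for x
      using DERIV_minus[OF refl_deriv[OF w1 that]] by simp
    show "1 \<le> \<phi>2 (- x) \<and> \<phi>2 (- x) \<le> 3" "\<bar>w2 (- x)\<bar> \<le> M" if "x \<in> {- b..- a}" for x
      using \<phi>2[of "- x"] w2[of "- x"] that by auto
  qed (use ab lam neg w0 in simp_all)
  then show ?thesis
    using Henstock_Kurzweil_Integration.integral_reflect_real[of b a "\<lambda>x. cis (lam * \<phi> x) * of_real (w x)"] by simp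
qed

section \<open>The curve of critical points\<close>

text \<open>Both \<open>g\<close> and \<open>- g\<close> become convex when \<open>L t (1 - t)\<close> is subtracted, and a convex function that
  vanishes at the ends is nonpositive between them.\<close>

lemma interpolation_error:
  fixes g :: "real \<Rightarrow> real"
  assumes g: "\<And>t. t \<in> {0..1} \<Longrightarrow> (g has_real_derivative g' t) (at t)"
    and g': "\<And>t. t \<in> {0..1} \<Longrightarrow> (g' has_real_derivative g'' t) (at t)"
    and bound: "\<And>t. t \<in> {0..1} \<Longrightarrow> \<bar>g'' t\<bar> \<le> 2 * L"
    and ends: "g 0 = 0" "g 1 = 0" and t: "t \<in> {0..1}"
  shows "\<bar>g t\<bar> \<le> L * (t * (1 - t))"
proof -
  have upper: "f t \<le> L * (t * (1 - t))"
    if f: "\<And>t. t \<in> {0..1} \<Longrightarrow> (f has_real_derivative f' t) (at t)"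
    and f': "\<And>t. t \<in> {0..1} \<Longrightarrow> (f' has_real_derivative f'' t) (at t)"
    and f'': "\<And>t. t \<in> {0..1} \<Longrightarrow> \<bar>f'' t\<bar> \<le> 2 * L"
    and f01: "f 0 = 0" "f 1 = 0" for f f' f'' :: "real \<Rightarrow> real"
  proof -
    have "convex_on {0..1} (\<lambda>t. f t - L * (t * (1 - t)))"
    proof (rule f''_ge0_imp_convex)
      fix x :: real assume x: "x \<in> {0..1}"
      show "((\<lambda>t. f t - L * (t * (1 - t))) has_real_derivative f' x - L * (1 - 2 * x)) (at x)"
        by (rule derivative_eq_intros f[OF x] refl)+ (simp add: algebra_simps)
      show "((\<lambda>x. f' x - L * (1 - 2 * x)) has_real_derivative f'' x + 2 * L) (at x)"
        by (rule derivative_eq_intros f'[OF x] refl)+ (simp add: algebra_simps)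
      show "0 \<le> f'' x + 2 * L" using f''[OF x] by linarith
    qed simp
    from convex_onD[OF this, of t 0 1] t show ?thesis using f01 by simp
  qed
  from upper[of g g' g''] upper[of "\<lambda>t. - g t" "\<lambda>t. - g' t" "\<lambda>t. - g'' t"] assms
  show ?thesis by (auto intro: DERIV_minus simp: abs_le_iff)
qed

text \<open>The normalised situation. \<open>F\<close> is the remainder of the phase, \<open>y1\<close> and \<open>y2\<close> are the coefficients
  of its linear part, and \<open>K\<close> bounds the derivatives of \<open>F\<close>. The amplitude lives in a smaller ball of
  radius \<open>r < \<epsilon>\<close>; the gap makes room for compact fibers inside the open ball, and no estimate depends
  on its size. The generous factor 1000 absorbs the numerical constants of \<open>\<psi>_top\<close>.\<close>

locale degenerate_phase =
  fixes F \<beta> :: "real \<times> real \<Rightarrow> real" and K M \<epsilon> r lam s y1 y2 :: real and k :: nat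
  assumes smooth_F: "smooth_on UNIV F" and smooth_\<beta>: "smooth_on UNIV \<beta>"
    and r: "0 < r" "r < \<epsilon>" and lam: "lam \<ge> 1" and s: "s \<in> {1, -1}" and k: "k \<in> {2, 3, 4}"
    and K: "K \<ge> 1" and small: "1000 * K ^ 3 * \<epsilon> \<le> 1"
    and F_order2: "\<And>a b p. p \<in> ball (0, 0) \<epsilon> \<Longrightarrow> a + b = 2 \<Longrightarrow> \<bar>partial_deriv a b F p\<bar> \<le> K * \<epsilon>"
    and F_order34: "\<And>a b p. p \<in> ball (0, 0) \<epsilon> \<Longrightarrow> a + b \<in> {3, 4} \<Longrightarrow> \<bar>partial_deriv a b F p\<bar> \<le> K"
    and F_top: "\<And>p. p \<in> ball (0, 0) \<epsilon> \<Longrightarrow> \<bar>partial_deriv k 0 F p\<bar> \<le> 2 * K * \<epsilon>"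
    and F_uuv: "\<And>p. k = 4 \<Longrightarrow> p \<in> ball (0, 0) \<epsilon> \<Longrightarrow> \<bar>partial_deriv 2 1 F p\<bar> \<le> 2 * K * \<epsilon>"
    and \<beta>_bound: "\<And>a b p. a + b \<le> 2 \<Longrightarrow> \<bar>partial_deriv a b \<beta> p\<bar> \<le> M"
    and \<beta>_zero: "\<And>a b u v. r\<^sup>2 \<le> u\<^sup>2 + v\<^sup>2 \<Longrightarrow> partial_deriv a b \<beta> (u, v) = 0"
begin

abbreviation D :: "nat \<Rightarrow> nat \<Rightarrow> real \<times> real \<Rightarrow> real" where "D a b \<equiv> partial_deriv a b F"
abbreviation E :: "nat \<Rightarrow> nat \<Rightarrow> real \<times> real \<Rightarrow> real" where "E a b \<equiv> partial_deriv a b \<beta>"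

definition \<Phi> :: "real \<Rightarrow> real \<Rightarrow> real"
  where "\<Phi> u v = y1 * u + y2 * v + v\<^sup>2 + s * u ^ k + D 0 0 (u, v)"
definition \<Phi>u :: "real \<Rightarrow> real \<Rightarrow> real"
  where "\<Phi>u u v = y1 + s * (real k * u ^ (k - 1)) + D 1 0 (u, v)"
definition \<Phi>v :: "real \<Rightarrow> real \<Rightarrow> real"
  where "\<Phi>v u v = y2 + 2 * v + D 0 1 (u, v)"

text \<open>The fibers that contain a critical point, and (by an arbitrary choice off this set) the critical
  point itself. It is unique by \<open>zeros_lipschitz\<close>.\<close>

definition crit :: "real set"
  where "crit = {u. \<exists>v. (u, v) \<in> ball (0, 0) \<epsilon> \<and> \<Phi>v u v = 0}"
definition \<gamma> :: "real \<Rightarrow> real"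
  where "\<gamma> u = (SOME v. (u, v) \<in> ball (0, 0) \<epsilon> \<and> \<Phi>v u v = 0)"

lemma \<epsilon>: "0 < \<epsilon>" "2 * \<epsilon> \<le> 1" "K * \<epsilon> \<le> 1 / 1000" "K * K * \<epsilon> \<le> 1 / 1000" "K * K * K * \<epsilon> \<le> 1 / 1000"
proof -
  show e: "0 < \<epsilon>" using r by linarith
  have c: "K * K * K * \<epsilon> \<le> 1 / 1000" using small by (simp add: power3_eq_cube)
  have "1 * (K * \<epsilon>) \<le> K * (K * \<epsilon>)" "1 * (K * K * \<epsilon>) \<le> K * (K * K * \<epsilon>)" "1 * \<epsilon> \<le> K * \<epsilon>"
    using K e by (intro mult_right_mono; simp)+
  with c show "2 * \<epsilon> \<le> 1" "K * \<epsilon> \<le> 1 / 1000" "K * K * \<epsilon> \<le> 1 / 1000" "K * K * K * \<epsilon> \<le> 1 / 1000"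
    by (simp_all add: mult.assoc)
qed

lemma M: "M \<ge> 0"
  using \<beta>_bound[of 0 0 "(0, 0)"] abs_ge_zero[of "E 0 0 (0, 0)"] by linarith

lemma in_ball: "(u, v) \<in> ball (0, 0) \<epsilon> \<longleftrightarrow> u\<^sup>2 + v\<^sup>2 < \<epsilon>\<^sup>2"
  using mem_ball_Pair[of \<epsilon> u v] \<epsilon>(1) by simp

lemma \<gamma>: "u \<in> crit \<Longrightarrow> (u, \<gamma> u) \<in> ball (0, 0) \<epsilon>" "u \<in> crit \<Longrightarrow> \<Phi>v u (\<gamma> u) = 0"
  unfolding crit_def \<gamma>_def mem_Collect_eq by (metis (mono_tags, lifting) someI_ex)+

lemma D02: "p \<in> ball (0, 0) \<epsilon> \<Longrightarrow> 1 \<le> 2 + D 0 2 p \<and> 2 + D 0 2 p \<le> 3"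
  using F_order2[of p 0 2] \<epsilon>(3) by (simp add: abs_le_iff)

lemma \<Phi>_v: "(\<Phi> u has_real_derivative \<Phi>v u v) (at v within S)"
proof -
  have "((\<lambda>v. D 0 0 (u, v)) has_real_derivative D 0 1 (u, v)) (at v within S)"
    using partial_deriv_v[OF smooth_F] by simp
  then show ?thesis unfolding \<Phi>_def[abs_def] \<Phi>v_def by (auto intro!: derivative_eq_intros)
qed

lemma \<Phi>_u: "((\<lambda>u. \<Phi> u v) has_real_derivative \<Phi>u u v) (at u within S)"
proof -
  have "((\<lambda>u. D 0 0 (u, v)) has_real_derivative D 1 0 (u, v)) (at u within S)"
    using partial_deriv_u[OF smooth_F] by simp
  then show ?thesis unfolding \<Phi>_def[abs_def] \<Phi>u_def by (auto intro!: derivative_eq_intros)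
qed

lemma \<Phi>v_v: "(\<Phi>v u has_real_derivative 2 + D 0 2 (u, v)) (at v within S)"
proof -
  have "((\<lambda>v. D 0 1 (u, v)) has_real_derivative D 0 2 (u, v)) (at v within S)"
    using partial_deriv_v[OF smooth_F, of 0 1] by (simp add: numeral_2_eq_2)
  then show ?thesis unfolding \<Phi>v_def[abs_def] by (auto intro!: derivative_eq_intros)
qed

lemma affine_deriv: "((\<lambda>t. a + t * b) has_real_derivative b) (at t within S)" for a b t :: real
  by (auto intro!: derivative_eq_intros)

lemma \<Phi>v_segment:
  "((\<lambda>t. \<Phi>v (u + t * x) (v + t * y)) has_real_derivative
     x * D 1 1 (u + t * x, v + t * y) + y * (2 + D 0 2 (u + t * x, v + t * y))) (at t within S)"
proof -
  have "((\<lambda>t. D 0 1 (u + t * x, v + t * y)) has_real_derivative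
      x * D 1 1 (u + t * x, v + t * y) + y * D 0 2 (u + t * x, v + t * y)) (at t within S)"
    using partial_deriv_curve[OF smooth_F affine_deriv affine_deriv, of 0 1] by (simp add: numeral_2_eq_2)
  then show ?thesis unfolding \<Phi>v_def[abs_def]
    by (auto intro!: derivative_eq_intros simp: algebra_simps)
qed

text \<open>Strict convexity of the squared norm, in quantitative form: the defect is what lets a critical
  point near a chord of the ball stay inside the ball.\<close>

lemma segment_norm:
  fixes u1 v1 x y t :: real
  shows "(u1 + t * x)\<^sup>2 + (v1 + t * y)\<^sup>2
    = (1 - t) * (u1\<^sup>2 + v1\<^sup>2) + t * ((u1 + x)\<^sup>2 + (v1 + y)\<^sup>2) - t * (1 - t) * (x\<^sup>2 + y\<^sup>2)"
  by (simp add: power2_eq_square algebra_simps)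

lemma segment_ball:
  assumes "(u1, v1) \<in> ball (0, 0) \<epsilon>" "(u1 + x, v1 + y) \<in> ball (0, 0) \<epsilon>" "t \<in> {0..1}"
  shows "(u1 + t * x)\<^sup>2 + (v1 + t * y)\<^sup>2 < \<epsilon>\<^sup>2 - t * (1 - t) * (x\<^sup>2 + y\<^sup>2)"
    and "(u1 + t * x, v1 + t * y) \<in> ball (0, 0) \<epsilon>"
proof -
  have "(1 - t) * (u1\<^sup>2 + v1\<^sup>2) + t * ((u1 + x)\<^sup>2 + (v1 + y)\<^sup>2) < \<epsilon>\<^sup>2"
    using assms unfolding in_ball by (intro convex_bound_lt) auto
  then show 1: "(u1 + t * x)\<^sup>2 + (v1 + t * y)\<^sup>2 < \<epsilon>\<^sup>2 - t * (1 - t) * (x\<^sup>2 + y\<^sup>2)"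
    using segment_norm[of u1 t x v1 y] by linarith
  have "0 \<le> t * (1 - t) * (x\<^sup>2 + y\<^sup>2)" using assms(3) by (intro mult_nonneg_nonneg) auto
  then show "(u1 + t * x, v1 + t * y) \<in> ball (0, 0) \<epsilon>" using 1 unfolding in_ball by linarith
qed

text \<open>Along the segment joining two zeros of \<open>\<Phi>v\<close> the mean value theorem gives
  \<open>\<Phi>\<^sub>u\<^sub>v x + \<Phi>\<^sub>v\<^sub>v y = 0\<close> for its direction \<open>(x, y)\<close>.\<close>

lemma zeros_lipschitz:
  assumes p1: "(u1, v1) \<in> ball (0, 0) \<epsilon>" "\<Phi>v u1 v1 = 0"
    and p2: "(u2, v2) \<in> ball (0, 0) \<epsilon>" "\<Phi>v u2 v2 = 0"
  shows "\<bar>v2 - v1\<bar> \<le> \<bar>u2 - u1\<bar>"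
proof -
  define x y where xy: "x = u2 - u1" "y = v2 - v1"
  have "\<exists>t>0. t < 1 \<and> \<Phi>v (u1 + 1 * x) (v1 + 1 * y) - \<Phi>v (u1 + 0 * x) (v1 + 0 * y)
      = (1 - 0) * (x * D 1 1 (u1 + t * x, v1 + t * y) + y * (2 + D 0 2 (u1 + t * x, v1 + t * y)))"
    by (intro MVT2 \<Phi>v_segment) auto
  then obtain t where t: "0 < t" "t < 1"
    and "\<Phi>v (u1 + 1 * x) (v1 + 1 * y) - \<Phi>v (u1 + 0 * x) (v1 + 0 * y)
      = (1 - 0) * (x * D 1 1 (u1 + t * x, v1 + t * y) + y * (2 + D 0 2 (u1 + t * x, v1 + t * y)))"
    by blast
  then have eq: "y * (2 + D 0 2 (u1 + t * x, v1 + t * y)) = - (x * D 1 1 (u1 + t * x, v1 + t * y))"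
    using p1 p2 by (simp add: xy)
  have q: "(u1 + t * x, v1 + t * y) \<in> ball (0, 0) \<epsilon>"
    using segment_ball(2)[of u1 v1 x y t] p1 p2 t by (simp add: xy)
  have "\<bar>y\<bar> * 1 \<le> \<bar>y\<bar> * \<bar>2 + D 0 2 (u1 + t * x, v1 + t * y)\<bar>"
    using D02[OF q] by (intro mult_left_mono) auto
  also have "\<dots> = \<bar>x\<bar> * \<bar>D 1 1 (u1 + t * x, v1 + t * y)\<bar>"
    unfolding abs_mult[symmetric] eq by simp
  also have "\<dots> \<le> \<bar>x\<bar> * 1"
    using F_order2[OF q, of 1 1] \<epsilon>(3) by (intro mult_left_mono) auto
  finally show ?thesis by (simp add: xy)
qed

text \<open>Take two critical points in the ball and the chord between them, of length \<open>l\<close>. At the parameter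
  \<open>t\<close> the function \<open>\<Phi>v\<close> differs from 0 by at most \<open>K X\<close> with \<open>X = t(1 - t) l\<^sup>2\<close>, since it vanishes at
  both ends. As its \<open>v\<close>-derivative is at least 1, it has a zero at vertical distance at most \<open>K X\<close>
  from the chord. This zero is in the ball, because the squared norm on the chord stays below
  \<open>\<epsilon>\<^sup>2\<close> by at least \<open>X\<close>, while the vertical shift changes it by a small multiple of \<open>X\<close> only.\<close>

lemma crit_interval:
  assumes "u1 \<in> crit" "u2 \<in> crit" "u1 \<le> u" "u \<le> u2"
  shows "u \<in> crit"
proof (cases "u1 = u2")
  case False
  then have u12: "u1 < u2" using assms by simp
  obtain v1 v2 where p1: "(u1, v1) \<in> ball (0, 0) \<epsilon>" "\<Phi>v u1 v1 = 0"
    and p2: "(u2, v2) \<in> ball (0, 0) \<epsilon>" "\<Phi>v u2 v2 = 0"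
    using assms unfolding crit_def by blast
  define x y where xy: "x = u2 - u1" "y = v2 - v1"
  define t where "t = (u - u1) / x"
  have t: "t \<in> {0..1}" "u1 + t * x = u" using assms u12 by (auto simp: t_def xy field_simps)
  define v where "v = v1 + t * y"
  define X where "X = t * (1 - t) * (x\<^sup>2 + y\<^sup>2)"
  have X0: "X \<ge> 0" unfolding X_def using t by (intro mult_nonneg_nonneg) auto
  have seg: "(u1 + \<tau> * x, v1 + \<tau> * y) \<in> ball (0, 0) \<epsilon>" if "\<tau> \<in> {0..1}" for \<tau>
    using segment_ball(2)[of u1 v1 x y \<tau>] p1 p2 that by (simp add: xy)
  have norm_v: "u\<^sup>2 + v\<^sup>2 < \<epsilon>\<^sup>2 - X"
    using segment_ball(1)[of u1 v1 x y t] p1 p2 t unfolding X_def v_def by (simp add: xy)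
  have "\<bar>\<Phi>v (u1 + t * x) (v1 + t * y)\<bar> \<le> (K * (x\<^sup>2 + y\<^sup>2)) * (t * (1 - t))"
  proof (rule interpolation_error[where g = "\<lambda>t. \<Phi>v (u1 + t * x) (v1 + t * y)", OF \<Phi>v_segment])
    let ?p = "\<lambda>t. (u1 + t * x, v1 + t * y)"
    let ?g2 = "\<lambda>t. x * (x * D 2 1 (?p t) + y * D 1 2 (?p t)) + y * (x * D 1 2 (?p t) + y * D 0 3 (?p t))"
    fix \<tau> :: real assume \<tau>: "\<tau> \<in> {0..1}"
    have "((\<lambda>t. D 1 1 (?p t)) has_real_derivative x * D 2 1 (?p \<tau>) + y * D 1 2 (?p \<tau>)) (at \<tau>)"
      using partial_deriv_curve[OF smooth_F affine_deriv affine_deriv, of 1 1] by (simp add: numeral_2_eq_2)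
    moreover have "((\<lambda>t. D 0 2 (?p t)) has_real_derivative x * D 1 2 (?p \<tau>) + y * D 0 3 (?p \<tau>)) (at \<tau>)"
      using partial_deriv_curve[OF smooth_F affine_deriv affine_deriv, of 0 2] by (simp add: numeral_2_eq_2 numeral_3_eq_3)
    ultimately have "((\<lambda>t. x * D 1 1 (?p t) + y * D 0 2 (?p t)) has_real_derivative ?g2 \<tau>) (at \<tau>)"
      by (intro DERIV_add DERIV_cmult)
    from DERIV_add[OF this DERIV_const[of "2 * y"]]
    have "((\<lambda>t. (x * D 1 1 (?p t) + y * D 0 2 (?p t)) + 2 * y) has_real_derivative ?g2 \<tau> + 0) (at \<tau>)" .
    moreover have "(\<lambda>t. (x * D 1 1 (?p t) + y * D 0 2 (?p t)) + 2 * y)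
        = (\<lambda>t. x * D 1 1 (?p t) + y * (2 + D 0 2 (?p t)))" by (simp add: algebra_simps)
    ultimately show "((\<lambda>t. x * D 1 1 (?p t) + y * (2 + D 0 2 (?p t))) has_real_derivative ?g2 \<tau>) (at \<tau>)"
      by (simp only: add_0_right)
    have b: "\<bar>D 2 1 (?p \<tau>)\<bar> \<le> K" "\<bar>D 1 2 (?p \<tau>)\<bar> \<le> K" "\<bar>D 0 3 (?p \<tau>)\<bar> \<le> K"
      by (intro F_order34 seg \<tau>; simp)+
    have le_K: "\<bar>a * (b * d)\<bar> \<le> \<bar>a\<bar> * \<bar>b\<bar> * K" if "\<bar>d\<bar> \<le> K" for a b d :: real
      using that by (simp add: abs_mult mult.assoc mult_left_mono)
    have "?g2 \<tau> = x * (x * D 2 1 (?p \<tau>)) + x * (y * D 1 2 (?p \<tau>)) + y * (x * D 1 2 (?p \<tau>)) + y * (y * D 0 3 (?p \<tau>))"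
      by (simp add: algebra_simps)
    then have "\<bar>?g2 \<tau>\<bar> \<le> \<bar>x\<bar> * \<bar>x\<bar> * K + \<bar>x\<bar> * \<bar>y\<bar> * K + \<bar>y\<bar> * \<bar>x\<bar> * K + \<bar>y\<bar> * \<bar>y\<bar> * K"
      using le_K[OF b(1), of x x] le_K[OF b(2), of x y] le_K[OF b(2), of y x] le_K[OF b(3), of y y]
      by linarith
    also have "\<dots> = (\<bar>x\<bar> + \<bar>y\<bar>)\<^sup>2 * K" by (simp add: power2_eq_square algebra_simps)
    also have "\<dots> \<le> (2 * (x\<^sup>2 + y\<^sup>2)) * K"
      using sum_squares_bound[of "\<bar>x\<bar>" "\<bar>y\<bar>"] K
      by (intro mult_right_mono) (auto simp: power2_eq_square algebra_simps)
    finally show "\<bar>?g2 \<tau>\<bar> \<le> 2 * (K * (x\<^sup>2 + y\<^sup>2))" by (simp add: mult_ac)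
  qed (use p1 p2 t in \<open>simp_all add: xy\<close>)
  then have gv: "\<bar>\<Phi>v u v\<bar> \<le> K * X" using t by (simp add: v_def X_def mult_ac)
  \<comment> \<open>the shift by \<open>K X\<close> does not leave the ball\<close>
  have vertical: "(u, w) \<in> ball (0, 0) \<epsilon>" if w: "w \<in> {v - K * X..v + K * X}" for w
  proof -
    have KX: "0 \<le> K * X" using K X0 by simp
    have v\<epsilon>: "\<bar>v\<bar> \<le> \<epsilon>" and X\<epsilon>: "X \<le> \<epsilon>\<^sup>2"
    proof -
      have "v\<^sup>2 \<le> \<epsilon>\<^sup>2" using norm_v X0 zero_le_power2[of u] by linarith
      then show "\<bar>v\<bar> \<le> \<epsilon>" using \<epsilon>(1) by (simp add: abs_le_square_iff[symmetric])
      show "X \<le> \<epsilon>\<^sup>2" using norm_v zero_le_power2[of u] zero_le_power2[of v] by linarith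
    qed
    have d: "\<bar>w - v\<bar> \<le> K * X" using w by auto
    have "w\<^sup>2 = v\<^sup>2 + 2 * (v * (w - v)) + (w - v)\<^sup>2" by (simp add: power2_eq_square algebra_simps)
    moreover have "v * (w - v) \<le> \<epsilon> * (K * X)"
    proof -
      have "v * (w - v) \<le> \<bar>v\<bar> * \<bar>w - v\<bar>" by (metis abs_ge_self abs_mult)
      also have "\<dots> \<le> \<epsilon> * (K * X)" using v\<epsilon> d \<epsilon>(1) by (intro mult_mono) auto
      finally show ?thesis .
    qed
    moreover have "(w - v)\<^sup>2 \<le> (K * X)\<^sup>2" using d KX by (simp add: abs_le_square_iff[symmetric])
    moreover have "\<epsilon> * (K * X) \<le> 1 / 1000 * X"
      using mult_right_mono[OF \<epsilon>(3) X0] by (simp add: mult_ac)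
    moreover have "(K * X)\<^sup>2 \<le> 1 / 1000 * X"
    proof -
      have "(K * X)\<^sup>2 = (K * K * X) * X" by (simp add: power2_eq_square mult_ac)
      also have "\<dots> \<le> (K * K * \<epsilon>\<^sup>2) * X"
        using X\<epsilon> X0 K by (intro mult_right_mono mult_left_mono) auto
      also have "\<dots> = (K * K * \<epsilon>) * (\<epsilon> * X)" by (simp add: power2_eq_square mult_ac)
      also have "\<dots> \<le> 1 / 1000 * (1 * X)"
        using \<epsilon> X0 by (intro mult_mono mult_right_mono) auto
      finally show ?thesis by simp
    qed
    ultimately have "u\<^sup>2 + w\<^sup>2 < \<epsilon>\<^sup>2" using norm_v X0 by linarith
    then show ?thesis unfolding in_ball .
  qed
  have KX: "0 \<le> K * X" using K X0 by simp
  have slope: "\<Phi>v u w' - \<Phi>v u w \<ge> 1 * (w' - w)"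
    if "v - K * X \<le> w" "w \<le> w'" "w' \<le> v + K * X" for w w'
    using D02[OF vertical] that by (intro derivative_ge_imp_growth[OF \<Phi>v_v]) auto
  have "\<Phi>v u (v + K * X) \<ge> 0" using slope[of v "v + K * X"] gv KX by simp
  moreover have "\<Phi>v u (v - K * X) \<le> 0" using slope[of "v - K * X" v] gv KX by simp
  moreover have "continuous_on {v - K * X..v + K * X} (\<Phi>v u)" using \<Phi>v_v by (rule DERIV_continuous_on)
  ultimately obtain w where "v - K * X \<le> w" "w \<le> v + K * X" "\<Phi>v u w = 0"
    using IVT'[of "\<Phi>v u" "v - K * X" 0 "v + K * X"] KX by auto
  then show ?thesis unfolding crit_def using vertical[of w] by auto
qed (use assms in auto)

end

section \<open>The phase at the critical points\<close>

lemma has_real_derivative_quotient: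
  fixes n h :: "real \<Rightarrow> real"
  assumes "(n has_real_derivative n') (at x within S)" "(h has_real_derivative h') (at x within S)"
    and "h x \<noteq> 0"
  shows "((\<lambda>x. n x / h x) has_real_derivative (n' - n x / h x * h') / h x) (at x within S)"
  by (rule DERIV_cong[OF DERIV_divide[OF assms]]) (use assms(3) in \<open>simp add: field_simps\<close>)

context degenerate_phase
begin

definition G :: "nat \<Rightarrow> nat \<Rightarrow> real \<Rightarrow> real" where "G a b u = D a b (u, \<gamma> u)"

text \<open>The first three derivatives of \<open>\<gamma>\<close>, found by differentiating \<open>\<Phi>v u (\<gamma> u) = 0\<close>.\<close>

definition \<gamma>1 :: "real \<Rightarrow> real" where "\<gamma>1 u = - G 1 1 u / (2 + G 0 2 u)"
definition \<gamma>2 :: "real \<Rightarrow> real"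
  where "\<gamma>2 u = - (G 2 1 u + 2 * \<gamma>1 u * G 1 2 u + \<gamma>1 u * \<gamma>1 u * G 0 3 u) / (2 + G 0 2 u)"
definition \<gamma>3 :: "real \<Rightarrow> real"
  where "\<gamma>3 u = - (G 3 1 u + 3 * (\<gamma>1 u * G 2 2 u) + 3 * (\<gamma>1 u * \<gamma>1 u * G 1 3 u)
    + \<gamma>1 u * \<gamma>1 u * \<gamma>1 u * G 0 4 u + 3 * (\<gamma>2 u * G 1 2 u) + 3 * (\<gamma>1 u * \<gamma>2 u * G 0 3 u)) / (2 + G 0 2 u)"

lemma G02: "u \<in> crit \<Longrightarrow> 1 \<le> 2 + G 0 2 u"
  unfolding G_def using D02[OF \<gamma>(1)] by blast

text \<open>Implicit differentiation. Since \<open>crit\<close> is not known to be open, the derivative is taken within it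
  and is obtained from the total derivative of \<open>F\<^sub>v\<close>; the Lipschitz bound on \<open>\<gamma>\<close> turns the error of
  the linear approximation into an error in \<open>u\<close> alone.\<close>

lemma \<gamma>_deriv:
  assumes u0: "u0 \<in> crit"
  shows "(\<gamma> has_real_derivative \<gamma>1 u0) (at u0 within crit)"
  unfolding has_field_derivative_def has_derivative_within_alt
proof (intro conjI allI impI)
  show "bounded_linear ((*) (\<gamma>1 u0))" by (rule bounded_linear_mult_right)
  fix e :: real assume e: "e > 0"
  let ?p = "(u0, \<gamma> u0)"
  have "(D 0 1 has_derivative (\<lambda>w. D 1 1 ?p * fst w + D 0 2 ?p * snd w)) (at ?p within UNIV)"
    using partial_deriv_total[OF smooth_F, of 0 1] by (simp add: numeral_2_eq_2)
  from conjunct2[OF this[unfolded has_derivative_within_alt], rule_format, OF half_gt_zero[OF e]]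
  obtain d where d: "d > 0" and lin: "\<forall>q\<in>UNIV. norm (q - ?p) < d \<longrightarrow>
      norm (D 0 1 q - D 0 1 ?p - (D 1 1 ?p * fst (q - ?p) + D 0 2 ?p * snd (q - ?p))) \<le> e / 2 * norm (q - ?p)"
    by blast
  have "norm (\<gamma> u - \<gamma> u0 - \<gamma>1 u0 * (u - u0)) \<le> e * norm (u - u0)"
    if u: "u \<in> crit" and close: "norm (u - u0) < d / 2" for u
  proof -
    define x y where xy: "x = u - u0" "y = \<gamma> u - \<gamma> u0"
    have "\<bar>y\<bar> \<le> \<bar>x\<bar>" unfolding xy by (intro zeros_lipschitz \<gamma> u u0)
    then have n: "norm (x, y) \<le> 2 * \<bar>x\<bar>" using norm_Pair_le[of x y] by simp
    have q: "(u, \<gamma> u) - ?p = (x, y)" by (simp add: xy)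
    define R where "R = D 0 1 (u, \<gamma> u) - D 0 1 ?p - (D 1 1 ?p * x + D 0 2 ?p * y)"
    have "\<bar>R\<bar> \<le> e / 2 * norm (x, y)"
      using bspec[OF lin, of "(u, \<gamma> u)"] n close unfolding q R_def by (simp add: xy)
    also have "\<dots> \<le> e / 2 * (2 * \<bar>x\<bar>)" using n e by (intro mult_left_mono) auto
    finally have R: "\<bar>R\<bar> \<le> e * \<bar>x\<bar>" by simp
    have h: "1 \<le> 2 + D 0 2 ?p" using D02[OF \<gamma>(1)[OF u0]] by blast
    have "\<Phi>v u (\<gamma> u) - \<Phi>v u0 (\<gamma> u0) = 0" using \<gamma>(2)[OF u] \<gamma>(2)[OF u0] by simp
    then have "y * (2 + D 0 2 ?p) = - D 1 1 ?p * x - R"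
      unfolding \<Phi>v_def R_def xy by (simp add: algebra_simps)
    then have "y = (- D 1 1 ?p * x - R) / (2 + D 0 2 ?p)" using h by (simp add: nonzero_eq_divide_eq)
    then have "y - \<gamma>1 u0 * x = - R / (2 + D 0 2 ?p)"
      by (simp add: \<gamma>1_def G_def diff_divide_distrib)
    then have "\<bar>y - \<gamma>1 u0 * x\<bar> = \<bar>R\<bar> / (2 + D 0 2 ?p)" using h by simp
    also have "\<dots> \<le> \<bar>R\<bar> / 1" using h by (intro divide_left_mono) auto
    finally show ?thesis using R by (simp add: xy)
  qed
  then show "\<exists>d>0. \<forall>u\<in>crit. norm (u - u0) < d \<longrightarrow>
      norm (\<gamma> u - \<gamma> u0 - \<gamma>1 u0 * (u - u0)) \<le> e * norm (u - u0)"
    using d by (intro exI[of _ "d / 2"]) simp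
qed

lemma G_deriv:
  assumes "u \<in> crit" "a' = Suc a" "b' = Suc b"
  shows "(G a b has_real_derivative G a' b u + \<gamma>1 u * G a b' u) (at u within crit)"
  using partial_deriv_curve[OF smooth_F DERIV_ident \<gamma>_deriv[OF assms(1)], of a b]
  unfolding G_def[abs_def] assms(2,3) by simp

lemma \<gamma>1_deriv:
  assumes u: "u \<in> crit"
  shows "(\<gamma>1 has_real_derivative \<gamma>2 u) (at u within crit)"
proof -
  have "((\<lambda>u. - G 1 1 u) has_real_derivative - (G 2 1 u + \<gamma>1 u * G 1 2 u)) (at u within crit)"
    by (rule DERIV_minus, rule G_deriv[OF u]) simp_all
  moreover have "((\<lambda>u. 2 + G 0 2 u) has_real_derivative 0 + (G 1 2 u + \<gamma>1 u * G 0 3 u)) (at u within crit)"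
    by (rule DERIV_add[OF DERIV_const], rule G_deriv[OF u]) simp_all
  ultimately have "(\<gamma>1 has_real_derivative (- (G 2 1 u + \<gamma>1 u * G 1 2 u)
      - \<gamma>1 u * (0 + (G 1 2 u + \<gamma>1 u * G 0 3 u))) / (2 + G 0 2 u)) (at u within crit)"
    unfolding \<gamma>1_def[abs_def] using G02[OF u] by (intro has_real_derivative_quotient) auto
  then show ?thesis
    by (rule DERIV_cong) (simp add: \<gamma>2_def algebra_simps)
qed

lemma \<gamma>2_deriv:
  assumes u: "u \<in> crit"
  shows "(\<gamma>2 has_real_derivative \<gamma>3 u) (at u within crit)"
proof -
  note d = \<gamma>1_deriv[OF u]
  have g21: "(G 2 1 has_real_derivative G 3 1 u + \<gamma>1 u * G 2 2 u) (at u within crit)"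
    and g12: "(G 1 2 has_real_derivative G 2 2 u + \<gamma>1 u * G 1 3 u) (at u within crit)"
    and g03: "(G 0 3 has_real_derivative G 1 3 u + \<gamma>1 u * G 0 4 u) (at u within crit)"
    and g02: "(G 0 2 has_real_derivative G 1 2 u + \<gamma>1 u * G 0 3 u) (at u within crit)"
    by (rule G_deriv[OF u]; simp)+
  let ?n' = "- (G 3 1 u + \<gamma>1 u * G 2 2 u + ((0 * \<gamma>1 u + \<gamma>2 u * 2) * G 1 2 u + (G 2 2 u + \<gamma>1 u * G 1 3 u) * (2 * \<gamma>1 u))
      + ((\<gamma>2 u * \<gamma>1 u + \<gamma>2 u * \<gamma>1 u) * G 0 3 u + (G 1 3 u + \<gamma>1 u * G 0 4 u) * (\<gamma>1 u * \<gamma>1 u)))"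
  have "((\<lambda>u. - (G 2 1 u + 2 * \<gamma>1 u * G 1 2 u + \<gamma>1 u * \<gamma>1 u * G 0 3 u)) has_real_derivative ?n') (at u within crit)"
    by (rule DERIV_minus DERIV_add DERIV_mult DERIV_const d g21 g12 g03)+
  moreover have "((\<lambda>u. 2 + G 0 2 u) has_real_derivative 0 + (G 1 2 u + \<gamma>1 u * G 0 3 u)) (at u within crit)"
    by (rule DERIV_add[OF DERIV_const g02])
  ultimately have "(\<gamma>2 has_real_derivative (?n' - \<gamma>2 u * (0 + (G 1 2 u + \<gamma>1 u * G 0 3 u)))
      / (2 + G 0 2 u)) (at u within crit)"
    unfolding \<gamma>2_def[abs_def] using G02[OF u] by (intro has_real_derivative_quotient) auto
  then show ?thesis
    by (rule DERIV_cong) (simp add: \<gamma>3_def algebra_simps)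
qed

text \<open>The derivative of order \<open>i\<close> of \<open>s u\<^sup>k\<close>.\<close>

definition \<rho> :: "nat \<Rightarrow> real \<Rightarrow> real"
  where "\<rho> i u = s * ((\<Prod>j<i. real (k - j)) * u ^ (k - i))"

lemma \<rho>_deriv: "j = Suc i \<Longrightarrow> (\<rho> i has_real_derivative \<rho> j u) (at u within S)"
proof -
  assume j: "j = Suc i"
  have "((\<lambda>u. u ^ (k - i)) has_real_derivative real (k - i) * u ^ (k - Suc i)) (at u within S)"
    by (rule DERIV_cong[OF DERIV_power[OF DERIV_ident]]) simp
  then have "(\<rho> i has_real_derivative s * ((\<Prod>j<i. real (k - j)) * (real (k - i) * u ^ (k - Suc i)))) (at u within S)"
    unfolding \<rho>_def[abs_def] by (intro DERIV_cmult)
  then show ?thesis by (rule DERIV_cong) (simp add: \<rho>_def j mult.assoc)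
qed

text \<open>The critical value \<open>\<Phi> u (\<gamma> u)\<close> for \<open>i = 0\<close> and its derivative of order \<open>i\<close> for \<open>1 \<le> i \<le> 4\<close>. The first
  one contains no derivative of \<open>\<gamma>\<close>, because \<open>\<Phi>v\<close> vanishes on the curve.\<close>

definition \<psi> :: "nat \<Rightarrow> real \<Rightarrow> real" where
  "\<psi> i u =
    (if i = 0 then \<Phi> u (\<gamma> u)
     else if i = 1 then y1 + \<rho> 1 u + G 1 0 u
     else if i = 2 then \<rho> 2 u + G 2 0 u + \<gamma>1 u * G 1 1 u
     else if i = 3 then \<rho> 3 u + G 3 0 u + 2 * (\<gamma>1 u * G 2 1 u) + \<gamma>2 u * G 1 1 u + \<gamma>1 u * \<gamma>1 u * G 1 2 u
     else \<rho> 4 u + G 4 0 u + 3 * (\<gamma>1 u * G 3 1 u) + 3 * (\<gamma>2 u * G 2 1 u) + 3 * (\<gamma>1 u * \<gamma>1 u * G 2 2 u)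
       + \<gamma>3 u * G 1 1 u + 3 * (\<gamma>1 u * \<gamma>2 u * G 1 2 u) + \<gamma>1 u * \<gamma>1 u * \<gamma>1 u * G 1 3 u)"

lemma \<psi>1: "\<psi> 1 u = \<Phi>u u (\<gamma> u)"
  by (simp add: \<psi>_def \<Phi>u_def \<rho>_def G_def)

lemma \<psi>_deriv:
  assumes u: "u \<in> crit" and i: "i < 4"
  shows "(\<psi> i has_real_derivative \<psi> (Suc i) u) (at u within crit)"
proof -
  note d1 = \<gamma>1_deriv[OF u] and d2 = \<gamma>2_deriv[OF u]
  have g: "(G 0 0 has_real_derivative G 1 0 u + \<gamma>1 u * G 0 1 u) (at u within crit)"
    "(G 1 0 has_real_derivative G 2 0 u + \<gamma>1 u * G 1 1 u) (at u within crit)"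
    "(G 2 0 has_real_derivative G 3 0 u + \<gamma>1 u * G 2 1 u) (at u within crit)"
    "(G 1 1 has_real_derivative G 2 1 u + \<gamma>1 u * G 1 2 u) (at u within crit)"
    "(G 3 0 has_real_derivative G 4 0 u + \<gamma>1 u * G 3 1 u) (at u within crit)"
    "(G 2 1 has_real_derivative G 3 1 u + \<gamma>1 u * G 2 2 u) (at u within crit)"
    "(G 1 2 has_real_derivative G 2 2 u + \<gamma>1 u * G 1 3 u) (at u within crit)"
    by (rule G_deriv[OF u]; simp)+
  have \<rho>: "(\<rho> 0 has_real_derivative \<rho> 1 u) (at u within crit)" "(\<rho> 1 has_real_derivative \<rho> 2 u) (at u within crit)"
    "(\<rho> 2 has_real_derivative \<rho> 3 u) (at u within crit)" "(\<rho> 3 has_real_derivative \<rho> 4 u) (at u within crit)"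
    by (rule \<rho>_deriv; simp)+
  note rules = DERIV_add DERIV_mult DERIV_const DERIV_ident g \<rho> d1 d2 \<gamma>_deriv[OF u]
  consider "i = 0" | "i = 1" | "i = 2" | "i = 3" using i by linarith
  then show ?thesis
  proof cases
    case 1
    have eq: "\<psi> 0 = (\<lambda>u. y1 * u + y2 * \<gamma> u + \<gamma> u * \<gamma> u + \<rho> 0 u + G 0 0 u)"
      by (auto simp: \<psi>_def \<Phi>_def \<rho>_def G_def power2_eq_square)
    have "(\<psi> 0 has_real_derivative 0 * u + 1 * y1 + (0 * \<gamma> u + \<gamma>1 u * y2) + (\<gamma>1 u * \<gamma> u + \<gamma>1 u * \<gamma> u)
        + \<rho> 1 u + (G 1 0 u + \<gamma>1 u * G 0 1 u)) (at u within crit)"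
      unfolding eq by (rule rules)+
    \<comment> \<open>the terms with \<open>\<gamma>1 u\<close> add up to \<open>\<gamma>1 u * \<Phi>v u (\<gamma> u)\<close>\<close>
    moreover have "y2 + 2 * \<gamma> u + G 0 1 u = 0" using \<gamma>(2)[OF u] by (simp add: \<Phi>v_def G_def)
    then have "\<gamma>1 u * (y2 + 2 * \<gamma> u + G 0 1 u) = 0" by simp
    ultimately show ?thesis unfolding 1
      by (elim DERIV_cong) (simp add: \<psi>_def algebra_simps)
  next
    case 2
    have eq: "\<psi> 1 = (\<lambda>u. y1 + \<rho> 1 u + G 1 0 u)" by (auto simp: \<psi>_def)
    have "(\<psi> 1 has_real_derivative 0 + \<rho> 2 u + (G 2 0 u + \<gamma>1 u * G 1 1 u)) (at u within crit)"
      unfolding eq by (rule rules)+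
    then show ?thesis unfolding 2 by (rule DERIV_cong) (simp add: \<psi>_def)
  next
    case 3
    have eq: "\<psi> 2 = (\<lambda>u. \<rho> 2 u + G 2 0 u + \<gamma>1 u * G 1 1 u)" by (auto simp: \<psi>_def)
    have "(\<psi> 2 has_real_derivative \<rho> 3 u + (G 3 0 u + \<gamma>1 u * G 2 1 u)
        + (\<gamma>2 u * G 1 1 u + (G 2 1 u + \<gamma>1 u * G 1 2 u) * \<gamma>1 u)) (at u within crit)"
      unfolding eq by (rule rules)+
    then show ?thesis unfolding 3 by (rule DERIV_cong) (simp add: \<psi>_def algebra_simps)
  next
    case 4
    have eq: "\<psi> 3 = (\<lambda>u. \<rho> 3 u + G 3 0 u + 2 * (\<gamma>1 u * G 2 1 u) + \<gamma>2 u * G 1 1 u + \<gamma>1 u * \<gamma>1 u * G 1 2 u)"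
      by (auto simp: \<psi>_def)
    have "(\<psi> 3 has_real_derivative \<rho> 4 u + (G 4 0 u + \<gamma>1 u * G 3 1 u)
        + (0 * (\<gamma>1 u * G 2 1 u) + (\<gamma>2 u * G 2 1 u + (G 3 1 u + \<gamma>1 u * G 2 2 u) * \<gamma>1 u) * 2)
        + (\<gamma>3 u * G 1 1 u + (G 2 1 u + \<gamma>1 u * G 1 2 u) * \<gamma>2 u)
        + ((\<gamma>2 u * \<gamma>1 u + \<gamma>2 u * \<gamma>1 u) * G 1 2 u + (G 2 2 u + \<gamma>1 u * G 1 3 u) * (\<gamma>1 u * \<gamma>1 u))) (at u within crit)"
      unfolding eq by (rule rules)+
    then show ?thesis unfolding 4 by (rule DERIV_cong) (simp add: \<psi>_def algebra_simps)
  qed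
qed

lemma abs_mult_le: "\<bar>x\<bar> \<le> X \<Longrightarrow> \<bar>y\<bar> \<le> Y \<Longrightarrow> \<bar>x * y\<bar> \<le> X * Y" for x y X Y :: real
  unfolding abs_mult by (intro mult_mono) auto

text \<open>Every term other than \<open>s k!\<close> has a small factor: \<open>\<gamma>1\<close> and the second derivatives of \<open>F\<close> are of size
  \<open>K\<epsilon>\<close>, and so is the derivative of \<open>F\<close> of order \<open>k\<close> in \<open>u\<close>. The only exception is \<open>\<gamma>2 G 2 1\<close>,
  which occurs for \<open>k = 4\<close>; there \<open>G 2 1\<close> itself is small.\<close>

lemma \<psi>_top:
  assumes u: "u \<in> crit"
  shows "\<bar>\<psi> k u - s * fact k\<bar> \<le> 1"
proof -
  note p = \<gamma>(1)[OF u]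
  define \<delta> where "\<delta> = K * \<epsilon>"
  have \<delta>: "0 \<le> \<delta>" "\<delta> \<le> 1 / 1000" "\<delta> * K \<le> 1 / 1000" "\<delta> * (K * K) \<le> 1 / 1000"
    using \<epsilon> K by (simp_all add: \<delta>_def mult_ac)
  have KK: "1 \<le> K * K" "K \<le> K * K" using K mult_mono[of 1 K 1 K] by simp_all
  have o2: "\<bar>G 1 1 u\<bar> \<le> \<delta>" using F_order2[OF p, of 1 1] by (simp add: G_def \<delta>_def)
  have o34: "\<bar>G a b u\<bar> \<le> K" if "a + b \<in> {3, 4}" for a b
    unfolding G_def by (rule F_order34[OF p that])
  have top: "\<bar>G k 0 u\<bar> \<le> 2 * \<delta>" using F_top[OF p] by (simp add: G_def \<delta>_def)
  have quot: "\<bar>- x / (2 + G 0 2 u)\<bar> \<le> B" if "\<bar>x\<bar> \<le> B" for x B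
  proof -
    have "\<bar>x\<bar> / (2 + G 0 2 u) \<le> \<bar>x\<bar> / 1" using G02[OF u] by (intro divide_left_mono) auto
    then show ?thesis using that G02[OF u] by simp
  qed
  have g1: "\<bar>\<gamma>1 u\<bar> \<le> \<delta>" unfolding \<gamma>1_def by (rule quot[OF o2])
  have t1: "\<bar>\<gamma>1 u * G a b u\<bar> \<le> 1 / 1000" if "a + b \<in> {3, 4}" for a b
    using abs_mult_le[OF g1 o34[OF that]] \<delta> by linarith
  have t2: "\<bar>\<gamma>1 u * \<gamma>1 u * G a b u\<bar> \<le> 1 / 1000" if "a + b \<in> {3, 4}" for a b
  proof -
    have "\<bar>\<gamma>1 u * (\<gamma>1 u * G a b u)\<bar> \<le> 1 * (1 / 1000)"
      using g1 \<delta> by (intro abs_mult_le t1 that) linarith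
    then show ?thesis by (simp add: mult.assoc)
  qed
  have t3: "\<bar>\<gamma>1 u * \<gamma>1 u * \<gamma>1 u * G a b u\<bar> \<le> 1 / 1000" if "a + b \<in> {3, 4}" for a b
  proof -
    have "\<bar>\<gamma>1 u * (\<gamma>1 u * \<gamma>1 u * G a b u)\<bar> \<le> 1 * (1 / 1000)"
      using g1 \<delta> by (intro abs_mult_le t2 that) linarith
    then show ?thesis by (simp add: mult.assoc)
  qed
  have g2: "\<bar>\<gamma>2 u\<bar> \<le> 2 * K" unfolding \<gamma>2_def
  proof (rule quot)
    have "\<bar>G 2 1 u\<bar> \<le> K" "\<bar>\<gamma>1 u * G 1 2 u\<bar> \<le> 1 / 1000" "\<bar>\<gamma>1 u * \<gamma>1 u * G 0 3 u\<bar> \<le> 1 / 1000"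
      by (rule o34 t1 t2; simp)+
    moreover have "2 * \<gamma>1 u * G 1 2 u = 2 * (\<gamma>1 u * G 1 2 u)" by simp
    ultimately show "\<bar>G 2 1 u + 2 * \<gamma>1 u * G 1 2 u + \<gamma>1 u * \<gamma>1 u * G 0 3 u\<bar> \<le> 2 * K"
      using K by linarith
  qed
  have t12: "\<bar>\<gamma>1 u * \<gamma>2 u * G a b u\<bar> \<le> 2 / 1000" if "a + b \<in> {3, 4}" for a b
  proof -
    have "\<bar>\<gamma>1 u * (\<gamma>2 u * G a b u)\<bar> \<le> \<delta> * (2 * K * K)"
      by (intro abs_mult_le g1 g2 o34 that)
    then show ?thesis using \<delta> by (simp add: mult_ac)
  qed
  have t211: "\<bar>\<gamma>2 u * G 1 1 u\<bar> \<le> 2 / 1000"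
    using abs_mult_le[OF g2 o2] \<delta> by (simp add: mult_ac)
  have g3: "\<bar>\<gamma>3 u\<bar> \<le> 8 * (K * K)" unfolding \<gamma>3_def
  proof (rule quot)
    have "\<bar>\<gamma>2 u * G 1 2 u\<bar> \<le> 2 * K * K" by (intro abs_mult_le g2 o34) simp
    then show "\<bar>G 3 1 u + 3 * (\<gamma>1 u * G 2 2 u) + 3 * (\<gamma>1 u * \<gamma>1 u * G 1 3 u)
      + \<gamma>1 u * \<gamma>1 u * \<gamma>1 u * G 0 4 u + 3 * (\<gamma>2 u * G 1 2 u) + 3 * (\<gamma>1 u * \<gamma>2 u * G 0 3 u)\<bar> \<le> 8 * (K * K)"
      using o34[of 3 1] t1[of 2 2] t2[of 1 3] t3[of 0 4] t12[of 0 3] KK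
      unfolding abs_le_iff by simp
  qed
  have t311: "\<bar>\<gamma>3 u * G 1 1 u\<bar> \<le> 8 / 1000"
    using abs_mult_le[OF g3 o2] \<delta> by (simp add: mult_ac)
  have t111: "\<bar>\<gamma>1 u * G 1 1 u\<bar> \<le> 1 / 1000"
  proof -
    have "\<bar>\<gamma>1 u * G 1 1 u\<bar> \<le> \<delta> * 1" using o2 \<delta> by (intro abs_mult_le g1) linarith
    then show ?thesis using \<delta> by simp
  qed
  from k consider "k = 2" | "k = 3" | "k = 4" by blast
  then show ?thesis
  proof cases
    case 1
    note at_k = arg_cong[OF 1, of "\<lambda>i. \<psi> i u"] arg_cong[OF 1, of "\<lambda>i. s * fact i"]
      arg_cong[OF 1, of "\<lambda>i. G i 0 u"]
    have \<rho>: "\<rho> 2 u = s * fact 2"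
      unfolding \<rho>_def unfolding 1 by (simp add: numeral_eq_Suc lessThan_Suc)
    have eq: "\<psi> k u - s * fact k = G 2 0 u + \<gamma>1 u * G 1 1 u"
      unfolding at_k by (simp add: \<psi>_def \<rho>)
    show ?thesis using top[unfolded at_k(3)] t111 \<delta>(2) unfolding eq by linarith
  next
    case 2
    note at_k = arg_cong[OF 2, of "\<lambda>i. \<psi> i u"] arg_cong[OF 2, of "\<lambda>i. s * fact i"]
      arg_cong[OF 2, of "\<lambda>i. G i 0 u"]
    have \<rho>: "\<rho> 3 u = s * fact 3"
      unfolding \<rho>_def unfolding 2 by (simp add: numeral_eq_Suc lessThan_Suc)
    have eq: "\<psi> k u - s * fact k = G 3 0 u + 2 * (\<gamma>1 u * G 2 1 u) + \<gamma>2 u * G 1 1 u + \<gamma>1 u * \<gamma>1 u * G 1 2 u"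
      unfolding at_k by (simp add: \<psi>_def \<rho>)
    have T: "\<bar>\<gamma>1 u * G 2 1 u\<bar> \<le> 1 / 1000" "\<bar>\<gamma>1 u * \<gamma>1 u * G 1 2 u\<bar> \<le> 1 / 1000"
      by (rule t1 t2; simp)+
    show ?thesis using top[unfolded at_k(3)] t211 T \<delta>(2) unfolding eq by linarith
  next
    case 3
    note at_k = arg_cong[OF 3, of "\<lambda>i. \<psi> i u"] arg_cong[OF 3, of "\<lambda>i. s * fact i"]
      arg_cong[OF 3, of "\<lambda>i. G i 0 u"]
    have \<rho>: "\<rho> 4 u = s * fact 4"
      unfolding \<rho>_def unfolding 3 by (simp add: numeral_eq_Suc lessThan_Suc)
    have eq: "\<psi> k u - s * fact k = G 4 0 u + 3 * (\<gamma>1 u * G 3 1 u) + 3 * (\<gamma>2 u * G 2 1 u)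
        + 3 * (\<gamma>1 u * \<gamma>1 u * G 2 2 u) + \<gamma>3 u * G 1 1 u + 3 * (\<gamma>1 u * \<gamma>2 u * G 1 2 u)
        + \<gamma>1 u * \<gamma>1 u * \<gamma>1 u * G 1 3 u"
      unfolding at_k by (simp add: \<psi>_def \<rho>)
    have "\<bar>G 2 1 u\<bar> \<le> 2 * \<delta>" using F_uuv[OF 3 p] by (simp add: G_def \<delta>_def)
    from abs_mult_le[OF g2 this] have t221: "\<bar>\<gamma>2 u * G 2 1 u\<bar> \<le> 4 / 1000" using \<delta> by (simp add: mult_ac)
    have T: "\<bar>\<gamma>1 u * G 3 1 u\<bar> \<le> 1 / 1000" "\<bar>\<gamma>1 u * \<gamma>1 u * G 2 2 u\<bar> \<le> 1 / 1000"
      "\<bar>\<gamma>1 u * \<gamma>2 u * G 1 2 u\<bar> \<le> 2 / 1000" "\<bar>\<gamma>1 u * \<gamma>1 u * \<gamma>1 u * G 1 3 u\<bar> \<le> 1 / 1000"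
      by (rule t1 t2 t12 t3; simp)+
    show ?thesis using top[unfolded at_k(3)] t311 t221 T \<delta>(2) unfolding eq by linarith
  qed
qed

lemma \<psi>_nondegenerate:
  assumes "S \<subseteq> crit"
  shows "(\<forall>u\<in>S. 1 \<le> \<psi> k u) \<or> (\<forall>u\<in>S. \<psi> k u \<le> - 1)"
proof -
  have f: "(fact k :: real) \<ge> 2"
    using k fact_mono[of 2 k, where 'a = real] by auto
  have d: "\<bar>\<psi> k u - s * fact k\<bar> \<le> 1" if "u \<in> S" for u
    using \<psi>_top assms that by blast
  from s consider "s = 1" | "s = -1" by blast
  then show ?thesis
  proof cases
    case 1
    have "1 \<le> \<psi> k u" if "u \<in> S" for u using d[OF that] f unfolding 1 by linarith
    then show ?thesis by blast
  next
    case 2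
    have "\<psi> k u \<le> - 1" if "u \<in> S" for u using d[OF that] f unfolding 2 by linarith
    then show ?thesis by blast
  qed
qed

end

section \<open>Integrating over the fibers\<close>

context degenerate_phase
begin

lemma continuous_on_D: "continuous_on S x \<Longrightarrow> continuous_on S y \<Longrightarrow> continuous_on S (\<lambda>t. D a b (x t, y t))"
  by (rule continuous_on_compose2[OF continuous_on_partial_deriv[OF smooth_F, of UNIV]])
    (auto intro: continuous_on_Pair)

lemma continuous_on_E: "continuous_on S x \<Longrightarrow> continuous_on S y \<Longrightarrow> continuous_on S (\<lambda>t. E a b (x t, y t))"
  by (rule continuous_on_compose2[OF continuous_on_partial_deriv[OF smooth_\<beta>, of UNIV]])
    (auto intro: continuous_on_Pair)

lemma continuous_on_\<Phi>: "continuous_on S x \<Longrightarrow> continuous_on S y \<Longrightarrow> continuous_on S (\<lambda>t. \<Phi> (x t) (y t))"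
  unfolding \<Phi>_def by (intro continuous_intros continuous_on_D)

lemma continuous_on_\<Phi>u: "continuous_on S x \<Longrightarrow> continuous_on S y \<Longrightarrow> continuous_on S (\<lambda>t. \<Phi>u (x t) (y t))"
  unfolding \<Phi>u_def by (intro continuous_intros continuous_on_D)

lemmas phase_continuous_intros = continuous_on_D continuous_on_E continuous_on_\<Phi> continuous_on_\<Phi>u

lemma E_v: "b' = Suc b \<Longrightarrow> ((\<lambda>v. E a b (u, v)) has_real_derivative E a b' (u, v)) (at v within S)"
  using partial_deriv_v[OF smooth_\<beta>] by simp

lemma D_v: "b' = Suc b \<Longrightarrow> ((\<lambda>v. D a b (u, v)) has_real_derivative D a b' (u, v)) (at v within S)"
  using partial_deriv_v[OF smooth_F] by simp

lemma E_u: "((\<lambda>u. E 0 0 (u, v)) has_real_derivative E 1 0 (u, v)) (at u within S)"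
  using partial_deriv_u[OF smooth_\<beta>] by simp

definition fiber :: "real \<Rightarrow> complex"
  where "fiber u = integral {- \<epsilon>..\<epsilon>} (\<lambda>v. cis (lam * \<Phi> u v) * of_real (E 0 0 (u, v)))"
definition fiber' :: "real \<Rightarrow> complex"
  where "fiber' u = integral {- \<epsilon>..\<epsilon>} (\<lambda>v. cis (lam * \<Phi> u v) *
    (of_real (E 1 0 (u, v)) + \<i> * of_real (lam * \<Phi>u u v * E 0 0 (u, v))))"

lemma fiber_deriv: "(fiber has_vector_derivative fiber' u) (at u within S)"
proof -
  let ?f = "\<lambda>u v. cis (lam * \<Phi> u v) * complex_of_real (E 0 0 (u, v))"
  let ?f' = "\<lambda>u v. cis (lam * \<Phi> u v) * (of_real (E 1 0 (u, v)) + \<i> * of_real (lam * \<Phi>u u v * E 0 0 (u, v)))"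
  have "((\<lambda>u. integral (cbox (- \<epsilon>) \<epsilon>) (?f u)) has_vector_derivative integral (cbox (- \<epsilon>) \<epsilon>) (?f' u)) (at u within UNIV)"
  proof (rule leibniz_rule_vector_derivative)
    fix x t :: real
    have "((\<lambda>u. ?f u t) has_vector_derivative cis (lam * \<Phi> x t) * of_real (E 1 0 (x, t))
        + (lam * \<Phi>u x t) *\<^sub>R (\<i> * cis (lam * \<Phi> x t)) * of_real (E 0 0 (x, t))) (at x within UNIV)"
      by (intro has_vector_derivative_mult has_vector_derivative_cis has_vector_derivative_of_real
        DERIV_cmult \<Phi>_u E_u)
    then show "((\<lambda>u. ?f u t) has_vector_derivative ?f' x t) (at x within UNIV)"
      by (rule has_vector_derivative_eq_rhs) (simp add: scaleR_conv_of_real algebra_simps)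
    show "?f x integrable_on cbox (- \<epsilon>) \<epsilon>"
      by (intro integrable_continuous continuous_intros phase_continuous_intros)
  next
    show "continuous_on (UNIV \<times> cbox (- \<epsilon>) \<epsilon>) (\<lambda>(x, t). ?f' x t)"
      unfolding case_prod_unfold by (intro continuous_intros phase_continuous_intros)
  qed simp_all
  then have "(fiber has_vector_derivative fiber' u) (at u)"
    by (simp add: fiber_def[abs_def] fiber'_def)
  then show ?thesis by (rule has_vector_derivative_at_within)
qed

lemma fiber_continuous: "continuous_on S fiber"
  by (rule continuous_on_vector_derivative[OF fiber_deriv])

lemma chord_ball:
  assumes R: "0 \<le> R" "R < \<epsilon>" "u\<^sup>2 \<le> R\<^sup>2" and v: "v \<in> {- sqrt (R\<^sup>2 - u\<^sup>2)..sqrt (R\<^sup>2 - u\<^sup>2)}"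
  shows "(u, v) \<in> ball (0, 0) \<epsilon>"
proof -
  have "\<bar>v\<bar> \<le> sqrt (R\<^sup>2 - u\<^sup>2)" using v by auto
  then have "v\<^sup>2 \<le> R\<^sup>2 - u\<^sup>2" using sqrt_ge_absD by blast
  moreover have "R\<^sup>2 < \<epsilon>\<^sup>2" using R by (intro power_strict_mono) auto
  ultimately show ?thesis unfolding in_ball by linarith
qed

lemma integral_chord:
  fixes f :: "real \<Rightarrow> complex"
  assumes R: "r \<le> R" "R < \<epsilon>" "u\<^sup>2 \<le> R\<^sup>2" and f: "continuous_on UNIV f"
    and zero: "\<And>v. r\<^sup>2 \<le> u\<^sup>2 + v\<^sup>2 \<Longrightarrow> f v = 0"
  shows "integral {- \<epsilon>..\<epsilon>} f = integral {- sqrt (R\<^sup>2 - u\<^sup>2)..sqrt (R\<^sup>2 - u\<^sup>2)} f"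
proof (rule integral_unique, rule has_integral_on_superset)
  let ?\<sigma> = "sqrt (R\<^sup>2 - u\<^sup>2)"
  show "(f has_integral integral {- ?\<sigma>..?\<sigma>} f) {- ?\<sigma>..?\<sigma>}"
    using f by (intro integrable_integral integrable_continuous_real) (auto intro: continuous_on_subset)
  have rR: "r\<^sup>2 \<le> R\<^sup>2" using R r by (intro power_mono) auto
  show "f v = 0" if "v \<notin> {- ?\<sigma>..?\<sigma>}" for v
  proof (rule zero)
    have "?\<sigma> \<le> \<bar>v\<bar>" using that by auto
    then have "?\<sigma>\<^sup>2 \<le> \<bar>v\<bar>\<^sup>2" using R by (intro power_mono) auto
    then show "r\<^sup>2 \<le> u\<^sup>2 + v\<^sup>2" using R rR by simp
  qed
  have "?\<sigma> \<le> sqrt (\<epsilon>\<^sup>2)"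
    using R r power_mono[of R \<epsilon> 2] by (intro real_sqrt_le_mono) (smt (verit) zero_le_power2)
  then show "{- ?\<sigma>..?\<sigma>} \<subseteq> {- \<epsilon>..\<epsilon>}" using \<epsilon>(1) by auto
qed

lemma E_at_chord_end:
  assumes "r \<le> R" "u\<^sup>2 \<le> R\<^sup>2" "v = sqrt (R\<^sup>2 - u\<^sup>2) \<or> v = - sqrt (R\<^sup>2 - u\<^sup>2)"
  shows "E a b (u, v) = 0"
proof (rule \<beta>_zero)
  have "r\<^sup>2 \<le> R\<^sup>2" using assms r by (intro power_mono) auto
  moreover have "v\<^sup>2 = R\<^sup>2 - u\<^sup>2" using assms by auto
  ultimately show "r\<^sup>2 \<le> u\<^sup>2 + v\<^sup>2" by simp
qed

lemma chord_length:
  assumes "0 \<le> R" "R < \<epsilon>"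
  shows "sqrt (R\<^sup>2 - u\<^sup>2) - - sqrt (R\<^sup>2 - u\<^sup>2) \<le> 1"
proof -
  have "sqrt (R\<^sup>2 - u\<^sup>2) \<le> sqrt (R\<^sup>2)" by (intro real_sqrt_le_mono) simp
  then show ?thesis using assms \<epsilon>(2) by simp
qed

text \<open>On the chord of the ball of radius \<open>r\<close> the function \<open>\<Phi>v u\<close> is increasing without a zero, so it is
  positive at the lower end or negative at the upper one. The amplitude vanishes at both ends
  together with its derivatives.\<close>

lemma fiber_off_crit:
  assumes u: "u \<notin> crit"
  shows "norm (fiber u) \<le> 4 * M / lam"
proof (cases "u\<^sup>2 \<le> r\<^sup>2")
  case False
  then have "E 0 0 (u, v) = 0" for v using zero_le_power2[of v] by (intro \<beta>_zero) linarith
  then show ?thesis using M lam by (simp add: fiber_def)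
next
  case True
  define \<sigma> where "\<sigma> = sqrt (r\<^sup>2 - u\<^sup>2)"
  have \<sigma>: "- \<sigma> \<le> \<sigma>" using True by (simp add: \<sigma>_def)
  have ball: "(u, v) \<in> ball (0, 0) \<epsilon>" if "v \<in> {- \<sigma>..\<sigma>}" for v
    using chord_ball[of r u v] r True that by (simp add: \<sigma>_def)
  let ?f = "\<lambda>v. cis (lam * \<Phi> u v) * complex_of_real (E 0 0 (u, v))"
  have "fiber u = integral {- \<sigma>..\<sigma>} ?f"
    unfolding fiber_def \<sigma>_def using r True
    by (intro integral_chord continuous_intros phase_continuous_intros) (auto simp: \<beta>_zero)
  moreover have "norm (integral {- \<sigma>..\<sigma>} ?f) \<le> 4 * M * (\<sigma> - - \<sigma>) / lam"
  proof -
    have ends: "E a b (u, \<sigma>) = 0" "E a b (u, - \<sigma>) = 0" for a b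
      using E_at_chord_end[of r u] True by (auto simp: \<sigma>_def)
    have \<Phi>2: "1 \<le> 2 + D 0 2 (u, v) \<and> 2 + D 0 2 (u, v) \<le> 3" if "v \<in> {- \<sigma>..\<sigma>}" for v
      by (rule D02[OF ball[OF that]])
    have E2: "\<bar>E 0 2 (u, v)\<bar> \<le> M" for v by (rule \<beta>_bound) simp
    have "\<Phi>v u (- \<sigma>) > 0 \<or> \<Phi>v u \<sigma> < 0"
    proof (rule ccontr)
      assume "\<not> ?thesis"
      moreover have "continuous_on {- \<sigma>..\<sigma>} (\<Phi>v u)" using \<Phi>v_v by (rule DERIV_continuous_on)
      ultimately obtain v where "- \<sigma> \<le> v" "v \<le> \<sigma>" "\<Phi>v u v = 0"
        using IVT'[of "\<Phi>v u" "- \<sigma>" 0 \<sigma>] \<sigma> by auto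
      then show False using u ball[of v] unfolding crit_def by auto
    qed
    then show ?thesis
    proof
      assume pos: "\<Phi>v u (- \<sigma>) > 0"
      show ?thesis
        by (rule nonstationary_fiber_bound[OF \<sigma> _ \<Phi>_v \<Phi>v_v \<Phi>2 pos E_v[OF refl] E_v[OF refl]])
          (use lam ends E2 in \<open>simp_all add: numeral_2_eq_2\<close>)
    next
      assume neg: "\<Phi>v u \<sigma> < 0"
      show ?thesis
        by (rule nonstationary_fiber_bound_reflected[OF \<sigma> _ \<Phi>_v \<Phi>v_v \<Phi>2 neg E_v[OF refl] E_v[OF refl]])
          (use lam ends E2 in \<open>simp_all add: numeral_2_eq_2\<close>)
    qed
  qed
  moreover have "4 * M * (\<sigma> - - \<sigma>) / lam \<le> 4 * M * 1 / lam"
    using chord_length[of r u] r M lam unfolding \<sigma>_def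
    by (intro divide_right_mono mult_left_mono) auto
  ultimately show ?thesis by simp
qed

text \<open>The size \<open>O(\<lambda>\<^bsup>-1/2\<^esup>)\<close> of a fiber integral and of its corrected derivative.\<close>

definition fiber_bound :: real
  where "fiber_bound = vdC_const 2 * lam powr (- (1 / 2)) * (28 * K ^ 3 * M)"

text \<open>The parameter \<open>\<kappa>\<close> merges two cases: 0 for the fiber integral itself, 1 for its derivative. The
  chord is taken in a ball that contains the critical point as well as the support of \<open>\<beta>\<close>.\<close>

lemma stationary_fiber:
  assumes u: "u \<in> crit"
    and z: "\<And>v S. (z has_real_derivative z1 v) (at v within S)"
    and zb: "\<And>v. \<bar>z v\<bar> \<le> M" "\<And>v. \<bar>z1 v\<bar> \<le> M"
    and z0: "\<And>v. r\<^sup>2 \<le> u\<^sup>2 + v\<^sup>2 \<Longrightarrow> z v = 0"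
    and \<kappa>: "\<bar>\<kappa>\<bar> \<le> 1"
  shows "norm (integral {- \<epsilon>..\<epsilon>} (\<lambda>v. cis (lam * \<Phi> u v) * (of_real (z v)
      + \<i> * of_real (lam * (\<kappa> * (\<Phi>u u v - \<Phi>u u (\<gamma> u))) * E 0 0 (u, v))))) \<le> fiber_bound"
proof -
  define R where "R = max r (sqrt (u\<^sup>2 + (\<gamma> u)\<^sup>2))"
  have g\<epsilon>: "sqrt (u\<^sup>2 + (\<gamma> u)\<^sup>2) < \<epsilon>"
    using \<gamma>(1)[OF u] \<epsilon>(1) real_sqrt_less_mono[of "u\<^sup>2 + (\<gamma> u)\<^sup>2" "\<epsilon>\<^sup>2"] unfolding in_ball by simp
  have R: "r \<le> R" "R < \<epsilon>" "0 \<le> R" using r g\<epsilon> by (auto simp: R_def)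
  have "sqrt (u\<^sup>2 + (\<gamma> u)\<^sup>2) \<le> R" by (simp add: R_def)
  then have "(sqrt (u\<^sup>2 + (\<gamma> u)\<^sup>2))\<^sup>2 \<le> R\<^sup>2" by (intro power_mono) auto
  then have uR: "u\<^sup>2 + (\<gamma> u)\<^sup>2 \<le> R\<^sup>2" by simp
  then have uR': "u\<^sup>2 \<le> R\<^sup>2" using zero_le_power2[of "\<gamma> u"] by linarith
  define \<sigma> where "\<sigma> = sqrt (R\<^sup>2 - u\<^sup>2)"
  have "\<bar>\<gamma> u\<bar> \<le> \<sigma>" unfolding \<sigma>_def using uR by (intro real_le_rsqrt) simp
  then have c: "\<gamma> u \<in> {- \<sigma>..\<sigma>}" by auto
  have ball: "(u, v) \<in> ball (0, 0) \<epsilon>" if "v \<in> {- \<sigma>..\<sigma>}" for v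
    using chord_ball[OF R(3,2) uR'] that unfolding \<sigma>_def .
  let ?g = "\<lambda>v. \<kappa> * (\<Phi>u u v - \<Phi>u u (\<gamma> u))"
  let ?f = "\<lambda>v. cis (lam * \<Phi> u v) * (complex_of_real (z v) + \<i> * of_real (lam * ?g v * E 0 0 (u, v)))"
  have contz: "continuous_on S z" for S using z by (rule DERIV_continuous_on)
  have eq: "integral {- \<epsilon>..\<epsilon>} ?f = integral {- \<sigma>..\<sigma>} ?f"
    unfolding \<sigma>_def by (intro integral_chord R uR' continuous_intros phase_continuous_intros contz)
      (simp add: z0 \<beta>_zero)
  have ends: "E a b (u, \<sigma>) = 0" "E a b (u, - \<sigma>) = 0" for a b
    using E_at_chord_end[OF R(1) uR'] by (auto simp: \<sigma>_def)
  have len: "\<sigma> - - \<sigma> \<le> 2" using chord_length[OF R(3,2), of u] unfolding \<sigma>_def by linarith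
  have \<kappa>_le: "\<bar>\<kappa> * x\<bar> \<le> K" if "\<bar>x\<bar> \<le> K" for x
    using abs_mult_le[OF \<kappa> that] by simp
  have D11: "\<bar>D 1 1 p\<bar> \<le> K" if "p \<in> ball (0, 0) \<epsilon>" for p
    using F_order2[OF that, of 1 1] \<epsilon>(3) K by simp
  have "norm (integral {- \<sigma>..\<sigma>} ?f) \<le> vdC_const 2 * lam powr (- (1 / 2)) * (28 * K ^ 3 * M)"
  proof (rule stationary_fiber_bound[OF c _ K len \<Phi>_v \<Phi>v_v])
    show "lam > 0" using lam by simp
    show "((\<lambda>v. 2 + D 0 2 (u, v)) has_real_derivative D 0 3 (u, v)) (at v within {- \<sigma>..\<sigma>})" for v
      by (rule DERIV_cong[OF DERIV_add[OF DERIV_const D_v[OF refl]]]) (simp add: numeral_eq_Suc)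
    show "((\<lambda>v. D 0 3 (u, v)) has_real_derivative D 0 4 (u, v)) (at v within {- \<sigma>..\<sigma>})" for v
      by (rule D_v) simp
    show "continuous_on {- \<sigma>..\<sigma>} (\<lambda>v. D 0 4 (u, v))" "continuous_on {- \<sigma>..\<sigma>} (\<lambda>v. \<kappa> * D 1 3 (u, v))"
      by (intro continuous_intros phase_continuous_intros)+
    show "1 \<le> 2 + D 0 2 (u, v) \<and> \<bar>D 0 3 (u, v)\<bar> \<le> K \<and> \<bar>D 0 4 (u, v)\<bar> \<le> K" if "v \<in> {- \<sigma>..\<sigma>}" for v
      using D02[OF ball[OF that]] F_order34[OF ball[OF that], of 0 3] F_order34[OF ball[OF that], of 0 4] by simp
    show "\<Phi>v u (\<gamma> u) = 0" by (rule \<gamma>(2)[OF u])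
    show "(?g has_real_derivative \<kappa> * D 1 1 (u, v)) (at v within {- \<sigma>..\<sigma>})" for v
    proof -
      have "((\<lambda>v. \<Phi>u u v - \<Phi>u u (\<gamma> u)) has_real_derivative 0 + D 1 1 (u, v) - 0) (at v within {- \<sigma>..\<sigma>})"
        unfolding \<Phi>u_def by (intro DERIV_diff DERIV_add DERIV_const D_v) simp
      from DERIV_cmult[OF this, of \<kappa>] show ?thesis by simp
    qed
    show "((\<lambda>v. \<kappa> * D 1 1 (u, v)) has_real_derivative \<kappa> * D 1 2 (u, v)) (at v within {- \<sigma>..\<sigma>})"
      "((\<lambda>v. \<kappa> * D 1 2 (u, v)) has_real_derivative \<kappa> * D 1 3 (u, v)) (at v within {- \<sigma>..\<sigma>})" for v
      by (rule DERIV_cmult, rule D_v, simp)+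
    show "\<bar>\<kappa> * D 1 1 (u, v)\<bar> \<le> K \<and> \<bar>\<kappa> * D 1 2 (u, v)\<bar> \<le> K \<and> \<bar>\<kappa> * D 1 3 (u, v)\<bar> \<le> K"
      if "v \<in> {- \<sigma>..\<sigma>}" for v
      using D11[OF ball[OF that]] F_order34[OF ball[OF that], of 1 2] F_order34[OF ball[OF that], of 1 3]
      by (intro conjI \<kappa>_le) simp_all
    show "((\<lambda>v. E 0 0 (u, v)) has_real_derivative E 0 1 (u, v)) (at v within {- \<sigma>..\<sigma>})"
      "((\<lambda>v. E 0 1 (u, v)) has_real_derivative E 0 2 (u, v)) (at v within {- \<sigma>..\<sigma>})" for v
      by (rule E_v, simp)+
    show "(z has_real_derivative z1 v) (at v within {- \<sigma>..\<sigma>})" for v by (rule z)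
    show "\<bar>E 0 0 (u, v)\<bar> \<le> M \<and> \<bar>E 0 1 (u, v)\<bar> \<le> M \<and> \<bar>E 0 2 (u, v)\<bar> \<le> M" for v
      by (intro conjI \<beta>_bound) simp_all
    show "\<bar>z v\<bar> \<le> M \<and> \<bar>z1 v\<bar> \<le> M" for v using zb by blast
  qed (use ends in simp_all)
  then show ?thesis unfolding eq fiber_bound_def .
qed

lemma fiber_on_crit:
  assumes u: "u \<in> crit"
  shows "norm (fiber u) \<le> fiber_bound"
proof -
  have "norm (integral {- \<epsilon>..\<epsilon>} (\<lambda>v. cis (lam * \<Phi> u v) * (of_real (E 0 0 (u, v))
      + \<i> * of_real (lam * (0 * (\<Phi>u u v - \<Phi>u u (\<gamma> u))) * E 0 0 (u, v))))) \<le> fiber_bound"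
    by (rule stationary_fiber[OF u E_v[OF refl]]) (simp_all add: \<beta>_bound \<beta>_zero)
  then show ?thesis by (simp add: fiber_def)
qed

text \<open>Up to a factor of modulus 1, this is the derivative of the fiber integral with its oscillation at
  the critical value removed.\<close>

lemma fiber'_on_crit:
  assumes u: "u \<in> crit"
  shows "norm (fiber' u - \<i> * of_real (lam * \<psi> 1 u) * fiber u) \<le> fiber_bound"
proof -
  let ?I = "{- \<epsilon>..\<epsilon>}"
  have "((\<lambda>v. cis (lam * \<Phi> u v) * (of_real (E 1 0 (u, v)) + \<i> * of_real (lam * \<Phi>u u v * E 0 0 (u, v))))
      has_integral fiber' u) ?I"
    unfolding fiber'_def
    by (intro integrable_integral integrable_continuous_real continuous_intros phase_continuous_intros)
  moreover have "((\<lambda>v. cis (lam * \<Phi> u v) * complex_of_real (E 0 0 (u, v))) has_integral fiber u) ?I"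
    unfolding fiber_def
    by (intro integrable_integral integrable_continuous_real continuous_intros phase_continuous_intros)
  ultimately have "((\<lambda>v. cis (lam * \<Phi> u v) * (of_real (E 1 0 (u, v)) + \<i> * of_real (lam * \<Phi>u u v * E 0 0 (u, v)))
      - \<i> * of_real (lam * \<psi> 1 u) * (cis (lam * \<Phi> u v) * complex_of_real (E 0 0 (u, v))))
      has_integral fiber' u - \<i> * of_real (lam * \<psi> 1 u) * fiber u) ?I"
    by (intro has_integral_diff has_integral_mult_right)
  then have "((\<lambda>v. cis (lam * \<Phi> u v) * (of_real (E 1 0 (u, v))
      + \<i> * of_real (lam * (1 * (\<Phi>u u v - \<Phi>u u (\<gamma> u))) * E 0 0 (u, v))))
      has_integral fiber' u - \<i> * of_real (lam * \<psi> 1 u) * fiber u) ?I"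
    by (rule has_integral_eq[rotated]) (simp only: \<psi>1, simp add: algebra_simps)
  from integral_unique[OF this, symmetric] show ?thesis
    by (simp only:) (rule stationary_fiber[OF u E_v[OF refl]], simp_all add: \<beta>_bound \<beta>_zero)
qed

text \<open>After splitting off the oscillation \<open>e\<^bsup>i\<lambda>\<psi>\<^esup>\<close>, the amplitude \<open>A\<close> and its derivative are both bounded
  by \<open>fiber_bound\<close>.\<close>

lemma integral_on_crit:
  assumes ab: "a \<le> b" "a \<in> crit" "b \<in> crit"
  shows "norm (integral {a..b} fiber)
    \<le> vdC_const k * lam powr (- (1 / real k)) * (fiber_bound + fiber_bound * (b - a))"
proof -
  have sub: "{a..b} \<subseteq> crit" by (intro subsetI crit_interval[OF ab(2,3)]) simp_all
  have d\<psi>: "((\<lambda>u. lam * \<psi> i u) has_real_derivative lam * \<psi> (Suc i) u) (at u within {a..b})"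
    if "i < 4" "u \<in> {a..b}" for i u
    using that sub by (intro DERIV_cmult DERIV_subset[OF \<psi>_deriv]) auto
  define A where "A u = cis (- (lam * \<psi> 0 u)) * fiber u" for u
  let ?A' = "\<lambda>u. cis (- (lam * \<psi> 0 u)) * (fiber' u - \<i> * of_real (lam * \<psi> 1 u) * fiber u)"
  have "norm (integral {a..b} (\<lambda>u. cis (lam * \<psi> 0 u) * A u))
      \<le> vdC_const k * lam powr (- (1 / real k)) * (fiber_bound + fiber_bound * (b - a))"
  proof (rule van_der_Corput_amplitude[where p = "\<lambda>i u. lam * \<psi> i u" and A' = ?A'])
    show "2 \<le> k" using k by auto
    show "((\<lambda>u. lam * \<psi> i u) has_real_derivative lam * \<psi> (Suc i) u) (at u within {a..b})"
      if "i < k" "u \<in> {a..b}" for i u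
      using that k by (intro d\<psi>) auto
    show "(\<forall>u\<in>{a..b}. lam \<le> lam * \<psi> k u) \<or> (\<forall>u\<in>{a..b}. lam * \<psi> k u \<le> - lam)"
      using \<psi>_nondegenerate[OF sub]
    proof
      assume h: "\<forall>u\<in>{a..b}. 1 \<le> \<psi> k u"
      have "lam * 1 \<le> lam * \<psi> k u" if "u \<in> {a..b}" for u using h that lam by (intro mult_left_mono) auto
      then show ?thesis by simp
    next
      assume h: "\<forall>u\<in>{a..b}. \<psi> k u \<le> - 1"
      have "lam * \<psi> k u \<le> lam * (- 1)" if "u \<in> {a..b}" for u using h that lam by (intro mult_left_mono) auto
      then show ?thesis by simp
    qed
    fix u assume u: "u \<in> {a..b}"
    then have uc: "u \<in> crit" using sub by blast
    have "((\<lambda>u. - (lam * \<psi> 0 u)) has_real_derivative - (lam * \<psi> 1 u)) (at u within {a..b})"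
      using DERIV_minus[OF d\<psi>[of 0 u]] u by simp
    from has_vector_derivative_mult[OF has_vector_derivative_cis[OF this] fiber_deriv]
    show "(A has_vector_derivative ?A' u) (at u within {a..b})"
      unfolding A_def[abs_def]
      by (rule has_vector_derivative_eq_rhs) (simp add: scaleR_conv_of_real algebra_simps)
    show "norm (A u) \<le> fiber_bound" using fiber_on_crit[OF uc] by (simp add: A_def norm_mult)
    show "norm (?A' u) \<le> fiber_bound" using fiber'_on_crit[OF uc] by (simp add: norm_mult)
  qed (use ab(1) lam in simp_all)
  moreover have "cis (lam * \<psi> 0 u) * A u = fiber u" for u
    by (simp add: A_def mult.assoc[symmetric] cis_mult)
  ultimately show ?thesis by simp
qed

lemma integral_off_crit:
  assumes ab: "a \<le> b" and off: "\<And>u. u \<in> {a<..<b} \<Longrightarrow> u \<notin> crit"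
  shows "norm (integral {a..b} fiber) \<le> 4 * M / lam * (b - a)"
proof -
  have "(fiber has_integral integral {a..b} fiber) (cbox a b)"
    using fiber_continuous by (simp add: integrable_integral integrable_continuous_real)
  moreover have "norm (fiber u) \<le> 4 * M / lam" if "u \<in> cbox a b - {a, b}" for u
    using that by (intro fiber_off_crit off) auto
  moreover have "0 \<le> 4 * M / lam" using M lam by simp
  ultimately have "norm (integral {a..b} fiber) \<le> 4 * M / lam * measure lborel (cbox a b)"
    by (intro has_integral_bound_spike_finite[where S = "{a, b}"]) simp_all
  then show ?thesis using ab by simp
qed

lemma crit_subset: "crit \<subseteq> {- \<epsilon>..\<epsilon>}"
proof
  fix u assume "u \<in> crit"
  then have "u\<^sup>2 + (\<gamma> u)\<^sup>2 < \<epsilon>\<^sup>2" using \<gamma>(1) unfolding in_ball by blast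
  then have "u\<^sup>2 \<le> \<epsilon>\<^sup>2" using zero_le_power2[of "\<gamma> u"] by linarith
  then have "\<bar>u\<bar> \<le> \<bar>\<epsilon>\<bar>" by (simp only: abs_le_square_iff)
  then show "u \<in> {- \<epsilon>..\<epsilon>}" using \<epsilon>(1) by auto
qed

lemma fiber_bound_nonneg: "fiber_bound \<ge> 0"
  unfolding fiber_bound_def using K M by (intro mult_nonneg_nonneg vdC_const_nonneg) auto

text \<open>The ends of \<open>crit\<close> need not be attained. So the integral is cut at points of \<open>crit\<close> close to them,
  and the short leftover pieces cost an arbitrarily small \<open>\<eta>\<close>.\<close>

lemma integral_fiber:
  "norm (integral {- \<epsilon>..\<epsilon>} fiber)
    \<le> vdC_const k * lam powr (- (1 / real k)) * (2 * fiber_bound) + 8 * M / lam"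
  (is "_ \<le> ?main + _")
proof (cases "crit = {}")
  case True
  have "norm (integral {- \<epsilon>..\<epsilon>} fiber) \<le> 4 * M / lam * (\<epsilon> - - \<epsilon>)"
    using True \<epsilon>(1) by (intro integral_off_crit) auto
  also have "\<dots> \<le> 4 * M / lam * 1" using \<epsilon> M lam by (intro mult_left_mono) auto
  also have "\<dots> \<le> 8 * M / lam" using M lam by (simp add: divide_right_mono)
  finally have "norm (integral {- \<epsilon>..\<epsilon>} fiber) \<le> 8 * M / lam" .
  moreover have "0 \<le> ?main" using fiber_bound_nonneg by (intro mult_nonneg_nonneg vdC_const_nonneg) auto
  ultimately show ?thesis by linarith
next
  case False
  have bdd: "bdd_below crit" "bdd_above crit"
    using crit_subset by (auto intro: bdd_below_mono[of "{- \<epsilon>..\<epsilon>}"] bdd_above_mono[of "{- \<epsilon>..\<epsilon>}"])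
  define a b where "a = Inf crit" and "b = Sup crit"
  have le: "a \<le> u" "u \<le> b" if "u \<in> crit" for u
    using that bdd unfolding a_def b_def by (auto intro: cInf_lower cSup_upper)
  obtain u0 where u0: "u0 \<in> crit" using False by blast
  have \<epsilon>ab: "- \<epsilon> \<le> a" "b \<le> \<epsilon>"
    unfolding a_def b_def using False crit_subset
    by (auto intro!: cInf_greatest cSup_least)
  have int: "fiber integrable_on {x..y}" for x y
    by (intro integrable_continuous_real fiber_continuous)
  have split: "integral {x..z} fiber = integral {x..y} fiber + integral {y..z} fiber" if "x \<le> y" "y \<le> z" for x y z
    using Henstock_Kurzweil_Integration.integral_combine[OF that int] by simp
  have "compact (fiber ` {- \<epsilon>..\<epsilon>})" by (intro compact_continuous_image fiber_continuous compact_Icc)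
  then obtain Q where "\<forall>x\<in>fiber ` {- \<epsilon>..\<epsilon>}. norm x \<le> Q"
    using compact_imp_bounded bounded_iff by blast
  then have Q: "norm (fiber u) \<le> Q" if "u \<in> {- \<epsilon>..\<epsilon>}" for u using that by blast
  have Q0: "Q \<ge> 0" using order_trans[OF norm_ge_zero Q[of 0]] \<epsilon>(1) by simp
  show ?thesis
  proof (rule field_le_epsilon)
    fix \<eta> :: real assume \<eta>: "\<eta> > 0"
    define \<delta> where "\<delta> = \<eta> / (2 * Q + 2)"
    have \<delta>: "\<delta> > 0" using \<eta> Q0 by (simp add: \<delta>_def)
    have "2 * Q * \<delta> \<le> (2 * Q + 2) * \<delta>" using \<delta> by (intro mult_right_mono) auto
    also have "\<dots> = \<eta>" using Q0 by (simp add: \<delta>_def)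
    finally have Q\<delta>: "2 * Q * \<delta> \<le> \<eta>" .
    obtain a0 where a0: "a0 \<in> crit" "a0 < a + \<delta>"
      using cInf_lessD[OF False, of "a + \<delta>"] \<delta> unfolding a_def by auto
    obtain b0 where b0: "b0 \<in> crit" "b - \<delta> < b0"
      using less_cSupD[OF False, of "b - \<delta>"] \<delta> unfolding b_def by auto
    define a' b' where "a' = min a0 b0" and "b' = max a0 b0"
    have a': "a' \<in> crit" "a \<le> a'" "a' \<le> a + \<delta>" and b': "b' \<in> crit" "b' \<le> b" "b - \<delta> \<le> b'" and ab': "a' \<le> b'"
      using a0 b0 le unfolding a'_def b'_def by (auto simp: min_def max_def)
    have lim: "- \<epsilon> \<le> a'" "b' \<le> \<epsilon>" "a' \<le> \<epsilon>" "- \<epsilon> \<le> b'" using a' b' ab' \<epsilon>ab by linarith+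
    have 1: "norm (integral {- \<epsilon>..a} fiber) \<le> 4 * M / lam * (a - - \<epsilon>)"
      by (rule integral_off_crit[OF \<epsilon>ab(1)]) (meson greaterThanLessThan_iff le(1) not_le)
    have 2: "norm (integral {b..\<epsilon>} fiber) \<le> 4 * M / lam * (\<epsilon> - b)"
      by (rule integral_off_crit[OF \<epsilon>ab(2)]) (meson greaterThanLessThan_iff le(2) not_le)
    have 3: "norm (integral {a..a'} fiber) \<le> Q * (a' - a)"
      using a' \<epsilon>ab lim by (intro norm_integral_le Q Q0) auto
    have 4: "norm (integral {b'..b} fiber) \<le> Q * (b - b')"
      using b' \<epsilon>ab lim by (intro norm_integral_le Q Q0) auto
    have 5: "norm (integral {a'..b'} fiber) \<le> ?main"
    proof -
      have "norm (integral {a'..b'} fiber)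
          \<le> vdC_const k * lam powr (- (1 / real k)) * (fiber_bound + fiber_bound * (b' - a'))"
        by (rule integral_on_crit[OF ab' a'(1) b'(1)])
      also have "\<dots> \<le> ?main"
      proof (intro mult_left_mono mult_nonneg_nonneg vdC_const_nonneg)
        have "fiber_bound * (b' - a') \<le> fiber_bound * 1"
          using lim \<epsilon>(2) fiber_bound_nonneg by (intro mult_left_mono) auto
        then show "fiber_bound + fiber_bound * (b' - a') \<le> 2 * fiber_bound" by simp
      qed simp
      finally show ?thesis .
    qed
    have "integral {- \<epsilon>..\<epsilon>} fiber = integral {- \<epsilon>..a} fiber + integral {a..a'} fiber + integral {a'..b'} fiber
        + integral {b'..b} fiber + integral {b..\<epsilon>} fiber"
      using a' b' ab' \<epsilon>ab lim split[of "- \<epsilon>" a \<epsilon>] split[of a a' \<epsilon>] split[of a' b' \<epsilon>] split[of b' b \<epsilon>]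
      by simp
    then have "norm (integral {- \<epsilon>..\<epsilon>} fiber) \<le> norm (integral {- \<epsilon>..a} fiber) + norm (integral {a..a'} fiber)
        + norm (integral {a'..b'} fiber) + norm (integral {b'..b} fiber) + norm (integral {b..\<epsilon>} fiber)"
      by (simp only:) (intro norm_triangle_mono order_refl)
    moreover have "4 * M / lam * (a - - \<epsilon>) \<le> 4 * M / lam * 1" "4 * M / lam * (\<epsilon> - b) \<le> 4 * M / lam * 1"
      using \<epsilon> \<epsilon>ab a' b' ab' lim M lam by (intro mult_left_mono; simp)+
    moreover have "Q * (a' - a) \<le> Q * \<delta>" "Q * (b - b') \<le> Q * \<delta>"
      using a' b' Q0 by (intro mult_left_mono; simp)+
    moreover have "8 * M / lam = 4 * M / lam * 1 + 4 * M / lam * 1" by simp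
    ultimately show "norm (integral {- \<epsilon>..\<epsilon>} fiber) \<le> ?main + 8 * M / lam + \<eta>"
      using 1 2 3 4 5 Q\<delta> by linarith
  qed
qed

lemma osc_integral_eq_fiber:
  "osc_integral \<beta> (\<lambda>(u, v). \<Phi> u v) lam = integral {- \<epsilon>..\<epsilon>} fiber"
proof -
  let ?f = "\<lambda>z. cis (lam * \<Phi> (fst z) (snd z)) * complex_of_real (E 0 0 (fst z, snd z))"
  let ?C = "cbox (- \<epsilon>, - \<epsilon>) (\<epsilon>, \<epsilon>)"
  have cont: "continuous_on S ?f" for S :: "(real \<times> real) set"
    by (intro continuous_intros phase_continuous_intros)
  have zero: "E 0 0 z = 0" if "z \<notin> ?C" for z
  proof -
    obtain u v where z: "z = (u, v)" by fastforce
    have "\<epsilon> \<le> \<bar>u\<bar> \<or> \<epsilon> \<le> \<bar>v\<bar>" using that by (auto simp: z cbox_Pair_eq)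
    then have "r\<^sup>2 \<le> u\<^sup>2 + v\<^sup>2"
    proof
      assume "\<epsilon> \<le> \<bar>u\<bar>"
      then show ?thesis using r power_mono[of r "\<bar>u\<bar>" 2] by (simp add: add_increasing2)
    next
      assume "\<epsilon> \<le> \<bar>v\<bar>"
      then show ?thesis using r power_mono[of r "\<bar>v\<bar>" 2] by (simp add: add_increasing)
    qed
    then show ?thesis unfolding z by (rule \<beta>_zero)
  qed
  have int: "set_integrable lborel ?C ?f"
    unfolding set_integrable_def by (intro borel_integrable_compact compact_cbox cont)
  have "osc_integral \<beta> (\<lambda>(u, v). \<Phi> u v) lam = (LINT z:?C|lborel. ?f z)"
    unfolding osc_integral_def set_lebesgue_integral_def
  proof (intro Bochner_Integration.integral_cong refl)
    fix z :: "real \<times> real"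
    show "exp (\<i> * complex_of_real (lam * (case z of (u, v) \<Rightarrow> \<Phi> u v))) * complex_of_real (\<beta> z)
        = indicator ?C z *\<^sub>R ?f z"
    proof (cases "z \<in> ?C")
      case True
      then show ?thesis by (simp add: cis_conv_exp partial_deriv_0 case_prod_unfold)
    next
      case False
      then have "\<beta> z = 0" using zero[of z] by (simp add: partial_deriv_0)
      then show ?thesis using False by simp
    qed
  qed
  also have "\<dots> = integral ?C ?f" by (rule set_borel_integral_eq_integral(2)[OF int])
  also have "\<dots> = integral (cbox (- \<epsilon>) \<epsilon>) (\<lambda>u. integral (cbox (- \<epsilon>) \<epsilon>) (\<lambda>v. ?f (u, v)))"
    by (rule integral_prod_continuous[OF cont])
  finally show ?thesis by (simp add: fiber_def[abs_def])
qed

theorem osc_integral_bound: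
  "norm (osc_integral \<beta> (\<lambda>(u, v). \<Phi> u v) lam)
    \<le> (56 * vdC_const k * vdC_const 2 * K ^ 3 + 8) * M * lam powr (- 1 / 2 - 1 / real k)"
proof -
  let ?e = "- 1 / 2 - 1 / real k"
  have "lam powr (- (1 / real k)) * lam powr (- (1 / 2)) = lam powr ?e"
    unfolding powr_add[symmetric] by (rule arg_cong[of _ _ "(powr) lam"]) simp
  then have main: "vdC_const k * lam powr (- (1 / real k)) * (2 * fiber_bound)
      = 56 * vdC_const k * vdC_const 2 * K ^ 3 * M * lam powr ?e"
    by (simp add: fiber_bound_def mult_ac)
  \<comment> \<open>the fibers off \<open>crit\<close> contribute no more than the others, as \<open>1/2 + 1/k \<le> 1\<close>\<close>
  have "lam powr (- 1) \<le> lam powr ?e"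
    using lam k by (intro powr_mono) auto
  then have "8 * M * lam powr (- 1) \<le> 8 * M * lam powr ?e"
    using M by (intro mult_left_mono) auto
  moreover have "8 * M / lam = 8 * M * lam powr (- 1)" using lam by (simp add: powr_minus_divide)
  moreover have "(56 * vdC_const k * vdC_const 2 * K ^ 3 + 8) * M * lam powr ?e
      = 56 * vdC_const k * vdC_const 2 * K ^ 3 * M * lam powr ?e + 8 * M * lam powr ?e"
    by (simp add: distrib_right)
  ultimately show ?thesis
    using integral_fiber unfolding osc_integral_eq_fiber main by linarith
qed

end

section \<open>Vanishing Taylor coefficients of the remainder\<close>

text \<open>The derivatives up to order \<open>n\<close> vanish one after the other: once the lower ones do, Taylor's
  formula with Lagrange remainder bounds \<open>d m\<close> at some point near 0 by a multiple of \<open>|t|\<close>.\<close>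

lemma flat_imp_deriv_zero:
  fixes d :: "nat \<Rightarrow> real \<Rightarrow> real"
  assumes d: "\<And>m x. (d m has_real_derivative d (Suc m) x) (at x)"
    and \<epsilon>: "\<epsilon> > 0" and flat: "\<And>t. t \<noteq> 0 \<Longrightarrow> \<bar>t\<bar> < \<epsilon> \<Longrightarrow> \<bar>d 0 t\<bar> \<le> B * \<bar>t\<bar> ^ Suc n"
  shows "d n 0 = 0"
proof -
  have "m \<le> n \<Longrightarrow> d m 0 = 0" for m
  proof (induction m rule: less_induct)
    case (less m)
    have small: "\<exists>\<xi>. \<bar>\<xi>\<bar> \<le> \<bar>t\<bar> \<and> \<bar>d m \<xi>\<bar> \<le> \<bar>B\<bar> * fact m * \<bar>t\<bar>"
      if t: "\<bar>t\<bar> < min \<epsilon> 1" "t \<noteq> 0" for t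
    proof -
      obtain \<xi> where \<xi>: "\<bar>\<xi>\<bar> \<le> \<bar>t\<bar>"
        and eq: "d 0 t = (\<Sum>j<m. d j 0 / fact j * t ^ j) + d m \<xi> / fact m * t ^ m"
        using Maclaurin_all_le[of d "d 0" t m] d by blast
      have "(\<Sum>j<m. d j 0 / fact j * t ^ j) = 0"
        by (rule sum.neutral) (use less in auto)
      with eq have "\<bar>d m \<xi>\<bar> * \<bar>t\<bar> ^ m = \<bar>d 0 t\<bar> * fact m" by (simp add: abs_mult power_abs)
      also have "\<dots> \<le> (\<bar>B\<bar> * \<bar>t\<bar> ^ Suc m) * fact m"
      proof (intro mult_right_mono)
        have "\<bar>d 0 t\<bar> \<le> B * \<bar>t\<bar> ^ Suc n" using t by (intro flat) simp_all
        also have "\<dots> \<le> \<bar>B\<bar> * \<bar>t\<bar> ^ Suc m"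
          using t less.prems by (intro mult_mono power_decreasing) auto
        finally show "\<bar>d 0 t\<bar> \<le> \<bar>B\<bar> * \<bar>t\<bar> ^ Suc m" .
      qed simp
      also have "\<dots> = (\<bar>B\<bar> * fact m * \<bar>t\<bar>) * \<bar>t\<bar> ^ m" by simp
      finally have "\<bar>d m \<xi>\<bar> \<le> \<bar>B\<bar> * fact m * \<bar>t\<bar>" using t(2) by simp
      with \<xi> show ?thesis by blast
    qed
    show "d m 0 = 0"
    proof (rule ccontr)
      assume nz: "d m 0 \<noteq> 0"
      have "isCont (d m) 0" using d by (rule DERIV_isCont)
      then obtain \<delta> where \<delta>: "\<delta> > 0" "\<And>x. \<bar>x\<bar> < \<delta> \<Longrightarrow> \<bar>d m x - d m 0\<bar> < \<bar>d m 0\<bar> / 2"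
        using nz unfolding continuous_at_eps_delta dist_real_def
        by (metis diff_zero half_gt_zero_iff zero_less_abs_iff)
      have "\<bar>d m 0\<bar> / (2 * (\<bar>B\<bar> * fact m + 1)) > 0"
        using nz by (intro divide_pos_pos mult_pos_pos add_nonneg_pos) auto
      then have "0 < min (min \<epsilon> 1) (min \<delta> (\<bar>d m 0\<bar> / (2 * (\<bar>B\<bar> * fact m + 1))))"
        using \<epsilon> \<delta>(1) by simp
      \<comment> \<open>so small a \<open>t\<close> forces \<open>d m\<close> to be below half of \<open>|d m 0|\<close> somewhere near 0\<close>
      then obtain t where t: "t > 0" "t < min \<epsilon> 1" "t < \<delta>" "t < \<bar>d m 0\<bar> / (2 * (\<bar>B\<bar> * fact m + 1))"
        using dense by (metis min_less_iff_conj)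
      obtain \<xi> where \<xi>: "\<bar>\<xi>\<bar> \<le> t" "\<bar>d m \<xi>\<bar> \<le> \<bar>B\<bar> * fact m * t"
        using small[of t] t by auto
      have "\<bar>d m \<xi> - d m 0\<bar> < \<bar>d m 0\<bar> / 2" using \<xi> t by (intro \<delta>(2)) simp
      moreover have "\<bar>B\<bar> * fact m * t \<le> (\<bar>B\<bar> * fact m + 1) * t" using t by simp
      moreover have "(\<bar>B\<bar> * fact m + 1) * t < \<bar>d m 0\<bar> / 2"
      proof -
        have "0 < 2 * (\<bar>B\<bar> * fact m + 1 :: real)" by (intro mult_pos_pos add_nonneg_pos) auto
        from t(4)[unfolded pos_less_divide_eq[OF this]] show ?thesis by (simp add: algebra_simps)
      qed
      ultimately show False using \<xi>(2) by linarith
    qed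
  qed
  then show ?thesis by simp
qed

text \<open>The mean value theorem on the segment from the origin.\<close>

lemma vanishing_imp_small:
  assumes F: "smooth_on UNIV F" and zero: "partial_deriv a b F (0, 0) = 0"
    and \<epsilon>: "\<epsilon> > 0" and p: "p \<in> ball (0, 0) \<epsilon>"
    and bound: "\<And>q. q \<in> ball (0, 0) \<epsilon> \<Longrightarrow> \<bar>partial_deriv (Suc a) b F q\<bar> \<le> K"
      "\<And>q. q \<in> ball (0, 0) \<epsilon> \<Longrightarrow> \<bar>partial_deriv a (Suc b) F q\<bar> \<le> K"
  shows "\<bar>partial_deriv a b F p\<bar> \<le> 2 * K * \<epsilon>"
proof -
  obtain x y where xy: "p = (x, y)" by fastforce
  have aff: "((\<lambda>t. t * c) has_real_derivative c) (at t within S)" for c t :: real and S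
    by (auto intro!: derivative_eq_intros)
  have "\<exists>t>0. t < 1 \<and> partial_deriv a b F (1 * x, 1 * y) - partial_deriv a b F (0 * x, 0 * y)
      = (1 - 0) * (x * partial_deriv (Suc a) b F (t * x, t * y) + y * partial_deriv a (Suc b) F (t * x, t * y))"
    by (intro MVT2 partial_deriv_curve[OF F] aff) auto
  then obtain t where t: "0 < t" "t < 1" and eq: "partial_deriv a b F p
      = x * partial_deriv (Suc a) b F (t * x, t * y) + y * partial_deriv a (Suc b) F (t * x, t * y)"
    using zero by (auto simp: xy)
  have norm: "x\<^sup>2 + y\<^sup>2 < \<epsilon>\<^sup>2" using p \<epsilon> mem_ball_Pair[of \<epsilon> x y] by (simp add: xy)
  have "t\<^sup>2 * (x\<^sup>2 + y\<^sup>2) \<le> 1 * (x\<^sup>2 + y\<^sup>2)" using t by (intro mult_right_mono) (auto simp: power_le_one)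
  then have q: "(t * x, t * y) \<in> ball (0, 0) \<epsilon>"
    using norm \<epsilon> mem_ball_Pair[of \<epsilon> "t * x" "t * y"] by (simp add: power_mult_distrib distrib_left)
  have "x\<^sup>2 \<le> \<epsilon>\<^sup>2" "y\<^sup>2 \<le> \<epsilon>\<^sup>2" using norm zero_le_power2[of x] zero_le_power2[of y] by linarith+
  then have "\<bar>x\<bar> \<le> \<epsilon>" "\<bar>y\<bar> \<le> \<epsilon>" using \<epsilon> by (auto simp: abs_le_square_iff[symmetric])
  then have "\<bar>x * partial_deriv (Suc a) b F (t * x, t * y)\<bar> \<le> \<epsilon> * K"
    "\<bar>y * partial_deriv a (Suc b) F (t * x, t * y)\<bar> \<le> \<epsilon> * K"
    unfolding abs_mult using bound[OF q] \<epsilon> by (auto intro!: mult_mono)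
  then show ?thesis unfolding eq by (simp add: algebra_simps)
qed

text \<open>On the parabolas \<open>v = \<plusminus>u\<^sup>2\<close> the bound on \<open>F\<close> is of order \<open>|u|\<^sup>5\<close>. In the difference of the values
  on both of them the even terms of the Taylor expansion in \<open>v\<close> cancel, which leaves
  \<open>2 u\<^sup>2 F\<^sub>v(u, 0) = O(|u|\<^sup>5)\<close>. So \<open>F\<^sub>v(u, 0)\<close> is of order \<open>|u|\<^sup>3\<close> and its second derivative vanishes at 0.\<close>

lemma weighted_flatness_uv:
  assumes F: "smooth_on UNIV F" and \<epsilon>: "0 < \<epsilon>" "\<epsilon> \<le> 1"
    and flat: "\<And>u v. (u, v) \<in> ball (0, 0) \<epsilon> \<Longrightarrow>
      \<bar>F (u, v)\<bar> \<le> A * (\<bar>v\<bar> ^ 3 + \<bar>v\<bar> ^ 2 * \<bar>u\<bar> + \<bar>u\<bar> ^ 5)"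
    and bound: "\<And>q. q \<in> ball (0, 0) \<epsilon> \<Longrightarrow> \<bar>partial_deriv 0 3 F q\<bar> \<le> K"
  shows "partial_deriv 2 1 F (0, 0) = 0"
proof -
  have main: "\<bar>partial_deriv 0 1 F (t, 0)\<bar> \<le> (3 * \<bar>A\<bar> + K) * \<bar>t\<bar> ^ Suc 2"
    if t: "t \<noteq> 0" "\<bar>t\<bar> < \<epsilon> / 2" for t
  proof -
    let ?D = "\<lambda>j v. partial_deriv 0 j F (t, v)"
    define w where "w = t\<^sup>2"
    have t1: "\<bar>t\<bar> \<le> 1" "0 < \<bar>t\<bar>" using t \<epsilon> by auto
    have w: "0 < w" "w \<le> \<bar>t\<bar>" "w = \<bar>t\<bar>\<^sup>2" "w \<le> 1"
      using t t1 power_decreasing[of 1 2 "\<bar>t\<bar>"] by (simp_all add: w_def abs_square_le_1)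
    have ball: "(t, \<xi>) \<in> ball (0, 0) \<epsilon>" if "\<bar>\<xi>\<bar> \<le> w" for \<xi>
    proof -
      have "\<bar>t\<bar>\<^sup>2 < (\<epsilon> / 2)\<^sup>2" using t by (intro power_strict_mono) auto
      moreover have "\<bar>\<xi>\<bar>\<^sup>2 \<le> \<bar>t\<bar>\<^sup>2" using that w by (intro power_mono) auto
      ultimately have "t\<^sup>2 + \<xi>\<^sup>2 < \<epsilon>\<^sup>2 / 2" by (simp add: power_divide)
      then have "t\<^sup>2 + \<xi>\<^sup>2 < \<epsilon>\<^sup>2" using \<epsilon>(1) zero_le_power2[of \<epsilon>] by linarith
      then show ?thesis using \<epsilon>(1) mem_ball_Pair[of \<epsilon> t \<xi>] by simp
    qed
    have taylor: "\<exists>R. \<bar>R\<bar> \<le> K * w ^ 3 \<and> F (t, v) = F (t, 0) + ?D 1 0 * v + ?D 2 0 / 2 * w\<^sup>2 + R"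
      if v: "\<bar>v\<bar> = w" for v
    proof -
      obtain \<xi> where \<xi>: "\<bar>\<xi>\<bar> \<le> \<bar>v\<bar>"
        and eq: "?D 0 v = (\<Sum>j<3. ?D j 0 / fact j * v ^ j) + ?D 3 \<xi> / fact 3 * v ^ 3"
        using Maclaurin_all_le[of ?D "?D 0" v 3] partial_deriv_v[OF F] by blast
      have "\<bar>?D 3 \<xi> / fact 3\<bar> \<le> K"
        using bound[OF ball[of \<xi>]] \<xi> v by (simp add: fact_numeral)
      then have "\<bar>?D 3 \<xi> / fact 3 * v ^ 3\<bar> \<le> K * w ^ 3"
        unfolding abs_mult power_abs v using w by (intro mult_right_mono) auto
      moreover have "v\<^sup>2 = w\<^sup>2" using v power2_abs[of v] by simp
      ultimately show ?thesis using eq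
        by (intro exI[of _ "?D 3 \<xi> / fact 3 * v ^ 3"])
          (simp add: partial_deriv_0 numeral_3_eq_3 lessThan_Suc fact_numeral numeral_2_eq_2)
    qed
    obtain R1 where R1: "\<bar>R1\<bar> \<le> K * w ^ 3" "F (t, w) = F (t, 0) + ?D 1 0 * w + ?D 2 0 / 2 * w\<^sup>2 + R1"
      using taylor[of w] w by auto
    obtain R2 where R2: "\<bar>R2\<bar> \<le> K * w ^ 3" "F (t, - w) = F (t, 0) + ?D 1 0 * (- w) + ?D 2 0 / 2 * w\<^sup>2 + R2"
      using taylor[of "- w"] w by auto
    have w3: "w ^ 3 \<le> w * \<bar>t\<bar> ^ 3"
    proof -
      have "w\<^sup>2 = \<bar>t\<bar> ^ 4" unfolding w(3) power_mult[symmetric] by simp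
      also have "\<dots> \<le> \<bar>t\<bar> ^ 3" using t1 by (intro power_decreasing) auto
      finally have "w * w\<^sup>2 \<le> w * \<bar>t\<bar> ^ 3" using w by (intro mult_left_mono) auto
      then show ?thesis by (simp add: power3_eq_cube power2_eq_square)
    qed
    have FA: "\<bar>F (t, v)\<bar> \<le> 3 * \<bar>A\<bar> * (w * \<bar>t\<bar> ^ 3)" if v: "\<bar>v\<bar> = w" for v
    proof -
      have "\<bar>F (t, v)\<bar> \<le> A * (w ^ 3 + w\<^sup>2 * \<bar>t\<bar> + \<bar>t\<bar> ^ 5)"
        using flat[OF ball[of v]] v by simp
      also have "\<dots> \<le> \<bar>A\<bar> * (w * \<bar>t\<bar> ^ 3 + w * \<bar>t\<bar> ^ 3 + w * \<bar>t\<bar> ^ 3)"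
      proof (rule mult_mono)
        have "w\<^sup>2 * \<bar>t\<bar> \<le> w * \<bar>t\<bar> ^ 3" "\<bar>t\<bar> ^ 5 \<le> w * \<bar>t\<bar> ^ 3"
          unfolding w(3) by (simp_all add: power_numeral_reduce)
        with w3 show "w ^ 3 + w\<^sup>2 * \<bar>t\<bar> + \<bar>t\<bar> ^ 5 \<le> w * \<bar>t\<bar> ^ 3 + w * \<bar>t\<bar> ^ 3 + w * \<bar>t\<bar> ^ 3"
          by linarith
      qed (use w in auto)
      finally show ?thesis by simp
    qed
    have "2 * w * ?D 1 0 = F (t, w) - F (t, - w) - R1 + R2" using R1 R2 by (simp add: algebra_simps)
    moreover have "\<bar>F (t, w)\<bar> \<le> 3 * \<bar>A\<bar> * (w * \<bar>t\<bar> ^ 3)" "\<bar>F (t, - w)\<bar> \<le> 3 * \<bar>A\<bar> * (w * \<bar>t\<bar> ^ 3)"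
      using w(1) by (intro FA; simp)+
    ultimately have "\<bar>2 * w * ?D 1 0\<bar> \<le> 6 * \<bar>A\<bar> * (w * \<bar>t\<bar> ^ 3) + 2 * (K * w ^ 3)"
      using R1(1) R2(1) by linarith
    moreover have "K * w ^ 3 \<le> K * (w * \<bar>t\<bar> ^ 3)"
    proof -
      have "0 \<le> K" using bound[OF ball[of 0]] w by simp
      with w3 show ?thesis by (rule mult_left_mono)
    qed
    moreover have "(2 * w) * ((3 * \<bar>A\<bar> + K) * \<bar>t\<bar> ^ 3) = 6 * \<bar>A\<bar> * (w * \<bar>t\<bar> ^ 3) + 2 * (K * (w * \<bar>t\<bar> ^ 3))"
      by (simp add: algebra_simps)
    ultimately have "\<bar>2 * w * ?D 1 0\<bar> \<le> (2 * w) * ((3 * \<bar>A\<bar> + K) * \<bar>t\<bar> ^ 3)"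
      by linarith
    moreover have "\<bar>2 * w * ?D 1 0\<bar> = (2 * w) * \<bar>?D 1 0\<bar>" using w by (simp add: abs_mult)
    ultimately have "(2 * w) * \<bar>?D 1 0\<bar> \<le> (2 * w) * ((3 * \<bar>A\<bar> + K) * \<bar>t\<bar> ^ 3)" by linarith
    then have "\<bar>?D 1 0\<bar> \<le> (3 * \<bar>A\<bar> + K) * \<bar>t\<bar> ^ 3"
      by (rule mult_left_le_imp_le) (use w in simp)
    moreover have "Suc 2 = 3" by simp
    ultimately show ?thesis by (simp only:)
  qed
  have "partial_deriv 2 1 F (0, 0) = 0"
  proof (rule flat_imp_deriv_zero[where d = "\<lambda>j t. partial_deriv j 1 F (t, 0)"])
    show "((\<lambda>t. partial_deriv m 1 F (t, 0)) has_real_derivative partial_deriv (Suc m) 1 F (x, 0)) (at x)" for m x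
      by (rule partial_deriv_u[OF F])
    show "\<epsilon> / 2 > 0" using \<epsilon> by simp
  qed (rule main)
  then show ?thesis .
qed

lemma norm_Pair_real: "norm (u, v) = sqrt (u\<^sup>2 + v\<^sup>2)" for u v :: real
  by (simp add: norm_Pair)

text \<open>A compact subset of an open ball lies in a smaller ball. Half of the gap is kept, so that the
  derivatives vanish on the sphere of radius \<open>r\<close> too.\<close>

lemma test_function_radius:
  assumes \<beta>: "test_function_on (ball (0, 0) \<epsilon>) \<beta>" and \<epsilon>: "\<epsilon> > 0"
  obtains r where "0 < r" "r < \<epsilon>" "\<And>a b u v. r\<^sup>2 \<le> u\<^sup>2 + v\<^sup>2 \<Longrightarrow> partial_deriv a b \<beta> (u, v) = 0"
proof -
  have \<beta>': "compact (supp \<beta>)" "supp \<beta> \<subseteq> ball (0, 0) \<epsilon>"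
    using \<beta> by (auto simp: test_function_on_def)
  have "\<exists>R. 0 \<le> R \<and> R < \<epsilon> \<and> (\<forall>p\<in>supp \<beta>. norm p \<le> R)"
  proof (cases "supp \<beta> = {}")
    case False
    obtain q where q: "q \<in> supp \<beta>" "\<forall>p\<in>supp \<beta>. norm p \<le> norm q"
      using continuous_attains_sup[OF \<beta>'(1) False, of norm] continuous_on_norm_id by blast
    have "norm q < \<epsilon>" using q(1) \<beta>'(2) by (auto simp: zero_prod_def[symmetric])
    then show ?thesis using q by (intro exI[of _ "norm q"]) simp
  qed (use \<epsilon> in auto)
  then obtain R where R: "0 \<le> R" "R < \<epsilon>" "\<And>p. p \<in> supp \<beta> \<Longrightarrow> norm p \<le> R" by blast
  show ?thesis
  proof (rule that)
    show "0 < (R + \<epsilon>) / 2" "(R + \<epsilon>) / 2 < \<epsilon>" using R \<epsilon> by auto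
    fix a b and u v :: real assume "((R + \<epsilon>) / 2)\<^sup>2 \<le> u\<^sup>2 + v\<^sup>2"
    then have "(R + \<epsilon>) / 2 \<le> norm (u, v)" unfolding norm_Pair_real by (rule real_le_rsqrt)
    then have "(u, v) \<notin> supp \<beta>" using R by fastforce
    then show "partial_deriv a b \<beta> (u, v) = 0" by (rule partial_deriv_outside_supp)
  qed
qed

section \<open>The oscillatory integral estimate\<close>

text \<open>The remainder \<open>F\<close> is formed from \<open>h\<close>, which is smooth on the whole plane, and agrees with \<open>f\<close> on the
  ball. Derivatives up to order 5 occur: one more than the largest \<open>k\<close>, in order to deduce the smallness of
  the derivative of order \<open>k\<close> from its vanishing at the origin.\<close>

lemma degenerate_phase_bound:
  fixes f h \<beta> :: "real \<times> real \<Rightarrow> real" and c :: "nat \<Rightarrow> nat \<Rightarrow> real"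
  defines "K \<equiv> 1 + (\<Sum>a\<le>5. \<Sum>b\<le>5. \<bar>c a b\<bar>)"
  assumes k: "k \<in> {2, 3, 4}" and \<epsilon>: "0 < \<epsilon>" "\<epsilon> < 1 / (1000 * K ^ 3)" and lam: "lam \<ge> 1"
    and \<beta>: "test_function_on (ball (0, 0) \<epsilon>) \<beta>" and h: "smooth_on UNIV h" and s: "s \<in> {1, -1}"
    and hf: "\<And>u v. (u, v) \<in> ball (0, 0) \<epsilon> \<Longrightarrow> h (u, v) = v ^ 2 + s * u ^ k + f (u, v)"
    and flat: "\<And>u v. (u, v) \<in> ball (0, 0) \<epsilon> \<Longrightarrow>
      \<bar>f (u, v)\<bar> \<le> A * (\<bar>v\<bar> ^ 3 + \<bar>v\<bar> ^ 2 * \<bar>u\<bar> + \<bar>u\<bar> ^ (k + 1))"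
    and deriv: "\<And>a b u v. (u, v) \<in> ball (0, 0) \<epsilon> \<Longrightarrow>
      \<bar>partial_deriv a b f (u, v)\<bar> \<le> c a b * min (\<epsilon> powi (3 - int (a + b))) 1"
  shows "cmod (osc_integral \<beta> (phase h x1 x2 lam) lam)
    \<le> (56 * vdC_const k * vdC_const 2 * K ^ 3 + 8) * CN_norm 2 \<beta> * lam powr (- 1 / 2 - 1 / real k)"
proof -
  have K: "K \<ge> 1" unfolding K_def by (simp add: sum_nonneg)
  have cK: "\<bar>c a b\<bar> \<le> K" if "a \<le> 5" "b \<le> 5" for a b
  proof -
    have "\<bar>c a b\<bar> \<le> (\<Sum>b\<le>5. \<bar>c a b\<bar>)" using that by (intro member_le_sum) auto
    also have "\<dots> \<le> (\<Sum>a\<le>5. \<Sum>b\<le>5. \<bar>c a b\<bar>)"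
      using that by (intro member_le_sum[of a _ "\<lambda>a. \<Sum>b\<le>5. \<bar>c a b\<bar>"]) (auto intro: sum_nonneg)
    finally show ?thesis by (simp add: K_def)
  qed
  have K3: "1 \<le> K ^ 3" using K by simp
  have small: "1000 * K ^ 3 * \<epsilon> \<le> 1"
  proof -
    have "0 < 1000 * K ^ 3" using K by simp
    from \<epsilon>(2)[unfolded pos_less_divide_eq[OF this]] show ?thesis by (simp add: mult.commute)
  qed
  have "1 * \<epsilon> \<le> (1000 * K ^ 3) * \<epsilon>" using \<epsilon> K3 by (intro mult_right_mono) auto
  then have \<epsilon>1: "\<epsilon> \<le> 1" using small by linarith
  define F where "F z = h z + (- 1) * (snd z ^ 2 + s * fst z ^ k)" for z
  have F: "smooth_on UNIV F"
    unfolding F_def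
    by (intro smooth_on_add smooth_on_mult smooth_on_power smooth_on_const smooth_on_fst smooth_on_snd h)
  have Ff: "F p = f p" if "p \<in> ball (0, 0) \<epsilon>" for p
    using hf[of "fst p" "snd p"] that by (simp add: F_def)
  have FD: "\<bar>partial_deriv a b F p\<bar> \<le> c a b * min (\<epsilon> powi (3 - int (a + b))) 1" if p: "p \<in> ball (0, 0) \<epsilon>" for a b p
  proof -
    have "partial_deriv a b F p = partial_deriv a b f p"
      by (rule partial_deriv_cong_open[OF open_ball Ff p])
    then show ?thesis using deriv[of "fst p" "snd p" a b] p by simp
  qed
  have F2: "\<bar>partial_deriv a b F p\<bar> \<le> K * \<epsilon>" if p: "p \<in> ball (0, 0) \<epsilon>" and ab: "a + b = 2" for a b p
  proof -
    have "\<bar>partial_deriv a b F p\<bar> \<le> c a b * \<epsilon>"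
      using FD[OF p, of a b] \<epsilon> \<epsilon>1 unfolding ab by simp
    also have "\<dots> \<le> K * \<epsilon>" using cK[of a b] ab \<epsilon> by (intro mult_right_mono) auto
    finally show ?thesis .
  qed
  have F345: "\<bar>partial_deriv a b F p\<bar> \<le> K" if p: "p \<in> ball (0, 0) \<epsilon>" and ab: "a + b \<in> {3, 4, 5}" for a b p
  proof -
    let ?m = "min (\<epsilon> powi (3 - int (a + b))) 1"
    have "0 \<le> ?m" "?m \<le> 1" using \<epsilon> by auto
    have "\<bar>partial_deriv a b F p\<bar> \<le> c a b * ?m" by (rule FD[OF p])
    also have "\<dots> \<le> K * 1" using cK[of a b] ab K \<open>0 \<le> ?m\<close> \<open>?m \<le> 1\<close> by (intro mult_mono) auto
    finally show ?thesis by simp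
  qed
  have top: "\<bar>partial_deriv k 0 F p\<bar> \<le> 2 * K * \<epsilon>" if p: "p \<in> ball (0, 0) \<epsilon>" for p
  proof -
    have "partial_deriv k 0 F (0, 0) = 0"
    proof (rule flat_imp_deriv_zero[where d = "\<lambda>j t. partial_deriv j 0 F (t, 0)" and B = A])
      show "((\<lambda>t. partial_deriv m 0 F (t, 0)) has_real_derivative partial_deriv (Suc m) 0 F (x, 0)) (at x)" for m x
        by (rule partial_deriv_u[OF F])
      show "\<bar>partial_deriv 0 0 F (t, 0)\<bar> \<le> A * \<bar>t\<bar> ^ Suc k" if t: "\<bar>t\<bar> < \<epsilon>" for t
      proof -
        have "\<bar>t\<bar>\<^sup>2 < \<epsilon>\<^sup>2" using t by (intro power_strict_mono) auto
        then have "(t, 0::real) \<in> ball (0, 0) \<epsilon>" using \<epsilon>(1) by (intro iffD2[OF mem_ball_Pair]) simp_all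
        from flat[OF this] Ff[OF this] show ?thesis by (simp add: partial_deriv_0)
      qed
    qed (rule \<epsilon>(1))
    moreover have "Suc k + 0 \<in> {3, 4, 5}" "k + Suc 0 \<in> {3, 4, 5}" using k by auto
    ultimately show ?thesis by (intro vanishing_imp_small[OF F _ \<epsilon>(1) p] F345)
  qed
  have uuv: "\<bar>partial_deriv 2 1 F p\<bar> \<le> 2 * K * \<epsilon>" if k4: "k = 4" and p: "p \<in> ball (0, 0) \<epsilon>" for p
  proof -
    have "partial_deriv 2 1 F (0, 0) = 0"
    proof (rule weighted_flatness_uv[OF F \<epsilon>(1) \<epsilon>1])
      show "\<bar>F (u, v)\<bar> \<le> A * (\<bar>v\<bar> ^ 3 + \<bar>v\<bar> ^ 2 * \<bar>u\<bar> + \<bar>u\<bar> ^ 5)" if "(u, v) \<in> ball (0, 0) \<epsilon>" for u v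
        using flat[OF that] Ff[OF that] by (simp add: k4)
      show "\<bar>partial_deriv 0 3 F q\<bar> \<le> K" if "q \<in> ball (0, 0) \<epsilon>" for q by (rule F345[OF that]) simp
    qed
    then show ?thesis by (rule vanishing_imp_small[OF F _ \<epsilon>(1) p]) (rule F345; simp)+
  qed
  have \<beta>s: "smooth_on UNIV \<beta>" "compact (supp \<beta>)" using \<beta> by (auto simp: test_function_on_def)
  obtain r where r: "0 < r" "r < \<epsilon>" "\<And>a b u v. r\<^sup>2 \<le> u\<^sup>2 + v\<^sup>2 \<Longrightarrow> partial_deriv a b \<beta> (u, v) = 0"
    using test_function_radius[OF \<beta> \<epsilon>(1)] by blast
  interpret degenerate_phase F \<beta> K "CN_norm 2 \<beta>" \<epsilon> r lam s "x1 / lam" "x2 / lam" k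
  proof
    show "\<bar>partial_deriv a b F p\<bar> \<le> K" if "p \<in> ball (0, 0) \<epsilon>" "a + b \<in> {3, 4}" for a b p
      using that by (intro F345) auto
    show "\<bar>partial_deriv a b \<beta> p\<bar> \<le> CN_norm 2 \<beta>" if "a + b \<le> 2" for a b p
      by (rule partial_deriv_le_CN_norm[OF \<beta>s that])
  qed (fact F \<beta>s(1) r lam s k K small F2 top uuv)+
  have "phase h x1 x2 lam = (\<lambda>(u, v). \<Phi> u v)"
    by (auto simp: phase_def \<Phi>_def F_def partial_deriv_0)
  then show ?thesis using osc_integral_bound by simp
qed

theorem theorem1p1:
  shows "\<exists>N::nat. \<forall>k\<in>{2, 3, 4::nat}. \<forall>(A::real) (c::nat \<Rightarrow> nat \<Rightarrow> real).
    \<exists>\<epsilon>0>0. \<exists>C::(real \<times> real) set \<Rightarrow> real \<Rightarrow> real.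
      \<forall>(\<epsilon>::real) (lam::real) (\<beta>::real \<times> real \<Rightarrow> real) (h::real \<times> real \<Rightarrow> real)
        (f::real \<times> real \<Rightarrow> real) (s::real) (x1::real) (x2::real).
        0 < \<epsilon> \<longrightarrow> \<epsilon> < \<epsilon>0 \<longrightarrow> lam \<ge> 1 \<longrightarrow>
        test_function_on (ball (0, 0) \<epsilon>) \<beta> \<longrightarrow>
        smooth_on UNIV h \<longrightarrow>
        s \<in> {1, -1} \<longrightarrow>
        (\<forall>u v. (u, v) \<in> ball (0, 0) \<epsilon> \<longrightarrow> h (u, v) = v ^ 2 + s * u ^ k + f (u, v)) \<longrightarrow>
        (\<forall>u v. (u, v) \<in> ball (0, 0) \<epsilon> \<longrightarrow>
           \<bar>f (u, v)\<bar> \<le> A * (\<bar>v\<bar> ^ 3 + \<bar>v\<bar> ^ 2 * \<bar>u\<bar> + \<bar>u\<bar> ^ (k + 1))) \<longrightarrow>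
        (\<forall>a b u v. (u, v) \<in> ball (0, 0) \<epsilon> \<longrightarrow>
           \<bar>partial_deriv a b f (u, v)\<bar> \<le> c a b * min (\<epsilon> powi (3 - int (a + b))) 1) \<longrightarrow>
        \<bar>x1\<bar> \<le> 10 * \<epsilon> * lam \<longrightarrow> \<bar>x2\<bar> \<le> 10 * \<epsilon> * lam \<longrightarrow>
        cmod (osc_integral \<beta> (phase h x1 x2 lam) lam)
          \<le> C (supp \<beta>) (CN_norm N \<beta>) * lam powr (- 1 / 2 - 1 / real k)"
proof (rule exI[of _ 2], intro ballI allI)
  fix k :: nat and A :: real and c :: "nat \<Rightarrow> nat \<Rightarrow> real"
  assume k: "k \<in> {2, 3, 4}"
  define K where "K = 1 + (\<Sum>a\<le>5. \<Sum>b\<le>5. \<bar>c a b\<bar>)"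
  have "K \<ge> 1" unfolding K_def by (simp add: sum_nonneg)
  then have pos: "0 < 1 / (1000 * K ^ 3)" by simp
  show "\<exists>\<epsilon>0>0. \<exists>C::(real \<times> real) set \<Rightarrow> real \<Rightarrow> real.
      \<forall>(\<epsilon>::real) (lam::real) (\<beta>::real \<times> real \<Rightarrow> real) (h::real \<times> real \<Rightarrow> real)
        (f::real \<times> real \<Rightarrow> real) (s::real) (x1::real) (x2::real).
        0 < \<epsilon> \<longrightarrow> \<epsilon> < \<epsilon>0 \<longrightarrow> lam \<ge> 1 \<longrightarrow>
        test_function_on (ball (0, 0) \<epsilon>) \<beta> \<longrightarrow>
        smooth_on UNIV h \<longrightarrow>
        s \<in> {1, -1} \<longrightarrow>
        (\<forall>u v. (u, v) \<in> ball (0, 0) \<epsilon> \<longrightarrow> h (u, v) = v ^ 2 + s * u ^ k + f (u, v)) \<longrightarrow>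
        (\<forall>u v. (u, v) \<in> ball (0, 0) \<epsilon> \<longrightarrow>
           \<bar>f (u, v)\<bar> \<le> A * (\<bar>v\<bar> ^ 3 + \<bar>v\<bar> ^ 2 * \<bar>u\<bar> + \<bar>u\<bar> ^ (k + 1))) \<longrightarrow>
        (\<forall>a b u v. (u, v) \<in> ball (0, 0) \<epsilon> \<longrightarrow>
           \<bar>partial_deriv a b f (u, v)\<bar> \<le> c a b * min (\<epsilon> powi (3 - int (a + b))) 1) \<longrightarrow>
        \<bar>x1\<bar> \<le> 10 * \<epsilon> * lam \<longrightarrow> \<bar>x2\<bar> \<le> 10 * \<epsilon> * lam \<longrightarrow>
        cmod (osc_integral \<beta> (phase h x1 x2 lam) lam)
          \<le> C (supp \<beta>) (CN_norm 2 \<beta>) * lam powr (- 1 / 2 - 1 / real k)"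
  proof (intro exI[of _ "1 / (1000 * K ^ 3)"] conjI pos
      exI[of _ "\<lambda>S M. (56 * vdC_const k * vdC_const 2 * K ^ 3 + 8) * M"] allI impI)
    fix \<epsilon> lam s x1 x2 :: real and \<beta> h f :: "real \<times> real \<Rightarrow> real"
    assume "0 < \<epsilon>" "\<epsilon> < 1 / (1000 * K ^ 3)" "lam \<ge> 1"
      "test_function_on (ball (0, 0) \<epsilon>) \<beta>" "smooth_on UNIV h" "s \<in> {1, -1}"
      and "\<forall>u v. (u, v) \<in> ball (0, 0) \<epsilon> \<longrightarrow> h (u, v) = v ^ 2 + s * u ^ k + f (u, v)"
      "\<forall>u v. (u, v) \<in> ball (0, 0) \<epsilon> \<longrightarrow>
        \<bar>f (u, v)\<bar> \<le> A * (\<bar>v\<bar> ^ 3 + \<bar>v\<bar> ^ 2 * \<bar>u\<bar> + \<bar>u\<bar> ^ (k + 1))"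
      "\<forall>a b u v. (u, v) \<in> ball (0, 0) \<epsilon> \<longrightarrow>
        \<bar>partial_deriv a b f (u, v)\<bar> \<le> c a b * min (\<epsilon> powi (3 - int (a + b))) 1"
    then show "cmod (osc_integral \<beta> (phase h x1 x2 lam) lam)
        \<le> (56 * vdC_const k * vdC_const 2 * K ^ 3 + 8) * CN_norm 2 \<beta> * lam powr (- 1 / 2 - 1 / real k)"
      unfolding K_def by (intro degenerate_phase_bound[OF k, where \<epsilon> = \<epsilon> and f = f and s = s and A = A]) blast+
  qed
qed

end
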